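(* Let $q \in \mathbb{R}$ with $q^2 < 1/3$. Then there exist $M_0, \varepsilon_0 > 0$ such that for all $\varepsilon \in (0,\varepsilon_0)$ and all $v_0 \in C^2_{\mathrm{ub}}(\mathbb{R},\mathbb{C})$ with $\|v_0\|_{W^{2,\infty}} < \varepsilon$ there exists a global classical solution $$A \in C^1\big([0,\infty),C_{\mathrm{ub}}(\mathbb{R},\mathbb{C})\big) \cap C\big([0,\infty), C^2_{\mathrm{ub}}(\mathbb{R},\mathbb{C})\big)$$ of the real Ginzburg-Landau equation $$\partial_t A = \partial_x^2 A + A - A|A|^2, \qquad x \in \mathbb{R},\ t \geq 0,\ A(x,t) \in \mathbb{C},$$ with initial condition $A(x,0) = \sqrt{1-q^2}\,\mathrm{e}^{\mathrm{i}qx} + v_0(x)$, satisfying $$\sup_{x \in \mathbb{R}} \left|A(x,t) - \sqrt{1-q^2}\,\mathrm{e}^{\mathrm{i}qx}\right| \leq M_0 \varepsilon \qquad \text{for all } t \geq 0.$$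
   Context: For $m \in \mathbb{N}_0$, $C^m_{\mathrm{ub}}(\mathbb{R},E)$ denotes the space of functions $\mathbb{R}\to E$ that are $m$ times differentiable and which, together with their first $m$ derivatives, are bounded and uniformly continuous, equipped with the $W^{m,\infty}$-norm; $C_{\mathrm{ub}} = C^0_{\mathrm{ub}}$. *)

theory Defs
  imports "HOL-Analysis.Analysis"
begin

definition iter_vderiv :: "nat \<Rightarrow> (real \<Rightarrow> 'a::real_normed_vector) \<Rightarrow> real \<Rightarrow> 'a" where
  "iter_vderiv j = ((\<lambda>g x. vector_derivative g (at x)) ^^ j)"

definition C_ub :: "nat \<Rightarrow> (real \<Rightarrow> 'a::real_normed_vector) set" where
  "C_ub m = {f. (\<forall>j<m. \<forall>x. iter_vderiv j f differentiable (at x)) \<and>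
                (\<forall>j\<le>m. bounded (range (iter_vderiv j f)) \<and>
                        uniformly_continuous_on UNIV (iter_vderiv j f))}"

(* The supremum is only meaningful for bounded derivatives, so W_norm m is used for elements of
   C_ub m only.  For continuous functions it coincides with the essential supremum. *)
definition W_norm :: "nat \<Rightarrow> (real \<Rightarrow> 'a::real_normed_vector) \<Rightarrow> real" where
  "W_norm m f = (MAX j\<in>{..m}. SUP x. norm (iter_vderiv j f x))"

(* The space C([0,\<infinity>), C_ub m(\<real>, E)), with a curve written as A t x.  Values at negative t are
   irrelevant. *)
definition C0_time :: "nat \<Rightarrow> (real \<Rightarrow> real \<Rightarrow> 'a::real_normed_vector) set" where
  "C0_time m = {A. (\<forall>t\<ge>0. A t \<in> C_ub m) \<and>
                   (\<forall>t\<ge>0. ((\<lambda>s. W_norm m (\<lambda>x. A s x - A t x)) \<longlongrightarrow> 0) (at t within {0..}))}"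

(* The space C^1([0,\<infinity>), C_ub m(\<real>, E)): the difference quotients converge in the norm of
   C_ub m (one-sidedly at t = 0), and the derivative B is continuous in that norm. *)
definition C1_time :: "nat \<Rightarrow> (real \<Rightarrow> real \<Rightarrow> 'a::real_normed_vector) set" where
  "C1_time m = {A. A \<in> C0_time m \<and>
                   (\<exists>B\<in>C0_time m. \<forall>t\<ge>0.
                      ((\<lambda>s. W_norm m (\<lambda>x. (A s x - A t x) /\<^sub>R (s - t) - B t x)) \<longlongrightarrow> 0)
                        (at t within {0..}))}"

definition GL_classical_solution :: "(real \<Rightarrow> real \<Rightarrow> complex) \<Rightarrow> bool" where
  "GL_classical_solution A \<longleftrightarrow>
     A \<in> C1_time 0 \<and> A \<in> C0_time 2 \<and>
     (\<forall>t\<ge>0. \<forall>x. ((\<lambda>s. A s x) has_vector_derivative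
                   (iter_vderiv 2 (A t) x + A t x - A t x * complex_of_real ((cmod (A t x))\<^sup>2)))
                 (at t within {0..}))"

definition periodic_wave :: "real \<Rightarrow> real \<Rightarrow> complex" where
  "periodic_wave q x = complex_of_real (sqrt (1 - q\<^sup>2)) * exp (\<i> * complex_of_real (q * x))"

end

theory Submission
  imports Defs "HOL-Probability.Distributions"
begin

text \<open>
  Write \<open>A = sqrt (1 - q\<^sup>2) * exp (\<i> q x) * exp w\<close> with \<open>w = u + \<i> p\<close>, so that, with \<open>a = 1 - q\<^sup>2\<close>,
  \<open>w\<^sub>t = w\<^sub>x\<^sub>x + 2 \<i> q w\<^sub>x + w\<^sub>x\<^sup>2 + a (1 - exp (2 u))\<close>.
  As long as \<open>w\<close> is uniformly small, every nonlinear term is absorbed by the dissipation in localized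
  energy estimates: with the weight \<open>\<rho> x = 1 / (1 + k\<^sup>2 (x - y)\<^sup>2)\<close>, which satisfies \<open>\<bar>\<rho>'\<bar> \<le> k \<rho>\<close>, and
  \<open>k\<^sup>2 = 1 / (1 + T)\<close>, the functional \<open>(\<integral> \<rho> \<bar>w\<bar>\<^sup>2) / c + (1 + t) \<integral> \<rho> \<bar>w\<^sub>x\<bar>\<^sup>2\<close> grows at most by a constant
  factor on \<open>[0, T]\<close>.  Coercivity of the linear part is positivity of the quadratic form
  \<open>p\<^sub>x\<^sup>2 + 4 q u p\<^sub>x + 2 a u\<^sup>2\<close>, that is, the Eckhaus condition \<open>q\<^sup>2 < 1/3\<close>.  The interpolation
  \<open>\<bar>w y\<bar>\<^sup>2 \<le> 2 k \<integral> \<rho> \<bar>w\<bar>\<^sup>2 + (\<integral> \<rho> \<bar>w\<^sub>x\<bar>\<^sup>2) / k\<close> then bounds \<open>w\<close> at time \<open>T\<close> by a constant times its initial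
  size, uniformly in \<open>T\<close>, and a continuity argument in time concludes.  Existence is obtained for the
  equation with nonlinearity truncated outside the disc of radius 2, by Picard iteration on the heat
  semigroup; the truncation is never active.
\<close>

section \<open>Parameter integrals and integration on the line\<close>

text \<open>The perturbation is merely bounded, so no global energy is finite, and the phase
  \<open>p\<close> is undamped, so exponential decay is out of reach. Two features of the
  logarithmic variable compensate. By phase invariance \<open>p\<close> enters the equation only
  through its derivatives, and the nonlinear terms are quadratic in \<open>w_x\<close> and in
  \<open>u\<close>, which are exactly the dissipated quantities. Hence a small supremum of
  \<open>w\<close> suffices to absorb them; the fourth powers of \<open>w_x\<close> that appear one
  derivative higher are handled by a Gagliardo-Nirenberg inequality with the same small factor. No
  smallness of \<open>w_x\<close> at positive times is ever assumed, so the continuity argument has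
  to watch a single quantity, the supremum of the perturbation. Localizing to length
  \<open>1 / k\<close>, the diffusive length at time \<open>T\<close>, costs three things that
  balance: errors of relative size \<open>k\<^sup>2\<close> accumulated up to time \<open>T\<close>,
  the mass of the weight in the initial energy, and the factor \<open>1 / k\<close> in front of the
  gradient in the interpolation. The weight \<open>1 + t\<close> on the gradient energy encodes the
  diffusive decay that makes the last one affordable.\<close>

lemma uniformly_continuous_on_param_integral:
  fixes g :: "real \<Rightarrow> real \<Rightarrow> complex" and m a b :: "'b \<Rightarrow> real"
  assumes m: "integrable M m" and a [measurable]: "a \<in> borel_measurable M"
    and b [measurable]: "b \<in> borel_measurable M"
    and a01: "\<And>\<omega>. m \<omega> \<noteq> 0 \<Longrightarrow> 0 \<le> a \<omega> \<and> a \<omega> \<le> 1"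
    and g: "continuous_on UNIV (case_prod g)"
    and ug: "uniformly_continuous_on ({0..T} \<times> UNIV) (case_prod g)"
    and bd: "\<And>t x. t \<in> {0..T} \<Longrightarrow> norm (g t x) \<le> C"
  shows "uniformly_continuous_on ({0..T} \<times> UNIV)
    (\<lambda>(t,x). \<integral>\<omega>. m \<omega> *\<^sub>R g (t * a \<omega>) (x + sqrt t * b \<omega>) \<partial>M)"
proof -
  have [measurable]: "case_prod g \<in> borel_measurable (borel \<Otimes>\<^sub>M borel)"
    using borel_measurable_continuous_onI[OF g] by (simp add: borel_prod)
  have [measurable]: "m \<in> borel_measurable M" using m by simp
  have gm [measurable]: "(\<lambda>\<omega>. g (t * a \<omega>) (x + sqrt t * b \<omega>)) \<in> borel_measurable M" for t x
  proof -
    have "(\<lambda>\<omega>. case_prod g (t * a \<omega>, x + sqrt t * b \<omega>)) \<in> borel_measurable M" by measurable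
    then show ?thesis by simp
  qed
  have bd': "norm (m \<omega> *\<^sub>R g (t * a \<omega>) (x + sqrt t * b \<omega>)) \<le> C * \<bar>m \<omega>\<bar>" if "t \<in> {0..T}" for t x \<omega>
  proof (cases "m \<omega> = 0")
    case False
    have "t * a \<omega> \<in> {0..T}" using that a01[OF False]
      by (auto intro: order_trans[OF mult_left_le])
    then show ?thesis using bd[of "t * a \<omega>" "x + sqrt t * b \<omega>"]
      by (metis abs_ge_zero mult.commute mult_left_mono norm_scaleR)
  qed simp
  have int: "integrable M (\<lambda>\<omega>. m \<omega> *\<^sub>R g (t * a \<omega>) (x + sqrt t * b \<omega>))" if "t \<in> {0..T}" for t x
    by (rule Bochner_Integration.integrable_bound[of _ "\<lambda>\<omega>. C * \<bar>m \<omega>\<bar>"])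
      (use m bd'[OF that] in \<open>auto intro!: AE_I2 order_trans[OF _ abs_ge_self]\<close>)
  show ?thesis
    unfolding uniformly_continuous_on_sequentially
  proof (intro allI impI, elim conjE)
    fix X Y :: "nat \<Rightarrow> real \<times> real"
    assume X: "\<forall>n. X n \<in> {0..T} \<times> UNIV" and Y: "\<forall>n. Y n \<in> {0..T} \<times> UNIV"
      and XY: "(\<lambda>n. dist (X n) (Y n)) \<longlonglongrightarrow> 0"
    define t where "t n = fst (X n)" for n
    define x where "x n = snd (X n)" for n
    define s where "s n = fst (Y n)" for n
    define y where "y n = snd (Y n)" for n
    have tT: "t n \<in> {0..T}" "s n \<in> {0..T}" for n
      using X Y by (auto simp: t_def s_def mem_Times_iff)
    have d1: "(\<lambda>n. t n - s n) \<longlonglongrightarrow> 0"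
      by (rule Lim_null_comparison[OF _ XY], rule always_eventually)
        (metis t_def s_def dist_fst_le dist_norm)
    have d2: "(\<lambda>n. x n - y n) \<longlonglongrightarrow> 0"
      by (rule Lim_null_comparison[OF _ XY], rule always_eventually)
        (metis x_def y_def dist_snd_le dist_norm)
    \<comment> \<open>The square root is not Lipschitz at 0; its Hoelder bound with exponent 1/2 is
      what carries uniform continuity down to time 0.\<close>
    have d3: "(\<lambda>n. sqrt (t n) - sqrt (s n)) \<longlonglongrightarrow> 0"
    proof (rule Lim_null_comparison)
      have "\<bar>sqrt p - sqrt r\<bar> \<le> sqrt \<bar>p - r\<bar>" if "0 \<le> p" "0 \<le> r" for p r :: real
      proof -
        have *: "sqrt p - sqrt r \<le> sqrt (p - r)" if "0 \<le> r" "r \<le> p" for p r :: real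
          using sqrt_add_le_add_sqrt[of "p - r" r] that by simp
        show ?thesis using *[of p r] *[of r p] that by (cases "r \<le> p") (auto simp: abs_if)
      qed
      then show "\<forall>\<^sub>F n in sequentially. norm (sqrt (t n) - sqrt (s n)) \<le> sqrt \<bar>t n - s n\<bar>"
        using tT by auto
      show "(\<lambda>n. sqrt \<bar>t n - s n\<bar>) \<longlonglongrightarrow> 0"
        using tendsto_real_sqrt[OF tendsto_rabs[OF d1]] by simp
    qed
    define h where "h n \<omega> = m \<omega> *\<^sub>R g (t n * a \<omega>) (x n + sqrt (t n) * b \<omega>)
      - m \<omega> *\<^sub>R g (s n * a \<omega>) (y n + sqrt (s n) * b \<omega>)" for n \<omega>
    \<comment> \<open>The shift \<open>sqrt t * b \<omega>\<close> may be unbounded in \<omega>, so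
      the two arguments of \<open>g\<close> approach each other only for each fixed \<omega>.
      Dominated convergence makes this sufficient.\<close>
    have "(\<lambda>n. \<integral>\<omega>. h n \<omega> \<partial>M) \<longlonglongrightarrow> (\<integral>\<omega>. 0 \<partial>M)"
    proof (rule integral_dominated_convergence[where w = "\<lambda>\<omega>. 2 * (C * \<bar>m \<omega>\<bar>)"])
      show "AE \<omega> in M. (\<lambda>n. h n \<omega>) \<longlonglongrightarrow> 0"
      proof (rule AE_I2)
        fix \<omega>
        show "(\<lambda>n. h n \<omega>) \<longlonglongrightarrow> 0"
        proof (cases "m \<omega> = 0")
          case False
          define P where "P n = (t n * a \<omega>, x n + sqrt (t n) * b \<omega>)" for n
          define R where "R n = (s n * a \<omega>, y n + sqrt (s n) * b \<omega>)" for n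
          have PR: "P n \<in> {0..T} \<times> UNIV" "R n \<in> {0..T} \<times> UNIV" for n
            using tT[of n] a01[OF False] by (auto simp: P_def R_def intro: order_trans[OF mult_left_le])
          have "(\<lambda>n. (t n - s n) * a \<omega>) \<longlonglongrightarrow> 0" using tendsto_mult_right[OF d1, of "a \<omega>"] by simp
          moreover have "(\<lambda>n. (x n - y n) + (sqrt (t n) - sqrt (s n)) * b \<omega>) \<longlonglongrightarrow> 0"
            using tendsto_add[OF d2 tendsto_mult_right[OF d3, of "b \<omega>"]] by simp
          ultimately have "(\<lambda>n. P n - R n) \<longlonglongrightarrow> (0, 0)"
            by (auto simp: P_def R_def algebra_simps dest: tendsto_Pair)
          then have "(\<lambda>n. dist (P n) (R n)) \<longlonglongrightarrow> 0"
            by (simp add: dist_norm tendsto_norm_zero zero_prod_def)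
          then have "(\<lambda>n. dist (case_prod g (P n)) (case_prod g (R n))) \<longlonglongrightarrow> 0"
            using ug PR unfolding uniformly_continuous_on_sequentially by blast
          then have "(\<lambda>n. case_prod g (P n) - case_prod g (R n)) \<longlonglongrightarrow> 0"
            by (simp add: dist_norm tendsto_norm_zero_iff)
          from tendsto_scaleR[OF tendsto_const[of "m \<omega>"] this] show ?thesis
            by (simp add: h_def P_def R_def scaleR_diff_right)
        qed (simp add: h_def)
      qed
      show "AE \<omega> in M. norm (h n \<omega>) \<le> 2 * (C * \<bar>m \<omega>\<bar>)" for n
      proof (rule AE_I2)
        fix \<omega>
        have "norm (h n \<omega>) \<le> C * \<bar>m \<omega>\<bar> + C * \<bar>m \<omega>\<bar>"
          unfolding h_def by (rule order_trans[OF norm_triangle_ineq4 add_mono[OF bd'[OF tT(1)] bd'[OF tT(2)]]])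
        then show "norm (h n \<omega>) \<le> 2 * (C * \<bar>m \<omega>\<bar>)" by simp
      qed
      show "h n \<in> borel_measurable M" for n unfolding h_def[abs_def] by measurable
      show "integrable M (\<lambda>\<omega>. 2 * (C * \<bar>m \<omega>\<bar>))" using m by simp
    qed simp
    moreover have "(\<integral>\<omega>. h n \<omega> \<partial>M) = (\<integral>\<omega>. m \<omega> *\<^sub>R g (t n * a \<omega>) (x n + sqrt (t n) * b \<omega>) \<partial>M)
        - (\<integral>\<omega>. m \<omega> *\<^sub>R g (s n * a \<omega>) (y n + sqrt (s n) * b \<omega>) \<partial>M)" for n
      unfolding h_def by (rule Bochner_Integration.integral_diff[OF int[OF tT(1)] int[OF tT(2)]])
    ultimately have "(\<lambda>n. norm ((\<integral>\<omega>. m \<omega> *\<^sub>R g (t n * a \<omega>) (x n + sqrt (t n) * b \<omega>) \<partial>M)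
        - (\<integral>\<omega>. m \<omega> *\<^sub>R g (s n * a \<omega>) (y n + sqrt (s n) * b \<omega>) \<partial>M))) \<longlonglongrightarrow> 0"
      by (intro tendsto_norm_zero) simp
    then show "(\<lambda>n. dist (case X n of (t, x) \<Rightarrow> \<integral>\<omega>. m \<omega> *\<^sub>R g (t * a \<omega>) (x + sqrt t * b \<omega>) \<partial>M)
        (case Y n of (t, x) \<Rightarrow> \<integral>\<omega>. m \<omega> *\<^sub>R g (t * a \<omega>) (x + sqrt t * b \<omega>) \<partial>M)) \<longlonglongrightarrow> 0"
      unfolding case_prod_beta dist_norm t_def x_def s_def y_def .
  qed
qed

section \<open>Differentiation under the integral sign and vanishing boundary terms\<close>

lemma has_vector_derivative_iff_quotient:
  fixes f :: "real \<Rightarrow> 'a::real_normed_vector"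
  shows "(f has_vector_derivative d) (at x within S) \<longleftrightarrow>
    ((\<lambda>y. (f y - f x) /\<^sub>R (y - x)) \<longlongrightarrow> d) (at x within S)"
proof -
  have "(f has_vector_derivative d) (at x within S) \<longleftrightarrow>
     ((\<lambda>y. norm (f y - f x - (y - x) *\<^sub>R d) / norm (y - x)) \<longlongrightarrow> 0) (at x within S)"
    unfolding has_vector_derivative_def has_derivative_iff_norm
    by (simp add: bounded_linear_scaleR_left)
  also have "\<dots> \<longleftrightarrow> ((\<lambda>y. norm ((f y - f x) /\<^sub>R (y - x) - d)) \<longlongrightarrow> 0) (at x within S)"
  proof (rule filterlim_cong[OF refl refl])
    show "\<forall>\<^sub>F y in at x within S. norm (f y - f x - (y - x) *\<^sub>R d) / norm (y - x) = norm ((f y - f x) /\<^sub>R (y - x) - d)"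
      unfolding eventually_at_filter
    proof (intro always_eventually allI impI)
      fix y assume "y \<noteq> x"
      then have "(f y - f x) /\<^sub>R (y - x) - d = (f y - f x - (y - x) *\<^sub>R d) /\<^sub>R (y - x)"
        by (simp add: scaleR_diff_right)
      then show "norm (f y - f x - (y - x) *\<^sub>R d) / norm (y - x) = norm ((f y - f x) /\<^sub>R (y - x) - d)"
        by (simp add: divide_inverse mult.commute)
    qed
  qed
  also have "\<dots> \<longleftrightarrow> ((\<lambda>y. (f y - f x) /\<^sub>R (y - x)) \<longlongrightarrow> d) (at x within S)"
    by (simp add: tendsto_norm_zero_iff LIM_zero_iff)
  finally show ?thesis .
qed

lemma vector_derivative_lipschitz:
  fixes f :: "real \<Rightarrow> 'a::real_normed_vector"
  assumes "convex S" "\<And>y. y \<in> S \<Longrightarrow> (f has_vector_derivative f' y) (at y within S)"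
    and "\<And>y. y \<in> S \<Longrightarrow> norm (f' y) \<le> B" and "x \<in> S" "y \<in> S"
  shows "norm (f y - f x) \<le> B * \<bar>y - x\<bar>"
proof -
  have "onorm (\<lambda>h. h *\<^sub>R f' z) \<le> B" if "z \<in> S" for z
    using onorm_scaleR_left[OF bounded_linear_ident, of "f' z"] assms(3)[OF that] 
    by (simp add: onorm_id)
  then show ?thesis
    using differentiable_bound[of S f "\<lambda>z h. h *\<^sub>R f' z" B y x] assms
    by (simp add: has_vector_derivative_def)
qed

text \<open>The mean value inequality on the convex set \<open>S\<close> turns the bound
  \<open>H\<close> on the derivative into a majorant of the difference quotients, so dominated
  convergence applies. Working within \<open>S\<close> covers one-sided time derivatives at the ends
  of an interval as well as space derivatives with \<open>S = UNIV\<close>.\<close>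

lemma has_vector_derivative_integral:
  fixes F F' :: "real \<Rightarrow> 'b \<Rightarrow> 'a::{banach, second_countable_topology}"
  assumes S: "convex S" "x \<in> S"
    and der: "\<And>y \<omega>. y \<in> S \<Longrightarrow> ((\<lambda>y. F y \<omega>) has_vector_derivative F' y \<omega>) (at y within S)"
    and bd: "\<And>y \<omega>. y \<in> S \<Longrightarrow> norm (F' y \<omega>) \<le> H \<omega>"
    and int: "\<And>y. y \<in> S \<Longrightarrow> integrable M (F y)" and H: "integrable M H"
    and meas [measurable]: "F' x \<in> borel_measurable M"
  shows "((\<lambda>y. \<integral>\<omega>. F y \<omega> \<partial>M) has_vector_derivative (\<integral>\<omega>. F' x \<omega> \<partial>M)) (at x within S)"
  unfolding has_vector_derivative_iff_quotient tendsto_at_iff_sequentially comp_def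
proof (intro allI impI)
  fix X :: "nat \<Rightarrow> real" assume X: "\<forall>i. X i \<in> S - {x}" "X \<longlonglongrightarrow> x"
  have "(\<lambda>i. \<integral>\<omega>. (F (X i) \<omega> - F x \<omega>) /\<^sub>R (X i - x) \<partial>M) \<longlonglongrightarrow> (\<integral>\<omega>. F' x \<omega> \<partial>M)"
  proof (rule integral_dominated_convergence[where w = H])
    show "AE \<omega> in M. (\<lambda>i. (F (X i) \<omega> - F x \<omega>) /\<^sub>R (X i - x)) \<longlonglongrightarrow> F' x \<omega>"
      using der[OF S(2), unfolded has_vector_derivative_iff_quotient tendsto_at_iff_sequentially comp_def] X
      by auto
    show "AE \<omega> in M. norm ((F (X i) \<omega> - F x \<omega>) /\<^sub>R (X i - x)) \<le> H \<omega>" for i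
    proof (rule AE_I2)
      fix \<omega>
      have "norm (F (X i) \<omega> - F x \<omega>) \<le> H \<omega> * \<bar>X i - x\<bar>"
        by (rule vector_derivative_lipschitz[OF S(1) der bd]) (use X S in auto)
      moreover have "X i - x \<noteq> 0" using X by auto
      ultimately show "norm ((F (X i) \<omega> - F x \<omega>) /\<^sub>R (X i - x)) \<le> H \<omega>"
        by (simp add: divide_simps mult.commute)
    qed
    show "(\<lambda>\<omega>. (F (X i) \<omega> - F x \<omega>) /\<^sub>R (X i - x)) \<in> borel_measurable M" for i
      using int[of "X i"] int[of x] X S by auto
  qed (use H in auto)
  moreover have "(\<integral>\<omega>. (F (X i) \<omega> - F x \<omega>) /\<^sub>R (X i - x) \<partial>M) = ((\<integral>\<omega>. F (X i) \<omega> \<partial>M) - (\<integral>\<omega>. F x \<omega> \<partial>M)) /\<^sub>R (X i - x)" for i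
    using int[of "X i"] int[of x] X S by (simp add: Bochner_Integration.integral_diff)
  ultimately show "(\<lambda>i. ((\<integral>\<omega>. F (X i) \<omega> \<partial>M) - (\<integral>\<omega>. F x \<omega> \<partial>M)) /\<^sub>R (X i - x)) \<longlonglongrightarrow> (\<integral>\<omega>. F' x \<omega> \<partial>M)"
    by (simp only:)
qed

lemma integral_derivative_eq_0:
  fixes J J' :: "real \<Rightarrow> 'a::euclidean_space"
  assumes der: "\<And>x. (J has_vector_derivative J' x) (at x)" and cont: "continuous_on UNIV J'"
    and int: "integrable lborel J'" and lim: "(J \<longlongrightarrow> 0) at_top" "(J \<longlongrightarrow> 0) at_bot"
  shows "(\<integral>x. J' x \<partial>lborel) = 0"
proof -
  have "(LBINT x=-\<infinity>..\<infinity>. J' x) = 0 - 0"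
  proof (rule interval_integral_FTC_integrable)
    show "isCont J' x" for x using cont by (simp add: continuous_on_eq_continuous_at)
    show "set_integrable lborel (einterval (-\<infinity>) \<infinity>) J'" using int by (simp add: set_integrable_def)
    show "((J \<circ> real_of_ereal) \<longlongrightarrow> 0) (at_right (- \<infinity>))"
      using lim(2) by (simp add: ereal_tendsto_simps comp_assoc)
    show "((J \<circ> real_of_ereal) \<longlongrightarrow> 0) (at_left \<infinity>)"
      using lim(1) by (simp add: ereal_tendsto_simps comp_assoc)
  qed (use der in auto)
  then show ?thesis by (simp add: interval_lebesgue_integral_def set_lebesgue_integral_def)
qed

section \<open>Localized weights\<close>

text \<open>A class closed under every operation occurring in the energy integrands, whose members
  are all integrable against the weight. Integrability conditions thereby reduce to
  \<open>bcont_intros\<close>.\<close>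

definition bcont :: "(real \<Rightarrow> real) \<Rightarrow> bool" where
  "bcont h \<longleftrightarrow> continuous_on UNIV h \<and> bounded (range h)"

lemma bcontI: "continuous_on UNIV h \<Longrightarrow> (\<And>x. \<bar>h x\<bar> \<le> B) \<Longrightarrow> bcont h"
  by (auto simp: bcont_def bounded_iff)

lemma bcontE: assumes "bcont h" obtains B where "0 \<le> B" "\<And>x. \<bar>h x\<bar> \<le> B"
proof -
  obtain B where "\<And>x. \<bar>h x\<bar> \<le> B" using assms by (auto simp: bcont_def bounded_iff)
  moreover from this[of 0] have "0 \<le> B" by linarith
  ultimately show ?thesis using that by blast
qed

lemma bcont_intros:
  "bcont (\<lambda>x. c)"
  "bcont f \<Longrightarrow> bcont g \<Longrightarrow> bcont (\<lambda>x. f x + g x)"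
  "bcont f \<Longrightarrow> bcont g \<Longrightarrow> bcont (\<lambda>x. f x - g x)"
  "bcont f \<Longrightarrow> bcont (\<lambda>x. - f x)"
  "bcont f \<Longrightarrow> bcont g \<Longrightarrow> bcont (\<lambda>x. f x * g x)"
  "bcont f \<Longrightarrow> bcont (\<lambda>x. (f x) ^ n)"
  "bcont f \<Longrightarrow> bcont (\<lambda>x. \<bar>f x\<bar>)"
  "bcont f \<Longrightarrow> bcont (\<lambda>x. exp (f x))"
proof -
  show "bcont (\<lambda>x. c)" by (rule bcontI[of _ "\<bar>c\<bar>"]) auto
  show "bcont (\<lambda>x. f x + g x)" if "bcont f" "bcont g"
    using that unfolding bcont_def by (auto intro!: continuous_intros bounded_plus_comp)
  show "bcont (\<lambda>x. f x - g x)" if "bcont f" "bcont g"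
    using that unfolding bcont_def by (auto intro!: continuous_intros bounded_minus_comp)
  show "bcont (\<lambda>x. - f x)" if "bcont f"
    using that unfolding bcont_def by (auto intro!: continuous_intros simp: bounded_iff)
  show m: "bcont (\<lambda>x. f x * g x)" if fg: "bcont f" "bcont g" for f g
  proof -
    obtain B C where "0 \<le> B" "\<And>x. \<bar>f x\<bar> \<le> B" "0 \<le> C" "\<And>x. \<bar>g x\<bar> \<le> C" using fg by (metis bcontE)
    then have "\<bar>f x * g x\<bar> \<le> B * C" for x by (simp add: abs_mult mult_mono)
    then show ?thesis using fg by (intro bcontI[of _ "B * C"]) (auto simp: bcont_def intro!: continuous_intros)
  qed
  show "bcont (\<lambda>x. (f x) ^ n)" if "bcont f"
  proof (induction n)
    case 0
    show ?case by (rule bcontI[of _ 1]) auto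
  next
    case (Suc n)
    show ?case using m[OF that Suc] by simp
  qed
  show "bcont (\<lambda>x. \<bar>f x\<bar>)" if "bcont f"
    using that unfolding bcont_def by (auto intro!: continuous_intros simp: bounded_iff)
  show "bcont (\<lambda>x. exp (f x))" if f: "bcont f"
  proof -
    obtain B where "0 \<le> B" "\<And>x. \<bar>f x\<bar> \<le> B" using f by (metis bcontE)
    then have "\<bar>exp (f x)\<bar> \<le> exp B" for x by (auto intro: order_trans[OF abs_ge_self])
    then show ?thesis using f by (intro bcontI[of _ "exp B"]) (auto simp: bcont_def intro!: continuous_intros)
  qed
qed

text \<open>A Lorentzian of mass \<open>pi / k\<close>. It is smooth, unlike
  \<open>exp (- k * \<bar>x - y\<bar>)\<close>, and its logarithmic derivative is bounded by
  \<open>k\<close>, unlike that of a Gaussian.\<close>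

definition loc_weight :: "real \<Rightarrow> real \<Rightarrow> real \<Rightarrow> real" where
  "loc_weight k y x = inverse (1 + (k * (x - y))\<^sup>2)"

definition log_slope :: "real \<Rightarrow> real \<Rightarrow> real \<Rightarrow> real" where
  "log_slope k y x = - 2 * k * (k * (x - y)) / (1 + (k * (x - y))\<^sup>2)"

lemma one_plus_square_pos: "0 < 1 + (x::real)\<^sup>2"
  by (simp add: add_pos_nonneg)

lemma loc_weight_pos: "0 < loc_weight k y x"
  by (simp add: loc_weight_def one_plus_square_pos)

lemma loc_weight_at: "loc_weight k y y = 1"
  by (simp add: loc_weight_def)

lemma loc_weight_deriv:
  "(loc_weight k y has_real_derivative loc_weight k y x * log_slope k y x) (at x)"
proof -
  define z where "z = 1 + (k * (x - y))\<^sup>2"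
  have z: "z \<noteq> 0" using one_plus_square_pos[of "k * (x - y)"] by (simp add: z_def)
  have "((\<lambda>x. 1 + (k * (x - y))\<^sup>2) has_real_derivative 2 * k * (k * (x - y))) (at x)"
    by (auto intro!: derivative_eq_intros)
  from DERIV_inverse'[OF this] z
  have "(loc_weight k y has_real_derivative - (inverse z * (2 * k * (k * (x - y))) * inverse z)) (at x)"
    by (simp add: z_def loc_weight_def[abs_def])
  moreover have "- (inverse z * (2 * k * (k * (x - y))) * inverse z) = loc_weight k y x * log_slope k y x"
    by (simp add: loc_weight_def log_slope_def z_def[symmetric] divide_inverse)
  ultimately show ?thesis by simp
qed

lemma abs_log_slope: "0 \<le> k \<Longrightarrow> \<bar>log_slope k y x\<bar> \<le> k"
proof -
  assume k: "0 \<le> k"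
  define z where "z = k * (x - y)"
  have "2 * \<bar>z\<bar> \<le> 1 + z\<^sup>2" using zero_le_power2[of "\<bar>z\<bar> - 1"] by (simp add: power2_diff)
  then have "\<bar>z\<bar> * 2 / (1 + z\<^sup>2) \<le> 1" using one_plus_square_pos[of z] by (simp add: field_simps)
  then have "k * (\<bar>z\<bar> * 2 / (1 + z\<^sup>2)) \<le> k * 1" using k by (rule mult_left_mono)
  moreover have "\<bar>log_slope k y x\<bar> = k * (\<bar>z\<bar> * 2 / (1 + z\<^sup>2))"
    using k one_plus_square_pos[of z] by (simp add: log_slope_def z_def[symmetric] abs_mult abs_of_pos)
  ultimately show ?thesis by simp
qed

lemma bcont_log_slope: "0 \<le> k \<Longrightarrow> bcont (log_slope k y)"
  by (rule bcontI[OF _ abs_log_slope])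
    (auto simp: log_slope_def intro!: continuous_intros less_imp_neq[OF one_plus_square_pos, symmetric])

lemma continuous_loc_weight: "continuous_on UNIV (loc_weight k y)"
  unfolding loc_weight_def by (auto intro!: continuous_intros less_imp_neq[OF one_plus_square_pos, symmetric])

lemma has_bochner_integral_loc_weight:
  assumes "0 < k"
  shows "has_bochner_integral lborel (loc_weight k y) (pi / k)"
proof -
  have at: "(arctan \<longlongrightarrow> pi / 2) at_top" "(arctan \<longlongrightarrow> - (pi / 2)) at_bot"
    by (rule tendsto_arctan_at_top tendsto_arctan_at_bot)+
  have der: "(arctan has_real_derivative inverse (1 + x\<^sup>2)) (at x)" for x
    by (auto intro!: derivative_eq_intros)
  have ic: "isCont (\<lambda>x. inverse (1 + x\<^sup>2)) x" for x :: real
    using one_plus_square_pos[of x] by (intro continuous_intros) simp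
  have lim: "((arctan \<circ> real_of_ereal) \<longlongrightarrow> - (pi / 2)) (at_right (-\<infinity>))" "((arctan \<circ> real_of_ereal) \<longlongrightarrow> pi / 2) (at_left \<infinity>)"
    using at by (simp_all add: ereal_tendsto_simps comp_assoc)
  have nn: "AE x in lborel. -\<infinity> < ereal x \<longrightarrow> ereal x < \<infinity> \<longrightarrow> 0 \<le> inverse (1 + x\<^sup>2)"
    using one_plus_square_pos by (intro AE_I2) (simp add: less_imp_le)
  note ftc = interval_integral_FTC_nonneg[of "-\<infinity>" \<infinity> arctan, OF _ der ic nn lim, simplified]
  have "set_integrable lborel UNIV (\<lambda>x::real. inverse (1 + x\<^sup>2))" "(LBINT x. inverse (1 + x\<^sup>2)) = pi"
    using ftc by (simp_all add: interval_lebesgue_integral_def set_lebesgue_integral_def)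
  then have "has_bochner_integral lborel (\<lambda>x::real. inverse (1 + x\<^sup>2)) pi"
    by (simp add: has_bochner_integral_iff set_integrable_def)
  from lborel_has_bochner_integral_real_affine_iff[of k, THEN iffD1, OF _ this, of "- k * y"]
  show ?thesis using assms by (simp add: loc_weight_def[abs_def] algebra_simps divide_inverse)
qed

lemma loc_weight_tendsto:
  assumes "0 < k"
  shows "(loc_weight k y \<longlongrightarrow> 0) at_top" "(loc_weight k y \<longlongrightarrow> 0) at_bot"
proof -
  have *: "((\<lambda>z::real. inverse (1 + z\<^sup>2)) \<longlongrightarrow> 0) at_top" "((\<lambda>z::real. inverse (1 + z\<^sup>2)) \<longlongrightarrow> 0) at_bot"
  proof -
    have sq: "filterlim (\<lambda>z::real. z\<^sup>2) at_top at_top" by (rule filterlim_pow_at_top) (auto intro: filterlim_ident)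
    then have top: "filterlim (\<lambda>z::real. 1 + z\<^sup>2) at_top at_top"
      by (rule filterlim_tendsto_add_at_top[OF tendsto_const])
    then have bot: "filterlim (\<lambda>z::real. 1 + z\<^sup>2) at_top at_bot"
      by (simp add: filterlim_at_bot_mirror)
    show "((\<lambda>z::real. inverse (1 + z\<^sup>2)) \<longlongrightarrow> 0) at_top" "((\<lambda>z::real. inverse (1 + z\<^sup>2)) \<longlongrightarrow> 0) at_bot"
      using tendsto_inverse_0_at_top[OF top] tendsto_inverse_0_at_top[OF bot] by blast+
  qed
  have lin: "filterlim (\<lambda>x. k * (x - y)) at_top at_top" for y
    using filterlim_tendsto_pos_mult_at_top[OF tendsto_const assms filterlim_tendsto_add_at_top[OF tendsto_const filterlim_ident], of "- y"]
    by simp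
  have "filterlim (\<lambda>x. k * (x - y)) at_top at_top" "filterlim (\<lambda>x. k * (x - y)) at_bot at_bot"
    using lin[of y] lin[of "- y"]
    by (simp_all add: filterlim_at_bot_mirror filterlim_uminus_at_bot algebra_simps)
  then show "(loc_weight k y \<longlongrightarrow> 0) at_top" "(loc_weight k y \<longlongrightarrow> 0) at_bot"
    unfolding loc_weight_def using filterlim_compose[OF *(1)] filterlim_compose[OF *(2)] by blast+
qed

context
  fixes k y :: real
  assumes k: "0 < k"
begin

lemma integrable_weighted:
  assumes h: "bcont h"
  shows "integrable lborel (\<lambda>x. loc_weight k y x * h x)"
proof -
  obtain B where B: "0 \<le> B" "\<And>x. \<bar>h x\<bar> \<le> B" using h by (metis bcontE)
  show ?thesis
  proof (rule Bochner_Integration.integrable_bound)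
    show "integrable lborel (\<lambda>x. B * loc_weight k y x)"
      using has_bochner_integral_loc_weight[OF k] by (auto simp: has_bochner_integral_iff)
    show "(\<lambda>x. loc_weight k y x * h x) \<in> borel_measurable lborel"
      using h by (auto intro!: borel_measurable_continuous_onI continuous_intros continuous_loc_weight simp: bcont_def)
    show "AE x in lborel. norm (loc_weight k y x * h x) \<le> norm (B * loc_weight k y x)"
      using B loc_weight_pos[of k y] by (auto intro!: AE_I2 simp: abs_mult abs_of_pos less_imp_le mult.commute mult_right_mono)
  qed
qed

lemma weighted_tendsto_0:
  assumes "bcont h"
  shows "((\<lambda>x. loc_weight k y x * h x) \<longlongrightarrow> 0) at_top" "((\<lambda>x. loc_weight k y x * h x) \<longlongrightarrow> 0) at_bot"
proof -
  obtain B where B: "\<And>x. \<bar>h x\<bar> \<le> B" using assms by (metis bcontE)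
  have "norm (loc_weight k y x * h x) \<le> B * loc_weight k y x" for x
    using B[of x] loc_weight_pos[of k y x] by (simp add: abs_mult abs_of_pos mult.commute)
  moreover have "((\<lambda>x. B * loc_weight k y x) \<longlongrightarrow> 0) at_top" "((\<lambda>x. B * loc_weight k y x) \<longlongrightarrow> 0) at_bot"
    using loc_weight_tendsto[OF k] by (auto intro!: tendsto_mult_right_zero)
  ultimately show "((\<lambda>x. loc_weight k y x * h x) \<longlongrightarrow> 0) at_top" "((\<lambda>x. loc_weight k y x * h x) \<longlongrightarrow> 0) at_bot"
    by (auto intro: Lim_null_comparison[where g = "\<lambda>x. B * loc_weight k y x"])
qed

lemma weighted_deriv:
  assumes "(h has_real_derivative h') (at x)"
  shows "((\<lambda>x. loc_weight k y x * h x) has_real_derivative loc_weight k y x * (log_slope k y x * h x + h')) (at x)"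
  by (auto intro!: derivative_eq_intros assms loc_weight_deriv simp: algebra_simps)

lemma weighted_integral_by_parts:
  assumes "bcont h" "bcont h'" "\<And>x. (h has_real_derivative h' x) (at x)"
  shows "(\<integral>x. loc_weight k y x * (log_slope k y x * h x + h' x) \<partial>lborel) = 0"
proof (rule integral_derivative_eq_0)
  show "((\<lambda>x. loc_weight k y x * h x) has_vector_derivative loc_weight k y x * (log_slope k y x * h x + h' x)) (at x)" for x
    using weighted_deriv[OF assms(3)] by (simp add: has_real_derivative_iff_has_vector_derivative)
  have b: "bcont (\<lambda>x. log_slope k y x * h x + h' x)"
    using assms bcont_log_slope[of k y] k by (auto intro!: bcont_intros)
  then show "continuous_on UNIV (\<lambda>x. loc_weight k y x * (log_slope k y x * h x + h' x))"
    by (auto simp: bcont_def intro!: continuous_intros continuous_loc_weight)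
  show "integrable lborel (\<lambda>x. loc_weight k y x * (log_slope k y x * h x + h' x))"
    by (rule integrable_weighted[OF b])
qed (use weighted_tendsto_0[OF assms(1)] in auto)

text \<open>The weight equals 1 at \<open>y\<close> and kills the boundary term at minus infinity,
  so \<open>h y\<close> is the integral of the derivative of weight times \<open>h\<close> over the
  left half line. Enlarging the domain to the whole line after taking absolute values gives the
  bound.\<close>

lemma weighted_pointwise_bound:
  assumes "bcont h" "bcont h'" "\<And>x. (h has_real_derivative h' x) (at x)"
  shows "\<bar>h y\<bar> \<le> (\<integral>x. loc_weight k y x * \<bar>log_slope k y x * h x + h' x\<bar> \<partial>lborel)"
proof -
  let ?J = "\<lambda>x. loc_weight k y x * h x"
  let ?J' = "\<lambda>x. loc_weight k y x * (log_slope k y x * h x + h' x)"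
  have b: "bcont (\<lambda>x. log_slope k y x * h x + h' x)"
    using assms bcont_log_slope[of k y] k by (auto intro!: bcont_intros)
  have c: "continuous_on UNIV ?J'"
    using b by (auto simp: bcont_def intro!: continuous_intros continuous_loc_weight)
  have i: "integrable lborel ?J'" by (rule integrable_weighted[OF b])
  have der: "(?J has_vector_derivative ?J' x) (at x)" for x
    using weighted_deriv[OF assms(3)] by (simp add: has_real_derivative_iff_has_vector_derivative)
  have "(LBINT x=-\<infinity>..y. ?J' x) = ?J y - 0"
  proof (rule interval_integral_FTC_integrable)
    show "isCont ?J' x" for x using c by (simp add: continuous_on_eq_continuous_at)
    show "set_integrable lborel (einterval (-\<infinity>) y) ?J'"
      unfolding set_integrable_def using integrable_mult_indicator[OF _ i, of "einterval (-\<infinity>) y"] by simp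
    show "((?J \<circ> real_of_ereal) \<longlongrightarrow> 0) (at_right (- \<infinity>))"
      using weighted_tendsto_0(2)[OF assms(1)] by (simp add: ereal_tendsto_simps comp_assoc)
    have "(?J \<longlongrightarrow> ?J y) (at_left y)"
      using has_vector_derivative_continuous[OF der, of y] 
      by (auto simp: continuous_within intro: tendsto_within_subset)
    then show "((?J \<circ> real_of_ereal) \<longlongrightarrow> ?J y) (at_left (ereal y))"
      by (simp add: ereal_tendsto_simps comp_assoc)
  qed (use der in auto)
  then have "\<bar>h y\<bar> = \<bar>\<integral>x. indicator (einterval (-\<infinity>) y) x * ?J' x \<partial>lborel\<bar>"
    by (simp add: loc_weight_at interval_lebesgue_integral_def set_lebesgue_integral_def)
  also have "\<dots> \<le> (\<integral>x. \<bar>indicator (einterval (-\<infinity>) y) x * ?J' x\<bar> \<partial>lborel)" by (rule integral_abs_bound)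
  also have "\<dots> \<le> (\<integral>x. \<bar>?J' x\<bar> \<partial>lborel)"
    using i integrable_mult_indicator[OF _ i, of "einterval (-\<infinity>) y"]
    by (intro integral_mono) (auto split: split_indicator)
  also have "\<dots> = (\<integral>x. loc_weight k y x * \<bar>log_slope k y x * h x + h' x\<bar> \<partial>lborel)"
    using loc_weight_pos[of k y] by (simp add: abs_mult abs_of_pos)
  finally show ?thesis .
qed

end

section \<open>Energy estimates\<close>

text \<open>The matrix of the form has determinant \<open>2 * (1 - 3 * q\<^sup>2) = 3 * c\<close>
  and trace at most 3, so its smaller eigenvalue is at least determinant over trace, hence at least
  \<open>c\<close>. In the proof this choice makes the terms of first order in \<open>c\<close>
  cancel, up to a nonnegative remainder, in the discriminant condition \<open>disc\<close>.\<close>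

lemma eckhaus_coercive:
  fixes q x y :: real
  defines "c \<equiv> 2 * (1 - 3 * q\<^sup>2) / 3"
  assumes q: "q\<^sup>2 < 1 / 3"
  shows "c * (x\<^sup>2 + y\<^sup>2) \<le> y\<^sup>2 + 4 * q * x * y + 2 * (1 - q\<^sup>2) * x\<^sup>2"
proof -
  have c: "0 < c" "c \<le> 2 / 3" using q by (auto simp: c_def)
  have q0: "0 \<le> q\<^sup>2" by simp
  have "(1 - c) * (2 * (1 - q\<^sup>2) - c) - 4 * q\<^sup>2 = c * (c + 2 * q\<^sup>2)"
    by (simp add: c_def field_simps power2_eq_square)
  then have disc: "4 * q\<^sup>2 \<le> (1 - c) * (2 * (1 - q\<^sup>2) - c)"
    using c q0 by (smt (verit) mult_nonneg_nonneg)
  have "0 \<le> (1 - c) * ((1 - c) * y\<^sup>2 + 4 * q * x * y + (2 * (1 - q\<^sup>2) - c) * x\<^sup>2)"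
  proof -
    have "(1 - c) * ((1 - c) * y\<^sup>2 + 4 * q * x * y + (2 * (1 - q\<^sup>2) - c) * x\<^sup>2)
      = ((1 - c) * y + 2 * q * x)\<^sup>2 + ((1 - c) * (2 * (1 - q\<^sup>2) - c) - 4 * q\<^sup>2) * x\<^sup>2"
      by (simp add: algebra_simps power2_eq_square)
    then show ?thesis using disc by simp
  qed
  then have "0 \<le> (1 - c) * y\<^sup>2 + 4 * q * x * y + (2 * (1 - q\<^sup>2) - c) * x\<^sup>2"
    using c by (simp add: zero_le_mult_iff)
  then show ?thesis by (simp add: algebra_simps)
qed

lemma young_ineq:
  fixes e s x y k :: real
  assumes "0 < e" "\<bar>s\<bar> \<le> k"
  shows "s * x * y \<le> e * x\<^sup>2 + k\<^sup>2 * y\<^sup>2 / (4 * e)"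
proof -
  have "0 \<le> (2 * e * x - s * y)\<^sup>2 / (4 * e)" using assms by simp
  also have "\<dots> = e * x\<^sup>2 - s * x * y + s\<^sup>2 * y\<^sup>2 / (4 * e)"
    using assms by (simp add: power2_eq_square field_simps)
  finally have "s * x * y \<le> e * x\<^sup>2 + s\<^sup>2 * y\<^sup>2 / (4 * e)" by simp
  moreover have "s\<^sup>2 * y\<^sup>2 / (4 * e) \<le> k\<^sup>2 * y\<^sup>2 / (4 * e)"
    using assms by (intro divide_right_mono mult_right_mono) (auto simp: abs_le_square_iff[symmetric])
  ultimately show ?thesis by linarith
qed

text \<open>The inequality of arithmetic and geometric means, stated through the square of
  \<open>X\<close> so that Cauchy-Schwarz bounds can be inserted without extracting roots.\<close>

lemma two_sqrt_mult_le:
  fixes X A B :: real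
  assumes "X\<^sup>2 \<le> 4 * A * B" "0 \<le> A" "0 \<le> B"
  shows "\<bar>X\<bar> \<le> A + B"
proof -
  have "X\<^sup>2 \<le> (A + B)\<^sup>2"
    using assms(1) zero_le_power2[of "A - B"] by (simp add: power2_eq_square algebra_simps)
  then show ?thesis using assms(2,3) by (simp add: abs_le_square_iff[symmetric])
qed

text \<open>The upper bound on the exponential comes from squaring and inverting
  \<open>1 - u \<le> exp (- u)\<close>; the polynomial inequality that remains holds for
  \<open>u \<le> 1 / 6\<close>, which \<open>d \<le> 1 / 8\<close> secures. The lower bounds are the
  tangent line at 0.\<close>

lemma exp_double_bounds:
  fixes u d :: real
  assumes u: "\<bar>u\<bar> \<le> d" and d: "d \<le> 1 / 8"
  shows "\<bar>1 - exp (2 * u) + 2 * u\<bar> \<le> 4 * u\<^sup>2" and "1 - 2 * d \<le> exp (2 * u)"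
proof -
  have u1: "0 < 1 - u" "0 \<le> 1 - 6 * u" using u d by auto
  have "(1 - u)\<^sup>2 * exp (2 * u) \<le> (exp (- u))\<^sup>2 * exp (2 * u)"
    using exp_ge_add_one_self[of "- u"] u1 by (intro mult_right_mono power_mono) auto
  also have "\<dots> = 1" unfolding exp_double[symmetric] by (simp add: mult_exp_exp)
  also have "1 \<le> (1 - u)\<^sup>2 * (1 + 2 * u + 4 * u\<^sup>2)"
  proof -
    have "(1 - u)\<^sup>2 * (1 + 2 * u + 4 * u\<^sup>2) = 1 + u\<^sup>2 * ((1 - 6 * u) + 4 * u\<^sup>2)"
      by (simp add: power2_eq_square algebra_simps)
    then show ?thesis using u1 by simp
  qed
  finally have "exp (2 * u) \<le> 1 + 2 * u + 4 * u\<^sup>2"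
    using u1 by (simp add: mult_le_cancel_left)
  then show "\<bar>1 - exp (2 * u) + 2 * u\<bar> \<le> 4 * u\<^sup>2"
    using exp_ge_add_one_self[of "2 * u"] zero_le_power2[of u] by linarith
  show "1 - 2 * d \<le> exp (2 * u)" using exp_ge_add_one_self[of "2 * u"] u by linarith
qed

text \<open>
  Below \<open>s\<close> is the logarithmic derivative of the weight \<open>\<rho>\<close>: a sum of the form \<open>s * J + J'\<close> is
  \<open>(\<rho> J)' / \<rho>\<close> and disappears after integration against \<open>\<rho>\<close>.
\<close>

locale eckhaus_point =
  fixes q c k d s :: real
  assumes q: "q\<^sup>2 < 1 / 3" and c_def: "c = 2 * (1 - 3 * q\<^sup>2) / 3" and d_def: "d = c / 16"
    and s: "\<bar>s\<bar> \<le> k"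
begin

lemma c_bounds: "0 < c" "c \<le> 2 / 3" "0 < d" "d \<le> 1 / 24"
  using q by (auto simp: c_def d_def)

lemma q_le_1: "\<bar>q\<bar> \<le> 1" "0 \<le> 1 - q\<^sup>2" "1 - q\<^sup>2 \<le> 1"
  using q by (auto simp: abs_square_le_1[symmetric])

text \<open>The integrand of half the time derivative of the zeroth-order energy. Putting
  \<open>2 * q * u * p\<close> into the flux replaces the skew coupling
  \<open>2 * q * (p * ux - u * px)\<close> by \<open>- 4 * q * u * px\<close>: the undamped phase
  then occurs only as \<open>px\<close>, and the quadratic part is exactly the form of
  \<open>eckhaus_coercive\<close>.\<close>

lemma energy0_point:
  fixes u ux uxx ut p px pxx pt :: real
  assumes small: "u\<^sup>2 + p\<^sup>2 \<le> d\<^sup>2"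
    and ut: "ut = uxx - 2 * q * px + ux\<^sup>2 - px\<^sup>2 + (1 - q\<^sup>2) * (1 - exp (2 * u))"
    and pt: "pt = pxx + 2 * q * ux + 2 * ux * px"
  shows "u * ut + p * pt
    \<le> s * (u * ux + p * px + 2 * q * u * p) + (ux\<^sup>2 + u * uxx + px\<^sup>2 + p * pxx + 2 * q * (ux * p + u * px))
      - c / 2 * (ux\<^sup>2 + px\<^sup>2) + 6 / c * k\<^sup>2 * (u\<^sup>2 + p\<^sup>2)"
proof -
  have ud: "\<bar>u\<bar> \<le> d" "\<bar>p\<bar> \<le> d"
    using small c_bounds by (auto intro!: power2_le_imp_le[of "\<bar>_\<bar>"] order_trans[OF _ small])
  define g where "g = (1 - q\<^sup>2) * (1 - exp (2 * u))"
  have "\<bar>u * (1 - exp (2 * u) + 2 * u)\<bar> \<le> d * (4 * u\<^sup>2)"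
    using ud exp_double_bounds(1)[OF ud(1)] c_bounds unfolding abs_mult by (intro mult_mono) auto
  then have "\<bar>(1 - q\<^sup>2) * (u * (1 - exp (2 * u) + 2 * u))\<bar> \<le> 1 * (d * (4 * u\<^sup>2))"
    using q_le_1 unfolding abs_mult[of "1 - q\<^sup>2"] by (intro mult_mono) auto
  then have ug: "u * g \<le> - 2 * (1 - q\<^sup>2) * u\<^sup>2 + 4 * d * u\<^sup>2"
    by (simp add: g_def algebra_simps power2_eq_square abs_le_iff)
  have cub: "u * (ux\<^sup>2 - px\<^sup>2) + p * (2 * ux * px) \<le> 2 * d * (ux\<^sup>2 + px\<^sup>2)"
  proof -
    have "u * (ux\<^sup>2 - px\<^sup>2) \<le> d * (ux\<^sup>2 + px\<^sup>2)"
    proof -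
      have "u * (ux\<^sup>2 - px\<^sup>2) \<le> \<bar>u\<bar> * \<bar>ux\<^sup>2 - px\<^sup>2\<bar>" by (metis abs_ge_self abs_mult)
      also have "\<dots> \<le> d * (ux\<^sup>2 + px\<^sup>2)" using ud c_bounds by (intro mult_mono) (auto simp: abs_le_iff)
      finally show ?thesis .
    qed
    moreover have "p * (2 * ux * px) \<le> d * (ux\<^sup>2 + px\<^sup>2)"
    proof -
      have "p * (2 * ux * px) \<le> \<bar>p\<bar> * \<bar>2 * ux * px\<bar>" by (metis abs_ge_self abs_mult)
      also have "\<dots> \<le> d * (ux\<^sup>2 + px\<^sup>2)" using ud c_bounds zero_le_power2[of "ux - px"] zero_le_power2[of "ux + px"]
        by (intro mult_mono) (auto simp: abs_le_iff power2_diff power2_sum)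
      finally show ?thesis .
    qed
    ultimately show ?thesis by linarith
  qed
  have co: "c * (u\<^sup>2 + px\<^sup>2) \<le> px\<^sup>2 + 4 * q * u * px + 2 * (1 - q\<^sup>2) * u\<^sup>2"
    using eckhaus_coercive[OF q, of u px] by (simp add: c_def)
  \<comment> \<open>Budget: coercivity provides \<open>c\<close> times each of
    \<open>u\<^sup>2\<close>, \<open>px\<^sup>2\<close> and, since \<open>c \<le> 1\<close>,
    \<open>ux\<^sup>2\<close>. The weight errors and the cubic terms take \<open>c / 8\<close> each
    from \<open>ux\<^sup>2\<close> and \<open>px\<^sup>2\<close>; the coupling error and the
    exponential remainder take \<open>c / 4\<close> each from \<open>u\<^sup>2\<close>. What is left
    covers the claimed \<open>c / 2\<close>. The constant \<open>6 / c\<close> is the sum of the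
    \<open>2 / c\<close> and \<open>4 / c\<close> that fall on \<open>p\<^sup>2\<close>.\<close>
  have y1: "(- s) * ux * u \<le> c / 8 * ux\<^sup>2 + k\<^sup>2 * u\<^sup>2 / (4 * (c / 8))"
    by (rule young_ineq) (use s c_bounds in auto)
  have y2: "(- s) * px * p \<le> c / 8 * px\<^sup>2 + k\<^sup>2 * p\<^sup>2 / (4 * (c / 8))"
    by (rule young_ineq) (use s c_bounds in auto)
  have "\<bar>- 2 * q * s\<bar> \<le> 2 * k" 
    using mult_mono[OF q_le_1(1) s] by (simp add: abs_mult)
  then have y3: "(- 2 * q * s) * u * p \<le> c / 4 * u\<^sup>2 + (2 * k)\<^sup>2 * p\<^sup>2 / (4 * (c / 4))"
    by (rule young_ineq[rotated]) (use c_bounds in auto)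
  have c1: "c * ux\<^sup>2 \<le> ux\<^sup>2" using c_bounds by (intro mult_left_le_one_le) auto
  have dd: "4 * d * u\<^sup>2 = c / 4 * u\<^sup>2" "2 * d * (ux\<^sup>2 + px\<^sup>2) = c / 8 * (ux\<^sup>2 + px\<^sup>2)"
    by (auto simp: d_def)
  have fr: "k\<^sup>2 * u\<^sup>2 / (4 * (c / 8)) = 2 / c * k\<^sup>2 * u\<^sup>2" "k\<^sup>2 * p\<^sup>2 / (4 * (c / 8)) = 2 / c * k\<^sup>2 * p\<^sup>2"
    "(2 * k)\<^sup>2 * p\<^sup>2 / (4 * (c / 4)) = 4 / c * k\<^sup>2 * p\<^sup>2"
    using c_bounds by (auto simp: field_simps power2_eq_square)
  have nn: "0 \<le> 4 / c * k\<^sup>2 * u\<^sup>2" "0 \<le> c * u\<^sup>2" "0 \<le> c * px\<^sup>2" "0 \<le> c * ux\<^sup>2" using c_bounds by auto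
  have id: "u * ut + p * pt = (s * (u * ux + p * px + 2 * q * u * p)
      + (ux\<^sup>2 + u * uxx + px\<^sup>2 + p * pxx + 2 * q * (ux * p + u * px)))
      + ((- s) * ux * u + (- s) * px * p + (- 2 * q * s) * u * p) - ux\<^sup>2 - (px\<^sup>2 + 4 * q * u * px)
      + (u * (ux\<^sup>2 - px\<^sup>2) + p * (2 * ux * px)) + u * g"
    unfolding ut pt g_def[symmetric] by (simp add: algebra_simps power2_eq_square)
  have e1: "6 / c * k\<^sup>2 * (u\<^sup>2 + p\<^sup>2) = 6 / c * k\<^sup>2 * u\<^sup>2 + 6 / c * k\<^sup>2 * p\<^sup>2"
    by (simp add: distrib_left)
  have e2: "c / 2 * (ux\<^sup>2 + px\<^sup>2) = c / 2 * ux\<^sup>2 + c / 2 * px\<^sup>2" "c * (u\<^sup>2 + px\<^sup>2) = c * u\<^sup>2 + c * px\<^sup>2"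
    "c / 8 * (ux\<^sup>2 + px\<^sup>2) = c / 8 * ux\<^sup>2 + c / 8 * px\<^sup>2"
    by (simp_all add: algebra_simps)
  have e3: "2 / c * k\<^sup>2 * u\<^sup>2 \<le> 6 / c * k\<^sup>2 * u\<^sup>2" "2 / c * k\<^sup>2 * p\<^sup>2 + 4 / c * k\<^sup>2 * p\<^sup>2 \<le> 6 / c * k\<^sup>2 * p\<^sup>2"
    using c_bounds by (auto simp: divide_right_mono mult_right_mono field_simps)
  show ?thesis
    unfolding e1 e2
    using id ug cub co y1 y2 y3 c1 e3 nn unfolding dd fr e2 by linarith
qed

text \<open>The fourth-order terms are controlled by \<open>S\<^sup>2\<close>, which up to a derivative is small compared with \<open>K\<close>.\<close>

lemma gagliardo_nirenberg_point:
  fixes u ux uxx p px pxx :: real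
  defines "S \<equiv> ux\<^sup>2 + px\<^sup>2" and "K \<equiv> uxx\<^sup>2 + pxx\<^sup>2" and "m \<equiv> u * ux + p * px"
  assumes small: "u\<^sup>2 + p\<^sup>2 \<le> d\<^sup>2"
  shows "S\<^sup>2 \<le> 2 * (s * S * m + 2 * (ux * uxx + px * pxx) * m + S * (S + u * uxx + p * pxx))
    + 2 * k\<^sup>2 * d\<^sup>2 * S + 20 * d\<^sup>2 * K"
proof -
  have S0: "0 \<le> S" and K0: "0 \<le> K" by (auto simp: S_def K_def)
  have cs: "(a * b + a' * b')\<^sup>2 \<le> (a\<^sup>2 + a'\<^sup>2) * (b\<^sup>2 + b'\<^sup>2)" for a b a' b' :: real
    using zero_le_power2[of "a * b' - a' * b"] by (simp add: power2_eq_square algebra_simps)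
  have m: "m\<^sup>2 \<le> d\<^sup>2 * S"
    using cs[of u ux p px] mult_right_mono[OF small S0] by (simp add: m_def S_def)
  have s2: "s\<^sup>2 \<le> k\<^sup>2" using s by (auto simp: abs_le_square_iff[symmetric])
  \<comment> \<open>The flux is \<open>S * m\<close>, where \<open>m\<close> is half the derivative
    of \<open>u\<^sup>2 + p\<^sup>2\<close>; its derivative contains \<open>S\<^sup>2\<close>,
    because \<open>m\<close> differentiates to \<open>S\<close> plus second-order terms. The three
    other terms are charged with 1/4, 1/8 and 1/8 of \<open>S\<^sup>2\<close>, so half of it
    survives. Doubling produces the factor 2 and \<open>20 = 2 * (8 + 2)\<close>.\<close>
  have "(s * S * m)\<^sup>2 \<le> 4 * (S\<^sup>2 / 4) * (k\<^sup>2 * d\<^sup>2 * S)"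
  proof -
    have "(s * S * m)\<^sup>2 = S\<^sup>2 * (s\<^sup>2 * m\<^sup>2)" by (simp add: power_mult_distrib)
    also have "\<dots> \<le> S\<^sup>2 * (k\<^sup>2 * (d\<^sup>2 * S))" using m s2 by (intro mult_left_mono mult_mono) auto
    finally show ?thesis by (simp add: mult.assoc)
  qed
  then have t1: "\<bar>s * S * m\<bar> \<le> S\<^sup>2 / 4 + k\<^sup>2 * d\<^sup>2 * S"
    by (rule two_sqrt_mult_le) (use S0 in auto)
  have "(2 * (ux * uxx + px * pxx) * m)\<^sup>2 \<le> 4 * (S\<^sup>2 / 8) * (8 * d\<^sup>2 * K)"
  proof -
    have "(2 * (ux * uxx + px * pxx) * m)\<^sup>2 = 4 * ((ux * uxx + px * pxx)\<^sup>2 * m\<^sup>2)" by (simp only: power_mult_distrib) simp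
    also have "\<dots> \<le> 4 * ((S * K) * (d\<^sup>2 * S))"
      using m cs[of ux uxx px pxx] S0 K0 by (intro mult_left_mono mult_mono) (auto simp: S_def K_def)
    finally show ?thesis by (simp add: mult_ac power2_eq_square)
  qed
  then have t2: "\<bar>2 * (ux * uxx + px * pxx) * m\<bar> \<le> S\<^sup>2 / 8 + 8 * d\<^sup>2 * K"
    by (rule two_sqrt_mult_le) (use K0 in auto)
  have "(S * (u * uxx + p * pxx))\<^sup>2 \<le> 4 * (S\<^sup>2 / 8) * (2 * d\<^sup>2 * K)"
  proof -
    have "(S * (u * uxx + p * pxx))\<^sup>2 = S\<^sup>2 * (u * uxx + p * pxx)\<^sup>2" by (simp add: power_mult_distrib)
    also have "\<dots> \<le> S\<^sup>2 * (d\<^sup>2 * K)"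
      using order_trans[OF cs[of u uxx p pxx] mult_right_mono[OF small]] K0
      by (intro mult_left_mono) (auto simp: K_def)
    finally show ?thesis by simp
  qed
  then have t3: "\<bar>S * (u * uxx + p * pxx)\<bar> \<le> S\<^sup>2 / 8 + 2 * d\<^sup>2 * K"
    by (rule two_sqrt_mult_le) (use K0 in auto)
  have "S * (S + u * uxx + p * pxx) = S\<^sup>2 + S * (u * uxx + p * pxx)"
    by (simp add: algebra_simps power2_eq_square)
  then show ?thesis using t1 t2 t3 by (simp add: abs_le_iff)
qed

text \<open>The left side is the integrand of half the time derivative of the weighted gradient
  energy after an integration by parts, so neither third nor mixed derivatives occur. The quadratic
  part is the form of \<open>eckhaus_coercive\<close> one derivative higher, in \<open>ux\<close>
  and \<open>pxx\<close>. By Young's inequality the products of second derivatives with squares of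
  first ones cost \<open>2 / c * S\<^sup>2\<close>, and the weight error in the quadratic term costs
  one more \<open>S\<^sup>2\<close>. Their sum is removed by
  \<open>gagliardo_nirenberg_point\<close>, whose flux therefore appears with the factor
  \<open>2 * (1 + 2 / c)\<close>.\<close>

lemma energy1_point:
  fixes u ux uxx ut p px pxx pt :: real
  defines "S \<equiv> ux\<^sup>2 + px\<^sup>2" and "m \<equiv> u * ux + p * px" and "g \<equiv> (1 - q\<^sup>2) * (1 - exp (2 * u))"
  assumes small: "u\<^sup>2 + p\<^sup>2 \<le> d\<^sup>2"
    and ut: "ut = uxx - 2 * q * px + ux\<^sup>2 - px\<^sup>2 + (1 - q\<^sup>2) * (1 - exp (2 * u))"
    and pt: "pt = pxx + 2 * q * ux + 2 * ux * px"
  shows "- ((s * ux + uxx) * ut + (s * px + pxx) * pt)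
    \<le> s * (2 * q * ux * px - ux * g)
      + (2 * q * (uxx * px + ux * pxx) - uxx * g + 2 * (1 - q\<^sup>2) * exp (2 * u) * ux\<^sup>2)
      + 2 * (1 + 2 / c) * (s * S * m + (2 * (ux * uxx + px * pxx) * m + S * (S + u * uxx + p * pxx)))
      + (10 / c + 3) * k\<^sup>2 * S"
proof -
  define K where "K = uxx\<^sup>2 + pxx\<^sup>2"
  have S0: "0 \<le> S" and K0: "0 \<le> K" by (auto simp: S_def K_def)
  have ud: "\<bar>u\<bar> \<le> d"
    using small c_bounds by (auto intro!: power2_le_imp_le[of "\<bar>_\<bar>"] order_trans[OF _ small])
  have E: "- 2 * (1 - q\<^sup>2) * exp (2 * u) * ux\<^sup>2 \<le> - 2 * (1 - q\<^sup>2) * ux\<^sup>2 + c / 4 * ux\<^sup>2"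
  proof -
    have "(1 - q\<^sup>2) * (1 - exp (2 * u)) \<le> 1 * (2 * d)"
      using exp_double_bounds(2)[OF ud] q_le_1 c_bounds
      by (intro order_trans[OF mult_left_mono[of _ "2 * d"] mult_right_mono]) auto
    from mult_right_mono[OF this, of "2 * ux\<^sup>2"] show ?thesis by (simp add: d_def algebra_simps)
  qed
  have co: "c * (ux\<^sup>2 + pxx\<^sup>2) \<le> pxx\<^sup>2 + 4 * q * ux * pxx + 2 * (1 - q\<^sup>2) * ux\<^sup>2"
    using eckhaus_coercive[OF q, of ux pxx] by (simp add: c_def)
  have y1: "(- s) * uxx * ux \<le> c / 8 * uxx\<^sup>2 + k\<^sup>2 * ux\<^sup>2 / (4 * (c / 8))"
    by (rule young_ineq) (use s c_bounds in auto)
  have y2: "(- s) * pxx * px \<le> c / 8 * pxx\<^sup>2 + k\<^sup>2 * px\<^sup>2 / (4 * (c / 8))"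
    by (rule young_ineq) (use s c_bounds in auto)
  have "\<bar>- 2 * q * s\<bar> \<le> 2 * k" using mult_mono[OF q_le_1(1) s] by (simp add: abs_mult)
  then have y3: "(- 2 * q * s) * ux * px \<le> c / 4 * ux\<^sup>2 + (2 * k)\<^sup>2 * px\<^sup>2 / (4 * (c / 4))"
    by (rule young_ineq[rotated]) (use c_bounds in auto)
  have y4: "(- 1) * uxx * (ux\<^sup>2 - px\<^sup>2) \<le> c / 8 * uxx\<^sup>2 + 1\<^sup>2 * (ux\<^sup>2 - px\<^sup>2)\<^sup>2 / (4 * (c / 8))"
    by (rule young_ineq) (use c_bounds in auto)
  have y5: "(- 1) * pxx * (2 * ux * px) \<le> c / 8 * pxx\<^sup>2 + 1\<^sup>2 * (2 * ux * px)\<^sup>2 / (4 * (c / 8))"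
    by (rule young_ineq) (use c_bounds in auto)
  have y6: "(- s) * S * ux \<le> 1 * S\<^sup>2 + k\<^sup>2 * ux\<^sup>2 / (4 * 1)"
    by (rule young_ineq) (use s in auto)
  have sq: "(ux\<^sup>2 - px\<^sup>2)\<^sup>2 + (2 * ux * px)\<^sup>2 = S\<^sup>2" by (simp add: S_def power2_eq_square algebra_simps)
  have c1: "c * uxx\<^sup>2 \<le> uxx\<^sup>2" using c_bounds by (intro mult_left_le_one_le) auto
  have fr: "k\<^sup>2 * ux\<^sup>2 / (4 * (c / 8)) = 2 / c * k\<^sup>2 * ux\<^sup>2" "k\<^sup>2 * px\<^sup>2 / (4 * (c / 8)) = 2 / c * k\<^sup>2 * px\<^sup>2"
    "(2 * k)\<^sup>2 * px\<^sup>2 / (4 * (c / 4)) = 4 / c * k\<^sup>2 * px\<^sup>2"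
    using c_bounds by (auto simp: field_simps power2_eq_square)
  have y45: "(- 1) * uxx * (ux\<^sup>2 - px\<^sup>2) + (- 1) * pxx * (2 * ux * px) \<le> c / 8 * uxx\<^sup>2 + c / 8 * pxx\<^sup>2 + 2 / c * S\<^sup>2"
  proof -
    have "2 / c * S\<^sup>2 = 1\<^sup>2 * (ux\<^sup>2 - px\<^sup>2)\<^sup>2 / (4 * (c / 8)) + 1\<^sup>2 * (2 * ux * px)\<^sup>2 / (4 * (c / 8))"
      unfolding sq[symmetric] using c_bounds by (simp add: field_simps)
    then show ?thesis using y4 y5 by linarith
  qed
  define G where "G = s * S * m + (2 * (ux * uxx + px * pxx) * m + S * (S + u * uxx + p * pxx))"
  have "S\<^sup>2 \<le> 2 * G + 2 * k\<^sup>2 * d\<^sup>2 * S + 20 * d\<^sup>2 * K"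
    using gagliardo_nirenberg_point[OF small, of ux px uxx pxx] by (simp add: G_def S_def m_def K_def add.assoc)
  then have "(1 + 2 / c) * S\<^sup>2 \<le> (1 + 2 / c) * (2 * G + 2 * k\<^sup>2 * d\<^sup>2 * S + 20 * d\<^sup>2 * K)"
    using c_bounds by (intro mult_left_mono) (auto simp: add_nonneg_nonneg)
  \<comment> \<open>This fixes how small \<open>d\<close> has to be: the second-order terms returned
    by the interpolation must fit into \<open>c / 4\<close> of the dissipation. With
    \<open>d = c / 16\<close> and \<open>c \<le> 2 / 3\<close> the factor is
    \<open>20 / 256 * (c + 2) * c\<close>, below that limit.\<close>
  moreover have "(1 + 2 / c) * (20 * d\<^sup>2 * K) \<le> c / 4 * K"
  proof -
    have "(1 + 2 / c) * (20 * d\<^sup>2) = 20 / 256 * (c + 2) * c"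
      using c_bounds by (simp add: d_def field_simps power2_eq_square)
    also have "\<dots> \<le> c / 4" using c_bounds by simp
    finally have "(1 + 2 / c) * (20 * d\<^sup>2) * K \<le> c / 4 * K" using K0 by (rule mult_right_mono)
    then show ?thesis by (simp only: mult.assoc)
  qed
  moreover have "(1 + 2 / c) * (2 * k\<^sup>2 * d\<^sup>2 * S) \<le> k\<^sup>2 * S"
  proof -
    have "(1 + 2 / c) * (2 * d\<^sup>2) = 2 / 256 * (c + 2) * c"
      using c_bounds by (simp add: d_def field_simps power2_eq_square)
    also have "\<dots> \<le> 1 * 1" using c_bounds by (intro mult_mono) auto
    finally show ?thesis using mult_right_mono[of "(1 + 2 / c) * (2 * d\<^sup>2)" 1 "k\<^sup>2 * S"] S0 by (simp add: mult_ac)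
  qed
  ultimately have gn: "(1 + 2 / c) * S\<^sup>2 \<le> 2 * (1 + 2 / c) * G + k\<^sup>2 * S + c / 4 * K"
    using distrib_left[of "1 + 2 / c" "2 * G + 2 * k\<^sup>2 * d\<^sup>2 * S" "20 * d\<^sup>2 * K"]
      distrib_left[of "1 + 2 / c" "2 * G" "2 * k\<^sup>2 * d\<^sup>2 * S"] mult.left_commute[of "1 + 2 / c" 2 G]
    unfolding mult.assoc[of 2 "1 + 2 / c" G] by linarith
  have id: "- ((s * ux + uxx) * ut + (s * px + pxx) * pt) = s * (2 * q * ux * px - ux * g)
      + (2 * q * (uxx * px + ux * pxx) - uxx * g + 2 * (1 - q\<^sup>2) * exp (2 * u) * ux\<^sup>2)
      - uxx\<^sup>2 - (pxx\<^sup>2 + 4 * q * ux * pxx) + (- 2 * (1 - q\<^sup>2) * exp (2 * u) * ux\<^sup>2)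
      + (- s) * uxx * ux + (- s) * pxx * px + (- 2 * q * s) * ux * px
      + ((- 1) * uxx * (ux\<^sup>2 - px\<^sup>2) + (- 1) * pxx * (2 * ux * px)) + (- s) * S * ux"
    unfolding ut pt g_def[symmetric] S_def by (simp add: algebra_simps power2_eq_square)
  have e1: "(10 / c + 3) * k\<^sup>2 * S = 10 / c * k\<^sup>2 * ux\<^sup>2 + 10 / c * k\<^sup>2 * px\<^sup>2 + 3 * (k\<^sup>2 * ux\<^sup>2) + 3 * (k\<^sup>2 * px\<^sup>2)"
    by (simp add: S_def algebra_simps add_divide_distrib)
  have e2: "k\<^sup>2 * S = k\<^sup>2 * ux\<^sup>2 + k\<^sup>2 * px\<^sup>2" "c / 4 * K = c / 4 * uxx\<^sup>2 + c / 4 * pxx\<^sup>2"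
    "c * (ux\<^sup>2 + pxx\<^sup>2) = c * ux\<^sup>2 + c * pxx\<^sup>2" "(1 + 2 / c) * S\<^sup>2 = S\<^sup>2 + 2 / c * S\<^sup>2"
    by (simp_all add: S_def K_def algebra_simps)
  have e3: "2 / c * k\<^sup>2 * ux\<^sup>2 \<le> 10 / c * k\<^sup>2 * ux\<^sup>2" "2 / c * k\<^sup>2 * px\<^sup>2 + 4 / c * k\<^sup>2 * px\<^sup>2 \<le> 10 / c * k\<^sup>2 * px\<^sup>2"
    using c_bounds by (auto simp: divide_right_mono mult_right_mono field_simps)
  have nn: "0 \<le> k\<^sup>2 * ux\<^sup>2" "0 \<le> k\<^sup>2 * px\<^sup>2" "0 \<le> c * uxx\<^sup>2" "0 \<le> c * pxx\<^sup>2" "0 \<le> c * ux\<^sup>2" using c_bounds by auto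
  show ?thesis
    unfolding G_def[symmetric] e1
    using id E co y1 y2 y3 y45 y6 c1 gn e3 nn unfolding e2 fr by linarith
qed

end

section \<open>Time derivatives of weighted energies\<close>

text \<open>Matches the regularity of a classical solution: \<open>fx\<close> is continuous in time,
  but no mixed derivative in \<open>t\<close> and \<open>x\<close> is available. The locale is
  real-valued and is instantiated once for the logarithmic amplitude and once for the phase.\<close>

locale smooth_strip =
  fixes T K :: real and f fx fxx ft :: "real \<Rightarrow> real \<Rightarrow> real"
  assumes fx: "\<And>t x. t \<in> {0..T} \<Longrightarrow> (f t has_real_derivative fx t x) (at x)"
    and fxx: "\<And>t x. t \<in> {0..T} \<Longrightarrow> (fx t has_real_derivative fxx t x) (at x)"
    and ft: "\<And>t x. t \<in> {0..T} \<Longrightarrow> ((\<lambda>s. f s x) has_real_derivative ft t x) (at t within {0..T})"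
    and cont: "continuous_on ({0..T} \<times> UNIV) (case_prod fx)"
      "continuous_on ({0..T} \<times> UNIV) (case_prod fxx)" "continuous_on ({0..T} \<times> UNIV) (case_prod ft)"
    and bound: "\<And>t x. t \<in> {0..T} \<Longrightarrow> \<bar>f t x\<bar> \<le> K" "\<And>t x. t \<in> {0..T} \<Longrightarrow> \<bar>fx t x\<bar> \<le> K"
      "\<And>t x. t \<in> {0..T} \<Longrightarrow> \<bar>fxx t x\<bar> \<le> K" "\<And>t x. t \<in> {0..T} \<Longrightarrow> \<bar>ft t x\<bar> \<le> K"
begin

lemma space_slice:
  "continuous_on ({0..T} \<times> UNIV) (case_prod g) \<Longrightarrow> t \<in> {0..T} \<Longrightarrow> continuous_on UNIV (g t)"
  for g :: "real \<Rightarrow> real \<Rightarrow> real"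
  using continuous_on_compose2[of "{0..T} \<times> UNIV" "case_prod g" UNIV "\<lambda>x. (t, x)"]
    continuous_on_Pair[OF continuous_on_const continuous_on_id, of UNIV t] by (auto simp: image_subset_iff)

lemma time_slice:
  "continuous_on ({0..T} \<times> UNIV) (case_prod g) \<Longrightarrow> continuous_on {0..T} (\<lambda>t. g t x)"
  for g :: "real \<Rightarrow> real \<Rightarrow> real"
  using continuous_on_compose2[of "{0..T} \<times> UNIV" "case_prod g" "{0..T}" "\<lambda>t. (t, x)"]
    continuous_on_Pair[OF continuous_on_id continuous_on_const, of "{0..T}" x] by (auto simp: image_subset_iff)

lemma bcont_slice:
  assumes "t \<in> {0..T}"
  shows "bcont (f t)" "bcont (fx t)" "bcont (fxx t)" "bcont (ft t)"
proof -
  have "continuous_on UNIV (f t)"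
    using fx[OF assms] by (auto intro!: continuous_at_imp_continuous_on DERIV_isCont)
  then show "bcont (f t)" "bcont (fx t)" "bcont (fxx t)" "bcont (ft t)"
    using bound assms cont space_slice by (auto intro!: bcontI[where B = K])
qed

lemma time_lipschitz:
  assumes "t \<in> {0..T}" "s \<in> {0..T}"
  shows "\<bar>f s x - f t x\<bar> \<le> K * \<bar>s - t\<bar>"
  using vector_derivative_lipschitz[of "{0..T}" "\<lambda>s. f s x" "\<lambda>s. ft s x" K t s] ft bound assms
  by (auto simp: has_real_derivative_iff_has_vector_derivative)

lemma weighted_square_deriv:
  assumes k: "0 < k" and t: "t \<in> {0..T}"
  shows "((\<lambda>t. \<integral>x. loc_weight k y x * (f t x)\<^sup>2 \<partial>lborel) has_real_derivative
    (\<integral>x. loc_weight k y x * (2 * f t x * ft t x) \<partial>lborel)) (at t within {0..T})"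
  unfolding has_real_derivative_iff_has_vector_derivative
proof (rule has_vector_derivative_integral[where H = "\<lambda>x. loc_weight k y x * (2 * K * K)"])
  show "((\<lambda>t. loc_weight k y x * (f t x)\<^sup>2) has_vector_derivative loc_weight k y x * (2 * f s x * ft s x)) (at s within {0..T})"
    if "s \<in> {0..T}" for s x
    using ft[OF that] unfolding has_real_derivative_iff_has_vector_derivative[symmetric]
    by (auto intro!: derivative_eq_intros)
  show "norm (loc_weight k y x * (2 * f s x * ft s x)) \<le> loc_weight k y x * (2 * K * K)"
    if "s \<in> {0..T}" for s x
  proof -
    have "\<bar>f s x\<bar> * \<bar>ft s x\<bar> \<le> K * K" using bound[OF that, of x] by (intro mult_mono) auto
    then show ?thesis using loc_weight_pos[of k y x] by (simp add: abs_mult)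
  qed
  show "integrable lborel (\<lambda>x. loc_weight k y x * (f s x)\<^sup>2)" if "s \<in> {0..T}" for s
    using bcont_slice[OF that] by (intro integrable_weighted[OF k] bcont_intros)
  show "integrable lborel (\<lambda>x. loc_weight k y x * (2 * K * K))"
    by (intro integrable_weighted[OF k] bcont_intros)
  have "integrable lborel (\<lambda>x. loc_weight k y x * (2 * f t x * ft t x))"
    using bcont_slice[OF t] by (intro integrable_weighted[OF k] bcont_intros)
  then show "(\<lambda>x. loc_weight k y x * (2 * f t x * ft t x)) \<in> borel_measurable lborel" by simp
qed (use t in auto)

text \<open>Formally this is twice the integral of \<open>fx\<close> times its time derivative,
  integrated by parts; since \<open>fx\<close> need not be differentiable in time, the integration
  by parts is done on the difference quotient. The difference of the squares of \<open>fx\<close>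
  factors, and the derivative is moved from \<open>f s - f t\<close> onto the weight and the sum of
  the gradients. The result \<open>R\<close> contains a quotient of \<open>f\<close> only, which is
  bounded by \<open>K\<close> and converges to \<open>ft\<close>.\<close>

lemma weighted_gradient_deriv:
  assumes k: "0 < k" and t: "t \<in> {0..T}"
  shows "((\<lambda>t. \<integral>x. loc_weight k y x * (fx t x)\<^sup>2 \<partial>lborel) has_real_derivative
    (\<integral>x. loc_weight k y x * (- 2 * ((log_slope k y x * fx t x + fxx t x) * ft t x)) \<partial>lborel)) (at t within {0..T})"
  unfolding has_field_derivative_iff tendsto_at_iff_sequentially comp_def
proof (intro allI impI)
  fix X :: "nat \<Rightarrow> real" assume X: "\<forall>i. X i \<in> {0..T} - {t}" "X \<longlonglongrightarrow> t"
  note ls = bcont_log_slope[OF less_imp_le[OF k], of y]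
  define R where "R s x = - ((f s x - f t x) / (s - t)) * (log_slope k y x * (fx s x + fx t x) + (fxx s x + fxx t x))" for s x
  have R: "((\<integral>x. loc_weight k y x * (fx s x)\<^sup>2 \<partial>lborel) - (\<integral>x. loc_weight k y x * (fx t x)\<^sup>2 \<partial>lborel)) / (s - t)
      = (\<integral>x. loc_weight k y x * R s x \<partial>lborel)" (is "?l = ?r")
    and Ri: "integrable lborel (\<lambda>x. loc_weight k y x * R s x)"
    if s: "s \<in> {0..T}" "s \<noteq> t" for s
  proof -
    note bs = bcont_slice[OF s(1)] bcont_slice[OF t]
    define h where "h x = (f s x - f t x) * (fx s x + fx t x)" for x
    define h' where "h' x = (fx s x - fx t x) * (fx s x + fx t x) + (f s x - f t x) * (fxx s x + fxx t x)" for x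
    have bh: "bcont h" "bcont h'" unfolding h_def[abs_def] h'_def[abs_def] using bs by (auto intro!: bcont_intros)
    have "(h has_real_derivative h' x) (at x)" for x
      unfolding h_def[abs_def] h'_def using fx[OF s(1)] fx[OF t] fxx[OF s(1)] fxx[OF t]
      by (auto intro!: derivative_eq_intros)
    from weighted_integral_by_parts[OF k bh this]
    have z: "(\<integral>x. loc_weight k y x * (log_slope k y x * h x + h' x) \<partial>lborel) = 0" .
    show Ri: "integrable lborel (\<lambda>x. loc_weight k y x * R s x)"
      unfolding R_def divide_inverse using bs ls by (intro integrable_weighted[OF k] bcont_intros)
    have zi: "integrable lborel (\<lambda>x. loc_weight k y x * (log_slope k y x * h x + h' x))"
      using ls bh by (intro integrable_weighted[OF k] bcont_intros)
    have si: "integrable lborel (\<lambda>x. loc_weight k y x * (fx r x)\<^sup>2)" if "r \<in> {0..T}" for r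
      using bcont_slice[OF that] by (intro integrable_weighted[OF k] bcont_intros)
    \<comment> \<open>The second summand on the right has integral 0 by \<open>z\<close>; it is
      added because the integrands then agree pointwise.\<close>
    have "(\<integral>x. loc_weight k y x * (fx s x)\<^sup>2 \<partial>lborel) - (\<integral>x. loc_weight k y x * (fx t x)\<^sup>2 \<partial>lborel)
      = (\<integral>x. (s - t) * (loc_weight k y x * R s x) + loc_weight k y x * (log_slope k y x * h x + h' x) \<partial>lborel)"
      unfolding Bochner_Integration.integral_diff[OF si[OF s(1)] si[OF t], symmetric]
    proof (rule Bochner_Integration.integral_cong[OF refl])
      fix x
      have "(s - t) * R s x = - ((f s x - f t x) * (log_slope k y x * (fx s x + fx t x) + (fxx s x + fxx t x)))"
        using s by (simp add: R_def)
      then have "(s - t) * R s x + (log_slope k y x * h x + h' x) = (fx s x)\<^sup>2 - (fx t x)\<^sup>2"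
        by (simp add: h_def h'_def power2_eq_square algebra_simps)
      then show "loc_weight k y x * (fx s x)\<^sup>2 - loc_weight k y x * (fx t x)\<^sup>2
        = (s - t) * (loc_weight k y x * R s x) + loc_weight k y x * (log_slope k y x * h x + h' x)"
        by (metis distrib_left mult.left_commute right_diff_distrib)
    qed
    also have "\<dots> = (s - t) * (\<integral>x. loc_weight k y x * R s x \<partial>lborel)"
      using Bochner_Integration.integral_add[OF _ zi, of "\<lambda>x. (s - t) * (loc_weight k y x * R s x)"] Ri z by simp
    finally show "?l = ?r" using s by simp
  qed
  have "(\<lambda>i. \<integral>x. loc_weight k y x * R (X i) x \<partial>lborel)
    \<longlonglongrightarrow> (\<integral>x. loc_weight k y x * (- 2 * ((log_slope k y x * fx t x + fxx t x) * ft t x)) \<partial>lborel)"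
  proof (rule integral_dominated_convergence[where w = "\<lambda>x. loc_weight k y x * (K * (k * (2 * K) + 2 * K))"])
    show "integrable lborel (\<lambda>x. loc_weight k y x * (K * (k * (2 * K) + 2 * K)))"
      by (intro integrable_weighted[OF k] bcont_intros)
    show "(\<lambda>x. loc_weight k y x * R (X i) x) \<in> borel_measurable lborel" for i
      using Ri[of "X i"] X by auto
    have "integrable lborel (\<lambda>x. loc_weight k y x * (- 2 * ((log_slope k y x * fx t x + fxx t x) * ft t x)))"
      using ls bcont_slice[OF t] by (intro integrable_weighted[OF k] bcont_intros)
    then show "(\<lambda>x. loc_weight k y x * (- 2 * ((log_slope k y x * fx t x + fxx t x) * ft t x))) \<in> borel_measurable lborel" by simp
    show "AE x in lborel. (\<lambda>i. loc_weight k y x * R (X i) x) \<longlonglongrightarrow> loc_weight k y x * (- 2 * ((log_slope k y x * fx t x + fxx t x) * ft t x))"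
    proof (rule AE_I2)
      fix x
      have "(\<lambda>i. (f (X i) x - f t x) / (X i - t)) \<longlonglongrightarrow> ft t x"
        using ft[OF t, of x, unfolded has_field_derivative_iff tendsto_at_iff_sequentially comp_def] X by blast
      moreover have "(\<lambda>i. fx (X i) x) \<longlonglongrightarrow> fx t x" "(\<lambda>i. fxx (X i) x) \<longlonglongrightarrow> fxx t x"
        using time_slice[OF cont(1), of x] time_slice[OF cont(2), of x] X t
        by (auto simp: continuous_on_sequentially comp_def)
      ultimately have "(\<lambda>i. loc_weight k y x * (- ((f (X i) x - f t x) / (X i - t)) * (log_slope k y x * (fx (X i) x + fx t x) + (fxx (X i) x + fxx t x))))
        \<longlonglongrightarrow> loc_weight k y x * (- ft t x * (log_slope k y x * (fx t x + fx t x) + (fxx t x + fxx t x)))"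
        by (intro tendsto_intros)
      moreover have "- ft t x * (log_slope k y x * (fx t x + fx t x) + (fxx t x + fxx t x)) = - 2 * ((log_slope k y x * fx t x + fxx t x) * ft t x)"
        by (simp add: algebra_simps)
      ultimately show "(\<lambda>i. loc_weight k y x * R (X i) x) \<longlonglongrightarrow> loc_weight k y x * (- 2 * ((log_slope k y x * fx t x + fxx t x) * ft t x))"
        unfolding R_def by (simp only:)
    qed
    show "AE x in lborel. norm (loc_weight k y x * R (X i) x) \<le> loc_weight k y x * (K * (k * (2 * K) + 2 * K))" for i
    proof (rule AE_I2)
      fix x
      have Xi: "X i \<in> {0..T}" "X i \<noteq> t" using X by auto
      have "\<bar>f (X i) x - f t x\<bar> / \<bar>X i - t\<bar> \<le> K"
        using time_lipschitz[OF t Xi(1), of x] Xi by (simp add: divide_le_eq)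
      moreover have "\<bar>log_slope k y x * (fx (X i) x + fx t x) + (fxx (X i) x + fxx t x)\<bar> \<le> k * (2 * K) + 2 * K"
      proof -
        have "\<bar>log_slope k y x * (fx (X i) x + fx t x)\<bar> \<le> k * (2 * K)"
          unfolding abs_mult using bound(2)[OF t, of x] bound(2)[OF Xi(1), of x] k abs_log_slope[of k y x]
          by (intro mult_mono) auto
        then show ?thesis using bound(3)[OF t, of x] bound(3)[OF Xi(1), of x] by linarith
      qed
      ultimately have "\<bar>R (X i) x\<bar> \<le> K * (k * (2 * K) + 2 * K)"
        unfolding R_def abs_mult abs_divide abs_minus_cancel using bound(1)[OF t, of x] by (intro mult_mono) auto
      then show "norm (loc_weight k y x * R (X i) x) \<le> loc_weight k y x * (K * (k * (2 * K) + 2 * K))"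
        using loc_weight_pos[of k y x] by (simp add: abs_mult)
    qed
  qed
  then show "(\<lambda>i. ((\<integral>x. loc_weight k y x * (fx (X i) x)\<^sup>2 \<partial>lborel) - (\<integral>x. loc_weight k y x * (fx t x)\<^sup>2 \<partial>lborel)) / (X i - t))
     \<longlonglongrightarrow> (\<integral>x. loc_weight k y x * (- 2 * ((log_slope k y x * fx t x + fxx t x) * ft t x)) \<partial>lborel)"
    using R X by simp
qed

end

section \<open>Closing the energy estimate for the logarithmic perturbation\<close>

locale polar_GL =
  U: smooth_strip T K u ux uxx ut + V: smooth_strip T K p px pxx pt
  for q T K :: real and u ux uxx ut p px pxx pt :: "real \<Rightarrow> real \<Rightarrow> real" +
  fixes c :: real
  assumes q: "q\<^sup>2 < 1 / 3" and c_def: "c = 2 * (1 - 3 * q\<^sup>2) / 3" and T: "0 < T"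
    and small: "\<And>t x. t \<in> {0..T} \<Longrightarrow> (u t x)\<^sup>2 + (p t x)\<^sup>2 \<le> (c / 16)\<^sup>2"
    and u_eq: "\<And>t x. t \<in> {0..T} \<Longrightarrow> ut t x = uxx t x - 2 * q * px t x + (ux t x)\<^sup>2 - (px t x)\<^sup>2
      + (1 - q\<^sup>2) * (1 - exp (2 * u t x))"
    and p_eq: "\<And>t x. t \<in> {0..T} \<Longrightarrow> pt t x = pxx t x + 2 * q * ux t x + 2 * ux t x * px t x"
begin

definition k :: real where "k = 1 / sqrt (1 + T)"

lemma k: "0 < k" "k\<^sup>2 * (1 + T) = 1" "k\<^sup>2 \<le> 1"
  using T by (auto simp: k_def power_divide)

lemma c_pos: "0 < c" "c \<le> 2 / 3"
  using q by (auto simp: c_def)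

lemma point: "eckhaus_point q c k (c / 16) (log_slope k y x)"
  using q c_def abs_log_slope[of k y x] k by unfold_locales auto

lemma slices:
  assumes "t \<in> {0..T}"
  shows "bcont (u t)" "bcont (ux t)" "bcont (uxx t)" "bcont (ut t)"
    "bcont (p t)" "bcont (px t)" "bcont (pxx t)" "bcont (pt t)"
  using U.bcont_slice[OF assms] V.bcont_slice[OF assms] by auto

context
  fixes y :: real
begin

abbreviation "\<rho> \<equiv> loc_weight k y"
abbreviation "\<sigma> \<equiv> log_slope k y"

lemma integrable_\<rho>: "bcont h \<Longrightarrow> integrable lborel (\<lambda>x. \<rho> x * h x)"
  by (rule integrable_weighted[OF k(1)])

lemma bcont_\<sigma>: "bcont \<sigma>"
  by (rule bcont_log_slope) (use k in auto)

definition E0 :: "real \<Rightarrow> real" where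
  "E0 t = (\<integral>x. \<rho> x * (u t x)\<^sup>2 \<partial>lborel) + (\<integral>x. \<rho> x * (p t x)\<^sup>2 \<partial>lborel)"

definition E1 :: "real \<Rightarrow> real" where
  "E1 t = (\<integral>x. \<rho> x * (ux t x)\<^sup>2 \<partial>lborel) + (\<integral>x. \<rho> x * (px t x)\<^sup>2 \<partial>lborel)"

definition DE0 :: "real \<Rightarrow> real" where
  "DE0 t = (\<integral>x. \<rho> x * (2 * u t x * ut t x) \<partial>lborel) + (\<integral>x. \<rho> x * (2 * p t x * pt t x) \<partial>lborel)"

definition DE1 :: "real \<Rightarrow> real" where
  "DE1 t = (\<integral>x. \<rho> x * (- 2 * ((\<sigma> x * ux t x + uxx t x) * ut t x)) \<partial>lborel)
    + (\<integral>x. \<rho> x * (- 2 * ((\<sigma> x * px t x + pxx t x) * pt t x)) \<partial>lborel)"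

lemma E0_deriv: "t \<in> {0..T} \<Longrightarrow> (E0 has_real_derivative DE0 t) (at t within {0..T})"
  unfolding E0_def[abs_def] DE0_def
  by (intro DERIV_add U.weighted_square_deriv V.weighted_square_deriv k)

lemma E1_deriv: "t \<in> {0..T} \<Longrightarrow> (E1 has_real_derivative DE1 t) (at t within {0..T})"
  unfolding E1_def[abs_def] DE1_def
  by (intro DERIV_add U.weighted_gradient_deriv V.weighted_gradient_deriv k)

lemma E0_eq: "t \<in> {0..T} \<Longrightarrow> E0 t = (\<integral>x. \<rho> x * ((u t x)\<^sup>2 + (p t x)\<^sup>2) \<partial>lborel)"
  unfolding E0_def using slices[of t]
  by (subst Bochner_Integration.integral_add[symmetric]) (auto intro!: integrable_\<rho> bcont_intros simp: distrib_left)

lemma E1_eq: "t \<in> {0..T} \<Longrightarrow> E1 t = (\<integral>x. \<rho> x * ((ux t x)\<^sup>2 + (px t x)\<^sup>2) \<partial>lborel)"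
  unfolding E1_def using slices[of t]
  by (subst Bochner_Integration.integral_add[symmetric]) (auto intro!: integrable_\<rho> bcont_intros simp: distrib_left)

lemma E_nonneg: "0 \<le> E0 t" "0 \<le> E1 t"
  unfolding E0_def E1_def using loc_weight_pos[of k y] by (auto simp: less_imp_le intro!: add_nonneg_nonneg Bochner_Integration.integral_nonneg mult_nonneg_nonneg)

lemma DE0_le: 
  assumes t: "t \<in> {0..T}"
  shows "DE0 t \<le> - c * E1 t + 12 / c * k\<^sup>2 * E0 t"
proof -
  note b = slices[OF t] bcont_\<sigma>
  define h where "h x = u t x * ux t x + p t x * px t x + 2 * q * u t x * p t x" for x
  define h' where "h' x = (ux t x)\<^sup>2 + u t x * uxx t x + (px t x)\<^sup>2 + p t x * pxx t x + 2 * q * (ux t x * p t x + u t x * px t x)" for x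
  have bh: "bcont h" "bcont h'" unfolding h_def[abs_def] h'_def[abs_def] using b by (auto intro!: bcont_intros)
  have "(h has_real_derivative h' x) (at x)" for x
    unfolding h_def[abs_def] h'_def using U.fx[OF t] V.fx[OF t] U.fxx[OF t] V.fxx[OF t]
    by (auto intro!: derivative_eq_intros simp: algebra_simps power2_eq_square)
  from weighted_integral_by_parts[OF k(1) bh this]
  have z: "(\<integral>x. \<rho> x * (\<sigma> x * h x + h' x) \<partial>lborel) = 0" .
  have i1: "integrable lborel (\<lambda>x. \<rho> x * (\<sigma> x * h x + h' x))"
    and i2: "integrable lborel (\<lambda>x. \<rho> x * ((ux t x)\<^sup>2 + (px t x)\<^sup>2))"
    and i3: "integrable lborel (\<lambda>x. \<rho> x * ((u t x)\<^sup>2 + (p t x)\<^sup>2))"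
    and i4: "integrable lborel (\<lambda>x. \<rho> x * (2 * u t x * ut t x))"
    and i5: "integrable lborel (\<lambda>x. \<rho> x * (2 * p t x * pt t x))"
    using b bh by (auto intro!: integrable_\<rho> bcont_intros)
  have "DE0 t = (\<integral>x. \<rho> x * (2 * u t x * ut t x) + \<rho> x * (2 * p t x * pt t x) \<partial>lborel)"
    unfolding DE0_def using Bochner_Integration.integral_add[OF i4 i5] by simp
  also have "\<dots> \<le> (\<integral>x. 2 * (\<rho> x * (\<sigma> x * h x + h' x)) + (- c) * (\<rho> x * ((ux t x)\<^sup>2 + (px t x)\<^sup>2))
      + (12 / c * k\<^sup>2) * (\<rho> x * ((u t x)\<^sup>2 + (p t x)\<^sup>2)) \<partial>lborel)"
  proof (rule integral_mono)
    fix x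
    interpret eckhaus_point q c k "c / 16" "\<sigma> x" by (rule point)
    have "u t x * ut t x + p t x * pt t x \<le> (\<sigma> x * h x + h' x)
        - c / 2 * ((ux t x)\<^sup>2 + (px t x)\<^sup>2) + 6 / c * k\<^sup>2 * ((u t x)\<^sup>2 + (p t x)\<^sup>2)"
      using energy0_point[OF small[OF t] u_eq[OF t] p_eq[OF t], of x] unfolding h_def h'_def .
    from mult_left_mono[OF this, of "2 * \<rho> x"] 
    show "\<rho> x * (2 * u t x * ut t x) + \<rho> x * (2 * p t x * pt t x) \<le> 2 * (\<rho> x * (\<sigma> x * h x + h' x))
      + (- c) * (\<rho> x * ((ux t x)\<^sup>2 + (px t x)\<^sup>2)) + (12 / c * k\<^sup>2) * (\<rho> x * ((u t x)\<^sup>2 + (p t x)\<^sup>2))"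
      using loc_weight_pos[of k y x] by (simp add: algebra_simps)
  qed (use i1 i2 i3 i4 i5 in auto)
  also have "\<dots> = 2 * (\<integral>x. \<rho> x * (\<sigma> x * h x + h' x) \<partial>lborel) + (- c) * E1 t + (12 / c * k\<^sup>2) * E0 t"
    unfolding E0_eq[OF t] E1_eq[OF t] using i1 i2 i3 by simp
  finally show ?thesis using z by simp
qed

lemma DE1_le:
  assumes t: "t \<in> {0..T}"
  shows "DE1 t \<le> (20 / c + 6) * k\<^sup>2 * E1 t"
proof -
  note b = slices[OF t] bcont_\<sigma>
  define g where "g x = (1 - q\<^sup>2) * (1 - exp (2 * u t x))" for x
  define S where "S x = (ux t x)\<^sup>2 + (px t x)\<^sup>2" for x
  define m where "m x = u t x * ux t x + p t x * px t x" for x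
  define h where "h x = (2 * q * ux t x * px t x - ux t x * g x) + 2 * (1 + 2 / c) * (S x * m x)" for x
  define h' where "h' x = (2 * q * (uxx t x * px t x + ux t x * pxx t x) - uxx t x * g x
      + 2 * (1 - q\<^sup>2) * exp (2 * u t x) * (ux t x)\<^sup>2)
    + 2 * (1 + 2 / c) * (2 * (ux t x * uxx t x + px t x * pxx t x) * m x
      + S x * (S x + u t x * uxx t x + p t x * pxx t x))" for x
  have bg: "bcont g" "bcont S" "bcont m" unfolding g_def[abs_def] S_def[abs_def] m_def[abs_def]
    using b by (auto intro!: bcont_intros)
  have bh: "bcont h" "bcont h'" unfolding h_def[abs_def] h'_def[abs_def] using b bg by (auto intro!: bcont_intros)
  note d = U.fx[OF t] V.fx[OF t] U.fxx[OF t] V.fxx[OF t]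
  have dg: "(g has_real_derivative - 2 * (1 - q\<^sup>2) * exp (2 * u t x) * ux t x) (at x)" for x
    unfolding g_def[abs_def] using d by (auto intro!: derivative_eq_intros simp: algebra_simps)
  have dS: "(S has_real_derivative 2 * (ux t x * uxx t x + px t x * pxx t x)) (at x)" for x
    unfolding S_def[abs_def] using d by (auto intro!: derivative_eq_intros simp: algebra_simps)
  have dm: "(m has_real_derivative S x + u t x * uxx t x + p t x * pxx t x) (at x)" for x
    unfolding m_def[abs_def] S_def using d by (auto intro!: derivative_eq_intros simp: algebra_simps power2_eq_square)
  have "(h has_real_derivative h' x) (at x)" for x
    unfolding h_def[abs_def] h'_def
    by (rule derivative_eq_intros d dg dS dm refl)+ (simp add: power2_eq_square algebra_simps)
  from weighted_integral_by_parts[OF k(1) bh this]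
  have z: "(\<integral>x. \<rho> x * (\<sigma> x * h x + h' x) \<partial>lborel) = 0" .
  have i1: "integrable lborel (\<lambda>x. \<rho> x * (\<sigma> x * h x + h' x))"
    and i2: "integrable lborel (\<lambda>x. \<rho> x * S x)"
    and i4: "integrable lborel (\<lambda>x. \<rho> x * (- 2 * ((\<sigma> x * ux t x + uxx t x) * ut t x)))"
    and i5: "integrable lborel (\<lambda>x. \<rho> x * (- 2 * ((\<sigma> x * px t x + pxx t x) * pt t x)))"
    using b bh bg by (auto intro!: integrable_\<rho> bcont_intros)
  \<comment> \<open>\<open>energy1_point\<close> lists the Gagliardo-Nirenberg flux apart from the
    quadratic flux, whereas \<open>h\<close> and \<open>h'\<close> contain their sum, so that a
    single integration by parts removes both.\<close>
  have regroup: "s * (A + L * (B * B')) + (D + L * D') = s * A + D + L * (s * B * B' + D')" for s A B B' L D D' :: real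
    by (simp add: algebra_simps)
  have "DE1 t = (\<integral>x. \<rho> x * (- 2 * ((\<sigma> x * ux t x + uxx t x) * ut t x))
      + \<rho> x * (- 2 * ((\<sigma> x * px t x + pxx t x) * pt t x)) \<partial>lborel)"
    unfolding DE1_def using Bochner_Integration.integral_add[OF i4 i5] by simp
  also have "\<dots> \<le> (\<integral>x. 2 * (\<rho> x * (\<sigma> x * h x + h' x)) + ((20 / c + 6) * k\<^sup>2) * (\<rho> x * S x) \<partial>lborel)"
  proof (rule integral_mono)
    fix x
    interpret eckhaus_point q c k "c / 16" "\<sigma> x" by (rule point)
    have "- ((\<sigma> x * ux t x + uxx t x) * ut t x + (\<sigma> x * px t x + pxx t x) * pt t x)
        \<le> (\<sigma> x * h x + h' x) + (10 / c + 3) * k\<^sup>2 * S x"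
      using energy1_point[OF small[OF t] u_eq[OF t] p_eq[OF t], of x]
      unfolding h_def h'_def S_def[symmetric] m_def[symmetric] g_def[symmetric] regroup .
    from mult_left_mono[OF this, of "2 * \<rho> x"] 
    have "2 * \<rho> x * (- ((\<sigma> x * ux t x + uxx t x) * ut t x + (\<sigma> x * px t x + pxx t x) * pt t x))
      \<le> 2 * \<rho> x * ((\<sigma> x * h x + h' x) + (10 / c + 3) * k\<^sup>2 * S x)"
      using loc_weight_pos[of k y x] by simp
    moreover have "2 * \<rho> x * ((\<sigma> x * h x + h' x) + (10 / c + 3) * k\<^sup>2 * S x)
      = 2 * (\<rho> x * (\<sigma> x * h x + h' x)) + ((20 / c + 6) * k\<^sup>2) * (\<rho> x * S x)"
      by (simp add: algebra_simps)
    ultimately show "\<rho> x * (- 2 * ((\<sigma> x * ux t x + uxx t x) * ut t x))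
      + \<rho> x * (- 2 * ((\<sigma> x * px t x + pxx t x) * pt t x)) \<le> 2 * (\<rho> x * (\<sigma> x * h x + h' x)) + ((20 / c + 6) * k\<^sup>2) * (\<rho> x * S x)"
      by (simp add: algebra_simps)
  qed (use i1 i2 i4 i5 in auto)
  also have "\<dots> = 2 * (\<integral>x. \<rho> x * (\<sigma> x * h x + h' x) \<partial>lborel) + ((20 / c + 6) * k\<^sup>2) * E1 t"
    unfolding E1_eq[OF t] S_def[symmetric] using i1 i2 by simp
  finally show ?thesis using z by simp
qed

text \<open>The dissipation in \<open>DE0_le\<close>, divided by \<open>c\<close>, is exactly
  \<open>- E1 t\<close> and cancels the term produced by differentiating the factor
  \<open>1 + t\<close>. What remains is at most \<open>G * k\<^sup>2\<close> times the functional,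
  where \<open>G\<close> is the larger of the two growth constants \<open>12 / c\<close> and
  \<open>20 / c + 6\<close>. Gronwall's argument then yields the exponent
  \<open>G * k\<^sup>2 * T\<close>, which is at most \<open>G\<close>.\<close>

lemma energy_growth: "E0 T / c + (1 + T) * E1 T \<le> exp (20 / c + 6) * (E0 0 / c + E1 0)"
proof -
  define G where "G = 20 / c + 6"
  define F where "F t = exp (- G * k\<^sup>2 * t) * (E0 t / c + (1 + t) * E1 t)" for t
  define F' where "F' t = exp (- G * k\<^sup>2 * t) * (DE0 t / c + E1 t + (1 + t) * DE1 t - G * k\<^sup>2 * (E0 t / c + (1 + t) * E1 t))" for t
  have F: "(F has_real_derivative F' t) (at t within {0..T})" if "t \<in> {0..T}" for t
  proof -
    have "((\<lambda>t. 1 + t) has_real_derivative 1) (at t within {0..T})" by (auto intro!: derivative_eq_intros)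
    note m = DERIV_add[OF DERIV_cdivide[OF E0_deriv[OF that], of c] DERIV_mult[OF this E1_deriv[OF that]]]
    have "((\<lambda>t. exp (- G * k\<^sup>2 * t)) has_real_derivative exp (- G * k\<^sup>2 * t) * (- G * k\<^sup>2)) (at t within {0..T})"
      by (auto intro!: derivative_eq_intros)
    from DERIV_mult[OF this m] show ?thesis
      unfolding F_def[abs_def] F'_def by (rule DERIV_cong) (simp add: algebra_simps)
  qed
  have neg: "F' t \<le> 0" if t: "t \<in> {0..T}" for t
  proof -
    have "DE0 t / c \<le> (- c * E1 t + 12 / c * k\<^sup>2 * E0 t) / c"
      using DE0_le[OF t] c_pos by (intro divide_right_mono) auto
    also have "\<dots> = - E1 t + 12 / c * k\<^sup>2 * (E0 t / c)" using c_pos by (simp add: field_simps)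
    also have "\<dots> \<le> - E1 t + G * k\<^sup>2 * (E0 t / c)"
    proof -
      have "12 / c \<le> G" using divide_right_mono[of 12 20 c] c_pos by (simp add: G_def)
      then have "12 / c * k\<^sup>2 * (E0 t / c) \<le> G * k\<^sup>2 * (E0 t / c)"
        using E_nonneg(1)[of t] c_pos by (intro mult_right_mono) auto
      then show ?thesis by simp
    qed
    finally have 1: "DE0 t / c \<le> - E1 t + G * k\<^sup>2 * (E0 t / c)" .
    have 2: "(1 + t) * DE1 t \<le> (1 + t) * (G * k\<^sup>2 * E1 t)"
      using DE1_le[OF t] t unfolding G_def by (intro mult_left_mono) auto
    have "DE0 t / c + E1 t + (1 + t) * DE1 t - G * k\<^sup>2 * (E0 t / c + (1 + t) * E1 t) \<le> 0"
      using 1 2 unfolding distrib_left[of "G * k\<^sup>2"] mult.left_commute[of "1 + t"] by linarith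
    then show ?thesis unfolding F'_def by (simp add: mult_le_0_iff)
  qed
  have "F T \<le> F 0"
  proof (rule DERIV_nonpos_imp_decreasing_open[where f = F and a = 0 and b = T])
    show "\<exists>y. (F has_real_derivative y) (at x) \<and> y \<le> 0" if "0 < x" "x < T" for x
      using F[of x] neg[of x] that at_within_Icc_at[of 0 x T] by auto
    show "continuous_on {0..T} F"
      by (rule DERIV_continuous_on[OF F])
  qed (use T in auto)
  then have "exp (- G * k\<^sup>2 * T) * (E0 T / c + (1 + T) * E1 T) \<le> E0 0 / c + E1 0" by (simp add: F_def)
  then have "exp G * (exp (- G * k\<^sup>2 * T) * (E0 T / c + (1 + T) * E1 T)) \<le> exp G * (E0 0 / c + E1 0)" by simp
  moreover have "E0 T / c + (1 + T) * E1 T \<le> exp G * (exp (- G * k\<^sup>2 * T) * (E0 T / c + (1 + T) * E1 T))"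
  proof -
    have "k\<^sup>2 * T \<le> 1" using k(2) zero_le_power2[of k] unfolding distrib_left by linarith
    then have "G * (k\<^sup>2 * T) \<le> G * 1" using c_pos by (intro mult_left_mono) (auto simp: G_def)
    then have "1 \<le> exp G * exp (- G * k\<^sup>2 * T)" by (simp add: mult_exp_exp mult.assoc)
    from mult_right_mono[OF this, of "E0 T / c + (1 + T) * E1 T"] show ?thesis
      using E_nonneg[of T] c_pos T by (simp add: mult.assoc)
  qed
  ultimately have "E0 T / c + (1 + T) * E1 T \<le> exp G * (E0 0 / c + E1 0)" by linarith
  then show ?thesis unfolding G_def .
qed

text \<open>\<open>weighted_pointwise_bound\<close> is applied to
  \<open>u\<^sup>2 + p\<^sup>2\<close>. One factor \<open>k\<close> on the zeroth-order energy comes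
  from the slope of the weight, the other from Young's inequality, which leaves \<open>1 / k\<close>
  on the gradient energy.\<close>

lemma pointwise_le_energy: "(u T y)\<^sup>2 + (p T y)\<^sup>2 \<le> 3 * k * (E0 T / c + (1 + T) * E1 T)"
proof -
  have t: "T \<in> {0..T}" using T by simp
  note b = slices[OF t] bcont_\<sigma>
  define h where "h x = (u T x)\<^sup>2 + (p T x)\<^sup>2" for x
  define h' where "h' x = 2 * (u T x * ux T x + p T x * px T x)" for x
  have bh: "bcont h" "bcont h'" unfolding h_def[abs_def] h'_def[abs_def] using b by (auto intro!: bcont_intros)
  have der: "(h has_real_derivative h' x) (at x)" for x
    unfolding h_def[abs_def] h'_def using U.fx[OF t] V.fx[OF t]
    by (auto intro!: derivative_eq_intros simp: algebra_simps)
  have i1: "integrable lborel (\<lambda>x. \<rho> x * \<bar>\<sigma> x * h x + h' x\<bar>)"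
    and i2: "integrable lborel (\<lambda>x. \<rho> x * ((ux T x)\<^sup>2 + (px T x)\<^sup>2))"
    and i3: "integrable lborel (\<lambda>x. \<rho> x * ((u T x)\<^sup>2 + (p T x)\<^sup>2))"
    using b bh by (auto intro!: integrable_\<rho> bcont_intros)
  have "\<bar>h y\<bar> \<le> (\<integral>x. \<rho> x * \<bar>\<sigma> x * h x + h' x\<bar> \<partial>lborel)"
    by (rule weighted_pointwise_bound[OF k(1) bh der])
  also have "\<dots> \<le> (\<integral>x. (2 * k) * (\<rho> x * ((u T x)\<^sup>2 + (p T x)\<^sup>2)) + (1 / k) * (\<rho> x * ((ux T x)\<^sup>2 + (px T x)\<^sup>2)) \<partial>lborel)"
  proof (rule integral_mono)
    fix x
    have "\<bar>\<sigma> x * h x\<bar> \<le> k * ((u T x)\<^sup>2 + (p T x)\<^sup>2)"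
      using abs_log_slope[of k y x] k by (auto simp: abs_mult h_def intro!: mult_mono)
    moreover have am: "2 * \<bar>a * b\<bar> \<le> k * a\<^sup>2 + 1 / k * b\<^sup>2" for a b :: real
    proof -
      have "0 \<le> (k * \<bar>a\<bar> - \<bar>b\<bar>)\<^sup>2 / k" using k by simp
      also have "\<dots> = k * a\<^sup>2 + 1 / k * b\<^sup>2 - 2 * \<bar>a * b\<bar>"
        using k by (simp add: power2_diff abs_mult field_simps) (simp add: power2_eq_square)
      finally show ?thesis by simp
    qed
    have "\<bar>h' x\<bar> \<le> 2 * \<bar>u T x * ux T x\<bar> + 2 * \<bar>p T x * px T x\<bar>"
    proof -
      have "\<bar>h' x\<bar> = 2 * \<bar>u T x * ux T x + p T x * px T x\<bar>" by (simp only: h'_def abs_mult abs_numeral)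
      then show ?thesis using abs_triangle_ineq[of "u T x * ux T x" "p T x * px T x"] by simp
    qed
    then have "\<bar>h' x\<bar> \<le> k * ((u T x)\<^sup>2 + (p T x)\<^sup>2) + 1 / k * ((ux T x)\<^sup>2 + (px T x)\<^sup>2)"
      using am[of "u T x" "ux T x"] am[of "p T x" "px T x"] unfolding distrib_left by linarith
    ultimately have "\<bar>\<sigma> x * h x + h' x\<bar> \<le> 2 * k * ((u T x)\<^sup>2 + (p T x)\<^sup>2) + 1 / k * ((ux T x)\<^sup>2 + (px T x)\<^sup>2)"
      by linarith
    from mult_left_mono[OF this, of "\<rho> x"] show "\<rho> x * \<bar>\<sigma> x * h x + h' x\<bar>
      \<le> (2 * k) * (\<rho> x * ((u T x)\<^sup>2 + (p T x)\<^sup>2)) + (1 / k) * (\<rho> x * ((ux T x)\<^sup>2 + (px T x)\<^sup>2))"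
      using loc_weight_pos[of k y x] by (simp add: algebra_simps)
  qed (use i1 i2 i3 in auto)
  also have "\<dots> = 2 * k * E0 T + 1 / k * E1 T"
    unfolding E0_eq[OF t] E1_eq[OF t] using i2 i3 by simp
  also have "\<dots> \<le> 3 * k * (E0 T / c + (1 + T) * E1 T)"
  proof -
    have "E0 T \<le> E0 T / c" using E_nonneg(1)[of T] c_pos by (simp add: le_divide_eq mult_left_le)
    from mult_left_mono[OF this, of k] have "k * E0 T \<le> k * (E0 T / c)" using k by simp
    moreover have "0 \<le> k * (E0 T / c)" using k E_nonneg(1)[of T] c_pos by simp
    \<comment> \<open>The choice of \<open>k\<close> enters here: the gradient term of the
      interpolation acquires precisely the factor \<open>1 + T\<close> that the functional
      carries.\<close>
    moreover have "1 / k = k * (1 + T)" using k by (simp add: field_simps power2_eq_square)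
    then have "1 / k * E1 T = k * ((1 + T) * E1 T)" by simp
    moreover have "0 \<le> k * ((1 + T) * E1 T)" using E_nonneg(2)[of T] k T by simp
    ultimately show ?thesis unfolding distrib_left mult.assoc by linarith
  qed
  finally show ?thesis by (simp add: h_def)
qed

text \<open>The initial energies are at most the mass \<open>pi / k\<close> of the weight times
  \<open>e\<^sup>2\<close>, and this \<open>1 / k\<close> cancels the factor \<open>k\<close> of
  \<open>pointwise_le_energy\<close>. The resulting constant depends neither on \<open>T\<close> nor
  on the bound \<open>K\<close>.\<close>

lemma pointwise_bound:
  assumes "\<And>x. (u 0 x)\<^sup>2 + (p 0 x)\<^sup>2 \<le> e\<^sup>2" "\<And>x. (ux 0 x)\<^sup>2 + (px 0 x)\<^sup>2 \<le> e\<^sup>2"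
  shows "(u T y)\<^sup>2 + (p T y)\<^sup>2 \<le> 3 * pi * exp (20 / c + 6) * (1 / c + 1) * e\<^sup>2"
proof -
  have t: "0 \<in> {0..T}" using T by simp
  have i: "integrable lborel \<rho>" "(\<integral>x. \<rho> x \<partial>lborel) = pi / k"
    using has_bochner_integral_loc_weight[OF k(1), of y] by (auto simp: has_bochner_integral_iff)
  have le: "(\<integral>x. \<rho> x * h x \<partial>lborel) \<le> pi / k * e\<^sup>2" if "bcont h" "\<And>x. h x \<le> e\<^sup>2" for h
  proof -
    have "(\<integral>x. \<rho> x * h x \<partial>lborel) \<le> (\<integral>x. \<rho> x * e\<^sup>2 \<partial>lborel)"
      using that loc_weight_pos[of k y] i by (intro integral_mono integrable_\<rho> bcont_intros(1)) (auto intro!: mult_left_mono simp: less_imp_le)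
    then show ?thesis using i by simp
  qed
  have "E0 0 \<le> pi / k * e\<^sup>2" "E1 0 \<le> pi / k * e\<^sup>2"
    unfolding E0_eq[OF t] E1_eq[OF t]
    by (rule le; use slices[OF t] assms in \<open>force intro!: bcont_intros\<close>)+
  then have "E0 0 / c + E1 0 \<le> (pi / k * e\<^sup>2) / c + pi / k * e\<^sup>2"
    using c_pos by (intro add_mono divide_right_mono) auto
  also have "\<dots> = (1 / c + 1) * (pi / k * e\<^sup>2)" by (simp add: distrib_right add_divide_distrib)
  finally have "exp (20 / c + 6) * (E0 0 / c + E1 0) \<le> exp (20 / c + 6) * ((1 / c + 1) * (pi / k * e\<^sup>2))"
    by (rule mult_left_mono) simp
  then have "3 * k * (E0 T / c + (1 + T) * E1 T) \<le> 3 * k * (exp (20 / c + 6) * ((1 / c + 1) * (pi / k * e\<^sup>2)))"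
    using energy_growth k by (intro mult_left_mono) auto
  also have "\<dots> = 3 * pi * exp (20 / c + 6) * (1 / c + 1) * e\<^sup>2" using k by simp
  finally show ?thesis using pointwise_le_energy by linarith
qed

end

end

section \<open>Gaussian averages and Duhamel integrals\<close>

text \<open>Serves the substitution \<open>s = t * (1 - r)\<close> in the first variable of an
  integral over pairs, which relates physical time to the normalized time of the Duhamel
  integrals.\<close>

lemma lborel_pair_fst_affine:
  fixes c t :: real
  assumes c: "c \<noteq> 0"
  shows "(lborel :: (real \<times> real) measure)
    = density (distr lborel borel (\<lambda>\<omega>. (t + c * fst \<omega>, snd \<omega>))) (\<lambda>_. ennreal \<bar>c\<bar>)"
proof -
  define d :: "real \<times> real \<Rightarrow> real" where "d j = (if j = (1, 0) then c else 1)" for j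
  have B: "(Basis :: (real \<times> real) set) = {(1, 0), (0, 1)}" by (auto simp: Basis_prod_def)
  have "(t, 0) + (\<Sum>j\<in>Basis. (d j * (\<omega> \<bullet> j)) *\<^sub>R j) = (t + c * fst \<omega>, snd \<omega>)" for \<omega> :: "real \<times> real"
    by (cases \<omega>) (simp add: B d_def)
  moreover have "(\<Prod>j\<in>Basis. \<bar>d j\<bar>) = \<bar>c\<bar>" by (simp add: B d_def)
  ultimately show ?thesis
    using lborel_affine_euclidean[of d "(t, 0)"] c by (simp add: d_def)
qed

lemma measurable_fst_affine:
  "(\<lambda>\<omega>. (t + c * fst \<omega>, snd \<omega>)) \<in> borel_measurable (borel :: (real \<times> real) measure)"
  by (intro borel_measurable_continuous_onI continuous_intros)

lemma lborel_integral_pair_fst_affine: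
  fixes F :: "real \<times> real \<Rightarrow> 'a::{banach, second_countable_topology}"
  assumes c: "c \<noteq> 0" and F: "F \<in> borel_measurable borel"
  shows "(\<integral>\<omega>. F \<omega> \<partial>lborel) = \<bar>c\<bar> *\<^sub>R (\<integral>\<omega>. F (t + c * fst \<omega>, snd \<omega>) \<partial>lborel)"
proof -
  let ?T = "\<lambda>\<omega>. (t + c * fst \<omega>, snd \<omega>) :: real \<times> real"
  let ?D = "distr lborel borel ?T"
  note T = measurable_fst_affine[of t c]
  have FD: "F \<in> borel_measurable ?D" using F by simp
  have T': "?T \<in> lborel \<rightarrow>\<^sub>M borel" using T by simp
  have m: "integral\<^sup>L lborel F = integral\<^sup>L (density ?D (\<lambda>_. ennreal \<bar>c\<bar>)) F"
    by (simp only: lborel_pair_fst_affine[OF c, of t, symmetric])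
  show "(\<integral>\<omega>. F \<omega> \<partial>lborel) = \<bar>c\<bar> *\<^sub>R (\<integral>\<omega>. F (?T \<omega>) \<partial>lborel)"
    unfolding m by (subst integral_density[OF FD]) (simp_all add: integral_distr[OF T' F])
qed

lemma integrable_times_lborel:
  fixes f :: "'a::euclidean_space \<Rightarrow> real" and g :: "'b::euclidean_space \<Rightarrow> real"
  assumes f: "integrable lborel f" and g: "integrable lborel g"
  shows "integrable lborel (\<lambda>\<omega>. f (fst \<omega>) * g (snd \<omega>))"
proof -
  have [measurable]: "f \<in> borel_measurable borel" "g \<in> borel_measurable borel" using f g by auto
  have "integrable (lborel \<Otimes>\<^sub>M lborel) (\<lambda>\<omega>. f (fst \<omega>) * g (snd \<omega>))"
  proof (rule lborel_pair.Fubini_integrable)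
    show "integrable lborel (\<lambda>x. \<integral>y. norm (f (fst (x, y)) * g (snd (x, y))) \<partial>lborel)"
      using f g by (simp add: abs_mult)
  qed (use g in auto)
  then show ?thesis by (simp add: lborel_prod)
qed

lemma integral_lborel_pair:
  fixes F :: "'a::euclidean_space \<times> 'b::euclidean_space \<Rightarrow> 'c::{banach, second_countable_topology}"
  assumes "integrable lborel F"
  shows "(\<integral>\<omega>. F \<omega> \<partial>lborel) = (\<integral>x. (\<integral>y. F (x, y) \<partial>lborel) \<partial>lborel)"
    and "(\<integral>\<omega>. F \<omega> \<partial>lborel) = (\<integral>y. (\<integral>x. F (x, y) \<partial>lborel) \<partial>lborel)"
proof -
  have F: "integrable (lborel \<Otimes>\<^sub>M lborel) F" using assms by (simp add: lborel_prod)
  then show 1: "(\<integral>\<omega>. F \<omega> \<partial>lborel) = (\<integral>x. (\<integral>y. F (x, y) \<partial>lborel) \<partial>lborel)"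
    using lborel_pair.integral_fst'[OF F] by (simp add: lborel_prod)
  show "(\<integral>\<omega>. F \<omega> \<partial>lborel) = (\<integral>y. (\<integral>x. F (x, y) \<partial>lborel) \<partial>lborel)"
    unfolding 1 using lborel_pair.Fubini_integral[of "\<lambda>x y. F (x, y)"] F by simp
qed

text \<open>Singular kernels are never differentiated here. An integral identity is first
  established by Fubini, and continuity of the candidate derivative then gives differentiability,
  one-sided at the ends. Both the space derivative of a Duhamel integral of a continuous source and
  the time derivative of the solution are obtained in this way.\<close>

lemma has_vector_derivative_from_integral:
  fixes F f :: "real \<Rightarrow> 'a::euclidean_space"
  assumes f: "continuous_on {l..u} f"
    and F: "\<And>b. b \<in> {l..u} \<Longrightarrow> F b - F l = (\<integral>y. indicator {l..b} y *\<^sub>R f y \<partial>lborel)"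
    and x: "x \<in> {l..u}"
  shows "(F has_vector_derivative f x) (at x within {l..u})"
proof -
  obtain G where G: "\<And>x. x \<in> {l..u} \<Longrightarrow> (G has_vector_derivative f x) (at x within {l..u})"
    using antiderivative_continuous[OF f] by blast
  have eq: "F b = G b + (F l - G l)" if b: "b \<in> {l..u}" for b
  proof -
    have "(\<integral>y. indicator {l..b} y *\<^sub>R f y \<partial>lborel) = G b - G l"
      by (rule integral_FTC_atLeastAtMost)
        (use b f in \<open>auto intro: has_vector_derivative_within_subset[OF G] continuous_on_subset\<close>)
    with F[OF b] have "F b - F l + F l = G b - G l + F l" by (simp only:)
    then show ?thesis by (simp add: add_diff_eq diff_add_eq)
  qed
  have G': "((\<lambda>b. G b + (F l - G l)) has_vector_derivative f x) (at x within {l..u})"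
    using G[OF x] by (auto intro!: derivative_eq_intros)
  show ?thesis by (rule has_vector_derivative_transform[OF x _ G']) (rule eq)
qed

section \<open>Gaussian integration by parts and the square-root singularity\<close>

abbreviation gauss :: "real \<Rightarrow> real" where "gauss \<equiv> std_normal_density"

lemma integrable_gauss: "integrable lborel gauss" and integral_gauss: "(\<integral>z. gauss z \<partial>lborel) = 1"
  using std_normal_moment_even[of 0] by (auto simp: has_bochner_integral_iff)

lemma integrable_gauss_ident: "integrable lborel (\<lambda>z. z * gauss z)"
  using integrable_std_normal_moment[of 1] by (simp add: mult.commute)

lemma gauss_deriv: "(gauss has_real_derivative - (z * gauss z)) (at z)"
proof -
  have "((\<lambda>z. 1 / sqrt (2 * pi) * exp (- z\<^sup>2 / 2)) has_real_derivative 1 / sqrt (2 * pi) * (exp (- z\<^sup>2 / 2) * (- z))) (at z)"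
    by (rule DERIV_cmult) (auto intro!: derivative_eq_intros)
  then show ?thesis
    unfolding std_normal_density_def[abs_def] by (rule DERIV_cong) (simp only: mult_ac mult_minus_right mult_minus_left)
qed

lemma gauss_tendsto: "(gauss \<longlongrightarrow> 0) at_top" "(gauss \<longlongrightarrow> 0) at_bot"
proof -
  have "filterlim (\<lambda>z::real. z\<^sup>2 / 2) at_top at_top"
    using filterlim_tendsto_pos_mult_at_top[OF tendsto_const, of "1 / 2" "\<lambda>z::real. z\<^sup>2" at_top]
      filterlim_pow_at_top[OF _ filterlim_ident, of 2] by simp
  then have "((\<lambda>z::real. exp (- (z\<^sup>2 / 2))) \<longlongrightarrow> 0) at_top"
    by (intro filterlim_compose[OF exp_at_bot]) (simp add: filterlim_uminus_at_bot)
  from tendsto_mult_right_zero[OF this, of "1 / sqrt (2 * pi)"] show t: "(gauss \<longlongrightarrow> 0) at_top"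
    by (simp add: std_normal_density_def[abs_def])
  then show "(gauss \<longlongrightarrow> 0) at_bot"
    by (simp add: filterlim_at_bot_mirror std_normal_density_def[abs_def])
qed

text \<open>Stein's identity: \<open>gauss\<close> has derivative \<open>- z * gauss z\<close>, so
  the difference of the two integrands is a total derivative. A factor \<open>z\<close> is thus
  worth a derivative of \<open>f\<close>, which accounts for both the smoothing in space and the
  heat equation itself.\<close>

lemma stein:
  fixes f f' :: "real \<Rightarrow> complex"
  assumes der: "\<And>z. (f has_vector_derivative f' z) (at z)" and cont: "continuous_on UNIV f'"
    and bd: "\<And>z. norm (f z) \<le> B" "\<And>z. norm (f' z) \<le> B"
  shows "(\<integral>z. (z * gauss z) *\<^sub>R f z \<partial>lborel) = (\<integral>z. gauss z *\<^sub>R f' z \<partial>lborel)"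
proof -
  have cf: "continuous_on UNIV f"
    using der by (auto intro!: continuous_at_imp_continuous_on has_vector_derivative_continuous)
  then have [measurable]: "f \<in> borel_measurable borel" "f' \<in> borel_measurable borel"
    using cont by (auto intro: borel_measurable_continuous_onI)
  have i: "integrable lborel (\<lambda>z. w z *\<^sub>R h z)"
    if "integrable lborel w" "h \<in> borel_measurable borel" "\<And>z. norm (h z) \<le> B" for w :: "real \<Rightarrow> real" and h :: "real \<Rightarrow> complex"
    by (rule Bochner_Integration.integrable_bound[of _ "\<lambda>z. w z * B"])
      (use that order_trans[OF norm_ge_zero that(3)] in \<open>auto simp: abs_mult mult_left_mono\<close>)
  have i1: "integrable lborel (\<lambda>z. gauss z *\<^sub>R f' z)" and i2: "integrable lborel (\<lambda>z. (z * gauss z) *\<^sub>R f z)"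
    by (rule i; use integrable_gauss integrable_gauss_ident bd in simp)+
  have "(\<integral>z. gauss z *\<^sub>R f' z - (z * gauss z) *\<^sub>R f z \<partial>lborel) = 0"
  proof (rule integral_derivative_eq_0)
    show "((\<lambda>z. gauss z *\<^sub>R f z) has_vector_derivative gauss z *\<^sub>R f' z - (z * gauss z) *\<^sub>R f z) (at z)" for z
      using has_vector_derivative_scaleR[OF gauss_deriv der, of z] by simp
    show "continuous_on UNIV (\<lambda>z. gauss z *\<^sub>R f' z - (z * gauss z) *\<^sub>R f z)"
      unfolding std_normal_density_def[abs_def] by (intro continuous_intros cf cont) auto
    show "integrable lborel (\<lambda>z. gauss z *\<^sub>R f' z - (z * gauss z) *\<^sub>R f z)" using i1 i2 by simp
    have "norm (gauss z *\<^sub>R f z) \<le> gauss z * B" for z using bd(1)[of z] by (simp add: mult_left_mono)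
    then show "((\<lambda>z. gauss z *\<^sub>R f z) \<longlongrightarrow> 0) at_top" "((\<lambda>z. gauss z *\<^sub>R f z) \<longlongrightarrow> 0) at_bot"
      using tendsto_mult_left_zero[OF gauss_tendsto(1), of B] tendsto_mult_left_zero[OF gauss_tendsto(2), of B]
      by (auto intro: Lim_null_comparison[where g = "\<lambda>z. gauss z * B"])
  qed
  then show ?thesis using i1 i2 by simp
qed

lemma integral_indicator_Icc_Ioo:
  fixes f :: "real \<Rightarrow> 'a::{banach, second_countable_topology}"
  shows "(\<integral>s. indicator {a..b} s *\<^sub>R f s \<partial>lborel) = (\<integral>s. indicator {a<..<b} s *\<^sub>R f s \<partial>lborel)"
proof -
  have *: "AE s in lborel. s \<noteq> a \<and> s \<noteq> b"
    using AE_lborel_singleton[of a] AE_lborel_singleton[of b] by eventually_elim simp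
  show ?thesis
  proof (cases "(\<lambda>s. indicator {a<..<b} s *\<^sub>R f s) \<in> borel_measurable borel")
    case True
    have "(\<lambda>s. indicator {a..b} s *\<^sub>R f s) = (\<lambda>s. indicator {a<..<b} s *\<^sub>R f s + (if s = a \<or> s = b then indicator {a..b} s *\<^sub>R f s else 0))"
      by (auto simp: fun_eq_iff split: split_indicator)
    moreover have "(\<lambda>s. if s = a \<or> s = b then indicator {a..b} s *\<^sub>R f s else 0) \<in> borel_measurable borel"
    proof -
      have "(\<lambda>s. if s = a \<or> s = b then indicator {a..b} s *\<^sub>R f s else 0)
        = (\<lambda>s. if s = a then indicator {a..b} a *\<^sub>R f a else if s = b then indicator {a..b} b *\<^sub>R f b else 0)"
        by auto
      then show ?thesis by simp
    qed
    ultimately have "(\<lambda>s. indicator {a..b} s *\<^sub>R f s) \<in> borel_measurable borel" using True by simp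
    moreover have "AE s in lborel. indicator {a..b} s *\<^sub>R f s = indicator {a<..<b} s *\<^sub>R f s"
      using * by (rule eventually_mono) (auto split: split_indicator)
    ultimately show ?thesis using True by (intro integral_cong_AE) auto
  next
    \<comment> \<open>A non-measurable integrand has Bochner integral 0 by convention. Measurability
      on the open and on the closed interval are equivalent, so both sides are 0.\<close>
    case False
    have "(\<lambda>s. indicator {a..b} s *\<^sub>R f s) \<notin> borel_measurable borel"
    proof
      assume "(\<lambda>s. indicator {a..b} s *\<^sub>R f s) \<in> borel_measurable borel"
      then have "(\<lambda>s. indicator {a<..<b} s *\<^sub>R (indicator {a..b} s *\<^sub>R f s)) \<in> borel_measurable borel"
        by (rule borel_measurable_scaleR[rotated]) simp
      moreover have "(\<lambda>s. indicator {a<..<b} s *\<^sub>R (indicator {a..b} s *\<^sub>R f s)) = (\<lambda>s. indicator {a<..<b} s *\<^sub>R f s)"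
        by (auto simp: fun_eq_iff split: split_indicator)
      ultimately show False using False by simp
    qed
    with False show ?thesis
      by (metis borel_measurable_integrable measurable_lborel2 not_integrable_integral_eq)
  qed
qed

lemma integral_inverse_sqrt:
  assumes "0 \<le> \<tau>"
  shows "integrable lborel (\<lambda>\<sigma>. indicator {0<..<\<tau>} \<sigma> / sqrt (2 * \<sigma>))"
    and "(\<integral>\<sigma>. indicator {0<..<\<tau>} \<sigma> / sqrt (2 * \<sigma>) \<partial>lborel) = sqrt (2 * \<tau>)"
proof -
  have "integrable lborel (\<lambda>\<sigma>. indicator {0<..<\<tau>} \<sigma> / sqrt (2 * \<sigma>)) \<and>
    (\<integral>\<sigma>. indicator {0<..<\<tau>} \<sigma> / sqrt (2 * \<sigma>) \<partial>lborel) = sqrt (2 * \<tau>)"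
  proof (cases "\<tau> = 0")
    case False
    with assms have \<tau>: "0 < \<tau>" by simp
    define F where "F = (\<lambda>\<sigma>::real. sqrt (2 * \<sigma>))"
    have cF: "continuous_on UNIV F" unfolding F_def by (intro continuous_intros)
    have der: "(F has_real_derivative 1 / sqrt (2 * \<sigma>)) (at \<sigma>)" if "ereal 0 < ereal \<sigma>" for \<sigma>
      unfolding F_def using that by (auto intro!: derivative_eq_intros simp: field_simps)
    have ic: "isCont (\<lambda>\<sigma>. 1 / sqrt (2 * \<sigma>)) \<sigma>" if "ereal 0 < ereal \<sigma>" for \<sigma>
      using that by (intro continuous_intros) auto
    have nn: "AE \<sigma> in lborel. ereal 0 < ereal \<sigma> \<longrightarrow> ereal \<sigma> < ereal \<tau> \<longrightarrow> 0 \<le> 1 / sqrt (2 * \<sigma>)"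
      by (intro AE_I2) auto
    have "(F \<longlongrightarrow> F 0) (at_right 0)" "(F \<longlongrightarrow> F \<tau>) (at_left \<tau>)"
      using cF by (auto simp: continuous_on_def intro: tendsto_within_subset)
    then have lim: "((F \<circ> real_of_ereal) \<longlongrightarrow> 0) (at_right (ereal 0))" "((F \<circ> real_of_ereal) \<longlongrightarrow> sqrt (2 * \<tau>)) (at_left (ereal \<tau>))"
      by (simp_all only: ereal_tendsto_simps) (simp_all add: F_def)
    have lt: "ereal 0 < ereal \<tau>" using \<tau> by simp
    have "set_integrable lborel (einterval (ereal 0) (ereal \<tau>)) (\<lambda>\<sigma>. 1 / sqrt (2 * \<sigma>))"
      "(LBINT \<sigma>=ereal 0..ereal \<tau>. 1 / sqrt (2 * \<sigma>)) = sqrt (2 * \<tau>) - 0"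
      using interval_integral_FTC_nonneg[OF lt der ic nn lim] by auto
    then show ?thesis
      using \<tau> by (simp add: set_integrable_def interval_lebesgue_integral_def set_lebesgue_integral_def einterval_eq)
  qed simp
  then show "integrable lborel (\<lambda>\<sigma>. indicator {0<..<\<tau>} \<sigma> / sqrt (2 * \<sigma>))"
    "(\<integral>\<sigma>. indicator {0<..<\<tau>} \<sigma> / sqrt (2 * \<sigma>) \<partial>lborel) = sqrt (2 * \<tau>)" by auto
qed

lemma integrable_scaled_bounded:
  fixes h :: "'a \<Rightarrow> complex" and w :: "'a \<Rightarrow> real"
  assumes w: "integrable M w" and h: "(\<lambda>x. w x *\<^sub>R h x) \<in> borel_measurable M"
    and bd: "\<And>x. w x \<noteq> 0 \<Longrightarrow> norm (h x) \<le> C"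
  shows "integrable M (\<lambda>x. w x *\<^sub>R h x)"
proof (rule Bochner_Integration.integrable_bound[of _ "\<lambda>x. \<bar>w x\<bar> * C"])
  show "integrable M (\<lambda>x. \<bar>w x\<bar> * C)" using w by simp
  have "norm (w x *\<^sub>R h x) \<le> \<bar>w x\<bar> * C" for x
    using bd[of x] by (cases "w x = 0") (auto simp: mult_left_mono)
  then show "AE x in M. norm (w x *\<^sub>R h x) \<le> norm (\<bar>w x\<bar> * C)"
    by (intro AE_I2) (metis abs_ge_self order_trans real_norm_def)
qed (rule h)

text \<open>The fundamental theorem of calculus along the path
  \<open>x + sqrt (2 * \<sigma>) * z\<close>, whose velocity \<open>z / sqrt (2 * \<sigma>)\<close>
  is singular but integrable at 0. This velocity is also the extra factor that \<open>stein\<close>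
  produces, so averaging over \<open>z\<close> connects increments in time with second derivatives
  in space.\<close>

lemma sqrt_path_integral:
  fixes h h' :: "real \<Rightarrow> complex"
  assumes der: "\<And>y. (h has_vector_derivative h' y) (at y)" and cont: "continuous_on UNIV h'"
    and bd: "\<And>y. norm (h' y) \<le> C" and \<tau>: "0 \<le> \<tau>"
  shows "(\<integral>\<sigma>. (indicator {0<..<\<tau>} \<sigma> / sqrt (2 * \<sigma>) * z) *\<^sub>R h' (x + sqrt (2 * \<sigma>) * z) \<partial>lborel)
    = h (x + sqrt (2 * \<tau>) * z) - h x"
proof (cases "\<tau> = 0")
  case False
  with \<tau> have \<tau>0: "0 < \<tau>" by simp
  define F where "F = (\<lambda>\<sigma>. h (x + sqrt (2 * \<sigma>) * z))"
  have ch: "continuous_on UNIV h"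
    using der by (auto intro!: continuous_at_imp_continuous_on has_vector_derivative_continuous)
  have cF: "continuous_on UNIV F" unfolding F_def
    by (rule continuous_on_compose2[OF ch]) (auto intro!: continuous_intros)
  have der': "(F has_vector_derivative (1 / sqrt (2 * \<sigma>) * z) *\<^sub>R h' (x + sqrt (2 * \<sigma>) * z)) (at \<sigma>)"
    if "ereal 0 < ereal \<sigma>" for \<sigma>
  proof -
    have "((\<lambda>\<sigma>. x + sqrt (2 * \<sigma>) * z) has_vector_derivative 1 / sqrt (2 * \<sigma>) * z) (at \<sigma>)"
      using that unfolding has_real_derivative_iff_has_vector_derivative[symmetric]
      by (auto intro!: derivative_eq_intros simp: field_simps)
    from vector_diff_chain_at[OF this der] show ?thesis by (simp add: F_def comp_def)
  qed
  have ch': "continuous_on UNIV (\<lambda>\<sigma>. h' (x + sqrt (2 * \<sigma>) * z))"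
    by (rule continuous_on_compose2[OF cont]) (auto intro!: continuous_intros)
  have ic: "isCont (\<lambda>\<sigma>. (1 / sqrt (2 * \<sigma>) * z) *\<^sub>R h' (x + sqrt (2 * \<sigma>) * z)) \<sigma>" if "ereal 0 < ereal \<sigma>" for \<sigma>
    using that ch' by (intro continuous_intros) (auto simp: continuous_on_eq_continuous_at)
  have "(F \<longlongrightarrow> F 0) (at_right 0)" "(F \<longlongrightarrow> F \<tau>) (at_left \<tau>)"
    using cF by (auto simp: continuous_on_def intro: tendsto_within_subset)
  then have lim: "((F \<circ> real_of_ereal) \<longlongrightarrow> F 0) (at_right (ereal 0))" "((F \<circ> real_of_ereal) \<longlongrightarrow> F \<tau>) (at_left (ereal \<tau>))"
    by (simp_all only: ereal_tendsto_simps)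
  have lt: "ereal 0 < ereal \<tau>" using \<tau>0 by simp
  have i: "integrable lborel (\<lambda>\<sigma>. (indicator {0<..<\<tau>} \<sigma> / sqrt (2 * \<sigma>) * z) *\<^sub>R h' (x + sqrt (2 * \<sigma>) * z))"
  proof (rule integrable_scaled_bounded[OF _ _ bd])
    show "integrable lborel (\<lambda>\<sigma>. indicator {0<..<\<tau>} \<sigma> / sqrt (2 * \<sigma>) * z)"
      using integral_inverse_sqrt(1)[OF \<tau>] by (rule integrable_mult_left)
    have "(\<lambda>\<sigma>. h' (x + sqrt (2 * \<sigma>) * z)) \<in> borel_measurable borel" by (rule borel_measurable_continuous_onI[OF ch'])
    then show "(\<lambda>\<sigma>. (indicator {0<..<\<tau>} \<sigma> / sqrt (2 * \<sigma>) * z) *\<^sub>R h' (x + sqrt (2 * \<sigma>) * z)) \<in> borel_measurable lborel" by simp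
  qed
  have eq: "(\<lambda>\<sigma>. indicator {0<..<\<tau>} \<sigma> *\<^sub>R ((1 / sqrt (2 * \<sigma>) * z) *\<^sub>R h' (x + sqrt (2 * \<sigma>) * z)))
    = (\<lambda>\<sigma>. (indicator {0<..<\<tau>} \<sigma> / sqrt (2 * \<sigma>) * z) *\<^sub>R h' (x + sqrt (2 * \<sigma>) * z))"
    by (auto simp: fun_eq_iff split: split_indicator)
  have "(LBINT \<sigma>=ereal 0..ereal \<tau>. (1 / sqrt (2 * \<sigma>) * z) *\<^sub>R h' (x + sqrt (2 * \<sigma>) * z)) = F \<tau> - F 0"
    by (rule interval_integral_FTC_integrable[OF lt der' ic _ lim])
       (use i in \<open>auto simp: set_integrable_def einterval_eq eq\<close>)
  then show ?thesis using \<tau>0 eq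
    by (simp add: interval_lebesgue_integral_def set_lebesgue_integral_def einterval_eq F_def)
qed simp

section \<open>The heat semigroup, Duhamel integrals and their function space\<close>

text \<open>The expectation of \<open>f\<close> at \<open>x\<close> plus a Gaussian of variance
  \<open>2 * t\<close>. With the time moved from the kernel into the argument, time 0 is not
  singular and the integral has the form required by
  \<open>uniformly_continuous_on_param_integral\<close>.\<close>

definition heat :: "(real \<Rightarrow> complex) \<Rightarrow> real \<Rightarrow> real \<Rightarrow> complex" where
  "heat f t x = (\<integral>z. gauss z *\<^sub>R f (x + sqrt t * (sqrt 2 * z)) \<partial>lborel)"

definition wt0 :: "real \<times> real \<Rightarrow> real" where
  "wt0 \<omega> = indicator {0<..<1} (fst \<omega>) * gauss (snd \<omega>)"

definition wt1 :: "real \<times> real \<Rightarrow> real" where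
  "wt1 \<omega> = indicator {0<..<1} (fst \<omega>) / sqrt (2 * fst \<omega>) * (snd \<omega> * gauss (snd \<omega>))"

definition parabolic_avg :: "(real \<times> real \<Rightarrow> real) \<Rightarrow> (real \<Rightarrow> real \<Rightarrow> complex) \<Rightarrow> real \<Rightarrow> real \<Rightarrow> complex" where
  "parabolic_avg w g t x = (\<integral>\<omega>. w \<omega> *\<^sub>R g (t * (1 - fst \<omega>)) (x + sqrt t * (sqrt (2 * fst \<omega>) * snd \<omega>)) \<partial>lborel)"

lemma parabolic_avg_cong:
  assumes w01: "\<And>\<omega>. w \<omega> \<noteq> 0 \<Longrightarrow> 0 < fst \<omega> \<and> fst \<omega> < 1"
    and "0 \<le> t" "\<And>s x. s \<in> {0..t} \<Longrightarrow> g s x = h s x"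
  shows "parabolic_avg w g t x = parabolic_avg w h t x"
proof -
  have "(\<lambda>\<omega>. w \<omega> *\<^sub>R g (t * (1 - fst \<omega>)) (y \<omega>)) = (\<lambda>\<omega>. w \<omega> *\<^sub>R h (t * (1 - fst \<omega>)) (y \<omega>))" for y
  proof (rule ext)
    fix \<omega> show "w \<omega> *\<^sub>R g (t * (1 - fst \<omega>)) (y \<omega>) = w \<omega> *\<^sub>R h (t * (1 - fst \<omega>)) (y \<omega>)"
    proof (cases "w \<omega> = 0")
      case False
      then have "t * (1 - fst \<omega>) \<in> {0..t}" using w01[OF False] assms(2) by (auto intro: mult_left_le)
      then show ?thesis by (simp add: assms(3))
    qed simp
  qed
  then show ?thesis unfolding parabolic_avg_def by (rule arg_cong[where f = "integral\<^sup>L lborel"])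
qed

text \<open>
  \<open>duhamel g t\<close> is the Duhamel integral \<open>\<integral> heat (g s) (t - s) ds\<close> over \<open>0 < s < t\<close> after the substitution
  \<open>s = t (1 - r)\<close>, written as one integral over pairs \<open>(r, z)\<close> whose weight does not depend on \<open>t\<close>.
  In \<open>duhamel_x\<close>, its space derivative, a Gaussian integration by parts has moved the derivative from \<open>g\<close>
  to the kernel, at the price of the integrable singularity in \<open>wt1\<close>.
\<close>

definition duhamel :: "(real \<Rightarrow> real \<Rightarrow> complex) \<Rightarrow> real \<Rightarrow> real \<Rightarrow> complex" where
  "duhamel g t x = t *\<^sub>R (\<integral>\<omega>. wt0 \<omega> *\<^sub>R g (t * (1 - fst \<omega>)) (x + sqrt t * (sqrt (2 * fst \<omega>) * snd \<omega>)) \<partial>lborel)"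

definition duhamel_x :: "(real \<Rightarrow> real \<Rightarrow> complex) \<Rightarrow> real \<Rightarrow> real \<Rightarrow> complex" where
  "duhamel_x g t x = sqrt t *\<^sub>R (\<integral>\<omega>. wt1 \<omega> *\<^sub>R g (t * (1 - fst \<omega>)) (x + sqrt t * (sqrt (2 * fst \<omega>) * snd \<omega>)) \<partial>lborel)"

lemma integrable_wt0: "integrable lborel wt0"
proof -
  have "integrable lborel (indicator {0<..<1::real} :: real \<Rightarrow> real)" by simp
  from integrable_times_lborel[OF this integrable_gauss] show ?thesis by (simp add: wt0_def[abs_def])
qed

lemma integrable_wt1: "integrable lborel wt1"
  using integrable_times_lborel[OF integral_inverse_sqrt(1)[of 1] integrable_gauss_ident] by (simp add: wt1_def[abs_def])

lemma wt_nonzero: "wt0 \<omega> \<noteq> 0 \<Longrightarrow> 0 < fst \<omega> \<and> fst \<omega> < 1" "wt1 \<omega> \<noteq> 0 \<Longrightarrow> 0 < fst \<omega> \<and> fst \<omega> < 1"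
  by (auto simp: wt0_def wt1_def split: split_indicator_asm)

lemma duhamel_eq_parabolic_avg: "duhamel g t x = t *\<^sub>R parabolic_avg wt0 g t x" "duhamel_x g t x = sqrt t *\<^sub>R parabolic_avg wt1 g t x"
  by (simp_all add: duhamel_def duhamel_x_def parabolic_avg_def)

lemma duhamel_cong:
  assumes "0 \<le> t" "\<And>s x. s \<in> {0..t} \<Longrightarrow> g s x = h s x"
  shows "duhamel g t x = duhamel h t x" "duhamel_x g t x = duhamel_x h t x"
  using parabolic_avg_cong[OF wt_nonzero(1) assms] parabolic_avg_cong[OF wt_nonzero(2) assms] by (simp_all add: duhamel_eq_parabolic_avg)

text \<open>\<open>BUC\<close> is membership in \<open>C([0, \<infinity>), C_ub)\<close>; values at negative times are arbitrary.\<close>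

definition BUC :: "(real \<Rightarrow> real \<Rightarrow> complex) \<Rightarrow> bool" where
  "BUC g \<longleftrightarrow> (\<forall>T. uniformly_continuous_on ({0..T} \<times> UNIV) (case_prod g) \<and> bounded (case_prod g ` ({0..T} \<times> UNIV)))"

text \<open>Measurability of the integrands calls for a function continuous on all of the plane,
  while \<open>BUC\<close> says nothing about negative times. Freezing the function at time 0
  provides one without changing any Duhamel integral at nonnegative times.\<close>

definition extend0 :: "(real \<Rightarrow> real \<Rightarrow> complex) \<Rightarrow> real \<Rightarrow> real \<Rightarrow> complex" where
  "extend0 g t = g (max 0 t)"

lemma extend0_eq: "0 \<le> t \<Longrightarrow> extend0 g t = g t"
  by (simp add: extend0_def)

lemma BUCD: "BUC g \<Longrightarrow> uniformly_continuous_on ({0..T} \<times> UNIV) (case_prod g)"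
  by (simp add: BUC_def)

lemma BUC_bound:
  assumes "BUC g"
  obtains C where "0 \<le> C" "\<And>t x. t \<in> {0..T} \<Longrightarrow> norm (g t x) \<le> C"
proof -
  have "bounded (case_prod g ` ({0..T} \<times> UNIV))" using assms by (simp add: BUC_def)
  then obtain C where C: "\<forall>y\<in>case_prod g ` ({0..T} \<times> UNIV). norm y \<le> C" unfolding bounded_iff by blast
  have "norm (g t x) \<le> \<bar>C\<bar>" if "t \<in> {0..T}" for t x
  proof -
    have "case_prod g (t, x) \<in> case_prod g ` ({0..T} \<times> UNIV)" using that by (intro imageI) simp
    with C have "norm (case_prod g (t, x)) \<le> C" by blast
    then show ?thesis by simp
  qed
  then show ?thesis using that[of "\<bar>C\<bar>"] by simp
qed

lemma BUCI:
  assumes "\<And>T. 0 \<le> T \<Longrightarrow> uniformly_continuous_on ({0..T} \<times> UNIV) (case_prod g)"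
    and "\<And>T. 0 \<le> T \<Longrightarrow> \<exists>C. \<forall>t\<in>{0..T}. \<forall>x. norm (g t x) \<le> C"
  shows "BUC g"
  unfolding BUC_def
proof (intro allI conjI)
  fix T :: real
  show "uniformly_continuous_on ({0..T} \<times> UNIV) (case_prod g)"
    using assms(1) by (cases "0 \<le> T") (auto simp: uniformly_continuous_on_def)
  show "bounded (case_prod g ` ({0..T} \<times> UNIV))"
    using assms(2) by (cases "0 \<le> T") (fastforce simp: bounded_iff)+
qed

lemma BUC_cong: "BUC g \<Longrightarrow> (\<And>t x. 0 \<le> t \<Longrightarrow> h t x = g t x) \<Longrightarrow> BUC h"
  unfolding BUC_def uniformly_continuous_on_def bounded_iff by fastforce

lemma BUC_extend0: "BUC g \<Longrightarrow> BUC (extend0 g)"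
  by (erule BUC_cong) (simp add: extend0_eq)

lemma continuous_on_extend0:
  assumes g: "BUC g"
  shows "continuous_on UNIV (case_prod (extend0 g))"
proof -
  have c: "continuous_on ({0..T} \<times> UNIV) (case_prod g)" for T
    by (rule uniformly_continuous_imp_continuous[OF BUCD[OF g]])
  have "continuous_on ({..<T} \<times> UNIV) (case_prod (extend0 g))" for T :: real
  proof -
    have "continuous_on ({..<T} \<times> UNIV) (\<lambda>p. case_prod g (max 0 (fst p), snd p))"
      by (rule continuous_on_compose2[OF c[of "max 0 T"]]) (auto intro!: continuous_intros)
    then show ?thesis by (simp add: extend0_def case_prod_beta)
  qed
  then have "continuous_on (\<Union>T::real. {..<T} \<times> UNIV) (case_prod (extend0 g))"
    by (intro continuous_on_open_UN) (auto simp: open_Times)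
  moreover have "(\<Union>T::real. {..<T} \<times> (UNIV :: real set)) = UNIV" using gt_ex by auto
  ultimately show ?thesis by simp
qed

lemma BUC_slice:
  assumes "BUC g" "0 \<le> t"
  shows "uniformly_continuous_on UNIV (g t)" "continuous_on UNIV (g t)" "bounded (range (g t))"
proof -
  show 1: "uniformly_continuous_on UNIV (g t)"
    unfolding uniformly_continuous_on_def
  proof (intro allI impI)
    fix e :: real assume "0 < e"
    then obtain d where "0 < d" and d: "\<And>p p'. p \<in> {0..t} \<times> UNIV \<Longrightarrow> p' \<in> {0..t} \<times> UNIV \<Longrightarrow> dist p' p < d \<Longrightarrow> dist (case_prod g p') (case_prod g p) < e"
      using BUCD[OF assms(1), of t] unfolding uniformly_continuous_on_def by metis
    then show "\<exists>d>0. \<forall>x\<in>UNIV. \<forall>x'\<in>UNIV. dist x' x < d \<longrightarrow> dist (g t x') (g t x) < e"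
      using assms(2) d[of "(t, _)" "(t, _)"] by (auto simp: dist_Pair_Pair intro!: exI[of _ d])
  qed
  then show "continuous_on UNIV (g t)" by (rule uniformly_continuous_imp_continuous)
  obtain C where "\<And>s x. s \<in> {0..t} \<Longrightarrow> norm (g s x) \<le> C" using BUC_bound[OF assms(1)] by metis
  then show "bounded (range (g t))" using assms(2) by (auto simp: bounded_iff)
qed

lemma uniformly_continuous_on_scaleR_bounded:
  fixes f :: "'a::metric_space \<Rightarrow> real" and g :: "'a \<Rightarrow> 'b::real_normed_vector"
  assumes f: "uniformly_continuous_on S f" and g: "uniformly_continuous_on S g"
    and bf: "\<And>x. x \<in> S \<Longrightarrow> \<bar>f x\<bar> \<le> B" and bg: "\<And>x. x \<in> S \<Longrightarrow> norm (g x) \<le> C"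
  shows "uniformly_continuous_on S (\<lambda>x. f x *\<^sub>R g x)"
  unfolding uniformly_continuous_on_sequentially
proof (intro allI impI, elim conjE)
  fix X Y assume X: "\<forall>n. X n \<in> S" and Y: "\<forall>n. Y n \<in> S" and XY: "(\<lambda>n. dist (X n) (Y n)) \<longlonglongrightarrow> 0"
  have "(\<lambda>n. dist (f (X n)) (f (Y n))) \<longlonglongrightarrow> 0" "(\<lambda>n. dist (g (X n)) (g (Y n))) \<longlonglongrightarrow> 0"
    using f g X Y XY unfolding uniformly_continuous_on_sequentially by blast+
  then have lim: "(\<lambda>n. dist (f (X n)) (f (Y n)) * C + B * dist (g (X n)) (g (Y n))) \<longlonglongrightarrow> 0"
    by (auto intro!: tendsto_add_zero tendsto_mult_left_zero tendsto_mult_right_zero)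
  show "(\<lambda>n. dist (f (X n) *\<^sub>R g (X n)) (f (Y n) *\<^sub>R g (Y n))) \<longlonglongrightarrow> 0"
  proof (rule Lim_null_comparison[OF always_eventually lim], intro allI)
    fix n
    have "f (X n) *\<^sub>R g (X n) - f (Y n) *\<^sub>R g (Y n) = (f (X n) - f (Y n)) *\<^sub>R g (X n) + f (Y n) *\<^sub>R (g (X n) - g (Y n))"
      by (simp add: algebra_simps)
    then have "norm (f (X n) *\<^sub>R g (X n) - f (Y n) *\<^sub>R g (Y n)) \<le> \<bar>f (X n) - f (Y n)\<bar> * norm (g (X n)) + \<bar>f (Y n)\<bar> * norm (g (X n) - g (Y n))"
      using norm_triangle_ineq[of "(f (X n) - f (Y n)) *\<^sub>R g (X n)" "f (Y n) *\<^sub>R (g (X n) - g (Y n))"] by simp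
    also have "\<dots> \<le> \<bar>f (X n) - f (Y n)\<bar> * C + B * norm (g (X n) - g (Y n))"
      using bg X bf Y by (intro add_mono mult_left_mono mult_right_mono) auto
    finally show "norm (dist (f (X n) *\<^sub>R g (X n)) (f (Y n) *\<^sub>R g (Y n))) \<le> dist (f (X n)) (f (Y n)) * C + B * dist (g (X n)) (g (Y n))"
      by (simp add: dist_norm)
  qed
qed

lemma borel_measurable_case_prod_comp:
  fixes g :: "real \<Rightarrow> real \<Rightarrow> complex" and a b :: "'b::euclidean_space \<Rightarrow> real"
  assumes "continuous_on UNIV (case_prod g)" "a \<in> borel_measurable borel" "b \<in> borel_measurable borel"
  shows "(\<lambda>\<omega>. g (a \<omega>) (b \<omega>)) \<in> borel_measurable borel"
proof -
  note [measurable] = assms(2,3)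
  have [measurable]: "case_prod g \<in> borel_measurable (borel \<Otimes>\<^sub>M borel)"
    using borel_measurable_continuous_onI[OF assms(1)] by (simp add: borel_prod)
  have "(\<lambda>\<omega>. case_prod g (a \<omega>, b \<omega>)) \<in> borel_measurable borel" by measurable
  then show ?thesis by simp
qed

lemma integrable_parabolic_avg:
  assumes w: "integrable lborel w" and w01: "\<And>\<omega>. w \<omega> \<noteq> 0 \<Longrightarrow> 0 < fst \<omega> \<and> fst \<omega> < 1"
    and g: "BUC g" and t: "0 \<le> t" and y: "y \<in> borel_measurable borel"
  shows "integrable lborel (\<lambda>\<omega>. w \<omega> *\<^sub>R extend0 g (t * (1 - fst \<omega>)) (y \<omega>))"
proof -
  obtain C where C: "\<And>s x. s \<in> {0..t} \<Longrightarrow> norm (g s x) \<le> C" using BUC_bound[OF g] by metis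
  show ?thesis
  proof (rule integrable_scaled_bounded[OF w, where C = C])
    have [measurable]: "w \<in> borel_measurable borel" using w by auto
    have [measurable]: "(\<lambda>\<omega>. extend0 g (t * (1 - fst \<omega>)) (y \<omega>)) \<in> borel_measurable borel"
      by (rule borel_measurable_case_prod_comp[OF continuous_on_extend0[OF g] _ y]) (intro borel_measurable_continuous_onI continuous_intros)
    show "(\<lambda>\<omega>. w \<omega> *\<^sub>R extend0 g (t * (1 - fst \<omega>)) (y \<omega>)) \<in> borel_measurable lborel" by simp
    show "norm (extend0 g (t * (1 - fst \<omega>)) (y \<omega>)) \<le> C" if "w \<omega> \<noteq> 0" for \<omega>
      using w01[OF that] t C[of "t * (1 - fst \<omega>)"] by (simp add: extend0_eq mult_left_le)
  qed
qed

text \<open>Wherever the weight is nonzero, the time argument \<open>t * (1 - fst \<omega>)\<close>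
  lies between 0 and \<open>t\<close>, so bounds on the slab up to time \<open>T\<close> are enough.
  Treating a general weight settles \<open>duhamel\<close> and \<open>duhamel_x\<close>
  together.\<close>

lemma BUC_parabolic_avg:
  assumes w: "integrable lborel w" and w01: "\<And>\<omega>. w \<omega> \<noteq> 0 \<Longrightarrow> 0 < fst \<omega> \<and> fst \<omega> < 1"
    and g: "BUC g"
  shows "BUC (parabolic_avg w g)"
proof -
  define h where "h = extend0 g"
  have ch: "continuous_on UNIV (case_prod h)" and bh: "BUC h"
    unfolding h_def using continuous_on_extend0[OF g] BUC_extend0[OF g] by auto
  have "BUC (parabolic_avg w h)"
  proof (rule BUCI)
    fix T :: real assume T: "0 \<le> T"
    obtain C where C: "0 \<le> C" "\<And>t x. t \<in> {0..T} \<Longrightarrow> norm (h t x) \<le> C" using BUC_bound[OF bh] by metis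
    have "uniformly_continuous_on ({0..T} \<times> UNIV)
      (\<lambda>(t,x). \<integral>\<omega>. w \<omega> *\<^sub>R h (t * (1 - fst \<omega>)) (x + sqrt t * (sqrt (2 * fst \<omega>) * snd \<omega>)) \<partial>lborel)"
      by (rule uniformly_continuous_on_param_integral[OF w _ _ _ ch BUCD[OF bh] C(2)])
        (use w01 in \<open>auto simp: less_imp_le intro!: borel_measurable_continuous_onI continuous_intros\<close>)
    then show "uniformly_continuous_on ({0..T} \<times> UNIV) (case_prod (parabolic_avg w h))"
      unfolding parabolic_avg_def .
    show "\<exists>C. \<forall>t\<in>{0..T}. \<forall>x. norm (parabolic_avg w h t x) \<le> C"
    proof (intro exI ballI allI)
      fix t x assume t: "t \<in> {0..T}"
      have "norm (parabolic_avg w h t x) \<le> (\<integral>\<omega>. norm (w \<omega> *\<^sub>R h (t * (1 - fst \<omega>)) (x + sqrt t * (sqrt (2 * fst \<omega>) * snd \<omega>))) \<partial>lborel)"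
        unfolding parabolic_avg_def by (rule integral_norm_bound)
      also have "\<dots> \<le> (\<integral>\<omega>. C * \<bar>w \<omega>\<bar> \<partial>lborel)"
      proof (rule integral_mono')
        show "integrable lborel (\<lambda>\<omega>. C * \<bar>w \<omega>\<bar>)" using w by simp
        fix \<omega>
        show "norm (w \<omega> *\<^sub>R h (t * (1 - fst \<omega>)) (x + sqrt t * (sqrt (2 * fst \<omega>) * snd \<omega>))) \<le> C * \<bar>w \<omega>\<bar>"
        proof (cases "w \<omega> = 0")
          case False
          have "t * (1 - fst \<omega>) \<in> {0..T}" using t w01[OF False] by (auto intro: order_trans[OF mult_left_le])
          from C(2)[OF this, of "x + sqrt t * (sqrt (2 * fst \<omega>) * snd \<omega>)"] show ?thesis
            by (metis abs_ge_zero mult.commute mult_left_mono norm_scaleR)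
        qed simp
        show "0 \<le> C * \<bar>w \<omega>\<bar>" using C by simp
      qed
      finally show "norm (parabolic_avg w h t x) \<le> (\<integral>\<omega>. C * \<bar>w \<omega>\<bar> \<partial>lborel)" .
    qed
  qed
  then show ?thesis
    by (rule BUC_cong) (rule parabolic_avg_cong[OF w01], auto simp: h_def extend0_eq)
qed

lemma BUC_scale:
  assumes g: "BUC g" and s: "\<And>T. uniformly_continuous_on {0..T} s"
  shows "BUC (\<lambda>t x. s t *\<^sub>R g t x)"
proof (rule BUCI)
  fix T :: real assume T: "0 \<le> T"
  have "compact (s ` {0..T})" by (intro compact_continuous_image uniformly_continuous_imp_continuous[OF s] compact_Icc)
  then obtain B where B: "\<And>t. t \<in> {0..T} \<Longrightarrow> \<bar>s t\<bar> \<le> B"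
    by (fastforce dest!: compact_imp_bounded simp: bounded_iff)
  obtain C where C: "0 \<le> C" "\<And>t x. t \<in> {0..T} \<Longrightarrow> norm (g t x) \<le> C" using BUC_bound[OF g] by metis
  have "uniformly_continuous_on ({0..T} \<times> (UNIV :: real set)) (\<lambda>p. s (fst p))"
    using s[of T] unfolding uniformly_continuous_on_def
    by (metis dist_fst_le le_less_trans mem_Times_iff)
  from uniformly_continuous_on_scaleR_bounded[OF this BUCD[OF g, of T], of B C]
  show "uniformly_continuous_on ({0..T} \<times> UNIV) (\<lambda>(t, x). s t *\<^sub>R g t x)"
    using B C unfolding case_prod_beta by (auto simp: mem_Times_iff)
  have "norm (s t *\<^sub>R g t x) \<le> B * C" if "t \<in> {0..T}" for t x
  proof -
    have "\<bar>s t\<bar> * norm (g t x) \<le> B * C" using B[OF that] C(2)[OF that, of x] by (intro mult_mono) auto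
    then show ?thesis by simp
  qed
  then show "\<exists>C. \<forall>t\<in>{0..T}. \<forall>x. norm (s t *\<^sub>R g t x) \<le> C" by blast
qed

lemma BUC_duhamel: "BUC g \<Longrightarrow> BUC (duhamel g)" and BUC_duhamel_x: "BUC g \<Longrightarrow> BUC (duhamel_x g)"
proof -
  assume g: "BUC g"
  show "BUC (duhamel g)"
    using BUC_scale[OF BUC_parabolic_avg[OF integrable_wt0 wt_nonzero(1) g], of "\<lambda>t. t"]
    by (simp add: duhamel_eq_parabolic_avg[abs_def] uniformly_continuous_on_id)
  have "uniformly_continuous_on {0..T} sqrt" for T :: real
    by (intro compact_uniformly_continuous continuous_intros compact_Icc)
  then show "BUC (duhamel_x g)"
    using BUC_scale[OF BUC_parabolic_avg[OF integrable_wt1 wt_nonzero(2) g], of sqrt]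
    by (simp add: duhamel_eq_parabolic_avg[abs_def])
qed

lemma BUC_const: "uniformly_continuous_on UNIV f \<Longrightarrow> bounded (range f) \<Longrightarrow> BUC (\<lambda>t. f)"
proof (rule BUCI)
  fix T :: real assume f: "uniformly_continuous_on UNIV f" "bounded (range f)"
  show "uniformly_continuous_on ({0..T} \<times> UNIV) (\<lambda>(t, x). f x)"
    using f(1) unfolding uniformly_continuous_on_def case_prod_beta
    by (metis UNIV_I dist_snd_le le_less_trans)
  show "\<exists>C. \<forall>t\<in>{0..T}. \<forall>x. norm (f x) \<le> C" using f(2) by (auto simp: bounded_iff)
qed

lemma heat_bound:
  assumes "\<And>x. norm (f x) \<le> C"
  shows "norm (heat f t x) \<le> C"
proof -
  have "norm (heat f t x) \<le> (\<integral>z. norm (gauss z *\<^sub>R f (x + sqrt t * (sqrt 2 * z))) \<partial>lborel)"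
    unfolding heat_def by (rule integral_norm_bound)
  also have "\<dots> \<le> (\<integral>z. gauss z * C \<partial>lborel)"
    by (rule integral_mono') (use assms order_trans[OF norm_ge_zero assms] integrable_gauss in \<open>auto simp: mult_left_mono\<close>)
  finally show ?thesis by (simp add: integral_gauss)
qed

lemma BUC_heat:
  assumes f: "uniformly_continuous_on UNIV f" "bounded (range f)"
  shows "BUC (heat f)"
proof (rule BUCI)
  fix T :: real assume "0 \<le> T"
  note b = BUC_const[OF f]
  obtain C where C: "0 \<le> C" "\<And>x. norm (f x) \<le> C" using f(2) unfolding bounded_iff by (metis norm_ge_zero order_trans rangeI)
  have cf: "continuous_on UNIV f" by (rule uniformly_continuous_imp_continuous[OF f(1)])
  have "uniformly_continuous_on ({0..T} \<times> UNIV) (\<lambda>(t,x). \<integral>z. gauss z *\<^sub>R (\<lambda>t. f) (t * 1) (x + sqrt t * (sqrt 2 * z)) \<partial>lborel)"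
    by (rule uniformly_continuous_on_param_integral[OF integrable_gauss _ _ _ _ BUCD[OF b], where C = C and a = "\<lambda>_. 1" and b = "\<lambda>z. sqrt 2 * z"])
      (use C in \<open>auto simp: case_prod_beta intro!: continuous_on_compose2[OF cf] continuous_intros\<close>)
  then show "uniformly_continuous_on ({0..T} \<times> UNIV) (case_prod (heat f))" unfolding heat_def .
  have "norm (heat f t x) \<le> C" for t x by (rule heat_bound[OF C(2)])
  then show "\<exists>C. \<forall>t\<in>{0..T}. \<forall>x. norm (heat f t x) \<le> C" by blast
qed

lemma integrable_indicator_Icc: "integrable lborel (indicator {l..b::real} :: real \<Rightarrow> real)"
  by (rule integrable_real_indicator) (auto simp: emeasure_lborel_Icc_eq)

section \<open>Space and time derivatives of heat flows and Duhamel integrals\<close>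

text \<open>Integrating the merely continuous \<open>h\<close> over a window in \<open>y\<close>
  gives a differentiable function of \<open>z\<close>, because a shift by \<open>c * z\<close> only
  moves the ends of the window. This makes \<open>stein\<close> applicable to a source without
  derivatives.\<close>

lemma window_integral:
  fixes h :: "real \<Rightarrow> complex" and b c l :: real
  assumes h: "continuous_on UNIV h" and bd: "\<And>y. norm (h y) \<le> C" and lb: "l \<le> b"
  defines "f \<equiv> \<lambda>z. \<integral>y. indicator {l..b} y *\<^sub>R h (y + c * z) \<partial>lborel"
  shows "(f has_vector_derivative c *\<^sub>R (h (b + c * z) - h (l + c * z))) (at z)"
    and "norm (f z) \<le> C * (b - l)"
proof -
  obtain H where H: "\<And>y. (H has_vector_derivative h y) (at y)"
    using einterval_antiderivative[of "-\<infinity>" \<infinity> h] h by (auto simp: continuous_on_eq_continuous_at)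
  have f: "f z = H (b + c * z) - H (l + c * z)" for z
    unfolding f_def
  proof (rule integral_FTC_atLeastAtMost[OF lb])
    have "((\<lambda>y. y + c * z) has_vector_derivative 1) (at y)" for y
      unfolding has_real_derivative_iff_has_vector_derivative[symmetric] by (auto intro!: derivative_eq_intros)
    from vector_diff_chain_at[OF this H]
    have "((\<lambda>y. H (y + c * z)) has_vector_derivative h (y + c * z)) (at y)" for y by (simp add: comp_def)
    then show "((\<lambda>y. H (y + c * z)) has_vector_derivative h (y + c * z)) (at y within {l..b})" for y
      by (rule has_vector_derivative_at_within)
    show "continuous_on {l..b} (\<lambda>y. h (y + c * z))"
      by (rule continuous_on_compose2[OF h]) (auto intro!: continuous_intros)
  qed
  have "((\<lambda>z. x + c * z) has_vector_derivative c) (at z)" for x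
    unfolding has_real_derivative_iff_has_vector_derivative[symmetric] by (auto intro!: derivative_eq_intros)
  from vector_diff_chain_at[OF this H]
  have "((\<lambda>z. H (x + c * z)) has_vector_derivative c *\<^sub>R h (x + c * z)) (at z)" for x by (simp add: comp_def)
  from has_vector_derivative_diff[OF this[of b] this[of l]]
  show "(f has_vector_derivative c *\<^sub>R (h (b + c * z) - h (l + c * z))) (at z)"
    by (simp add: f[abs_def] scaleR_diff_right)
  have "norm (f z) \<le> (\<integral>y. norm (indicator {l..b} y *\<^sub>R h (y + c * z)) \<partial>lborel)"
    unfolding f_def by (rule integral_norm_bound)
  also have "\<dots> \<le> (\<integral>y. indicator {l..b} y * C \<partial>lborel)"
    by (rule integral_mono') (use integrable_indicator_Icc[of l b] bd order_trans[OF norm_ge_zero bd] in \<open>auto split: split_indicator\<close>)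
  also have "\<dots> = C * (b - l)" using lb by simp
  finally show "norm (f z) \<le> C * (b - l)" .
qed

text \<open>With \<open>g\<close> only continuous, differentiation under the integral is impossible.
  Instead the candidate \<open>duhamel_x\<close> is integrated in space over a window starting at
  \<open>x - 1\<close>, the integrals are exchanged, and \<open>stein\<close> is applied in
  \<open>z\<close> to the window integral of \<open>g\<close>. The values at the two ends of the
  window reassemble to an increment of \<open>duhamel\<close>.\<close>

lemma duhamel_has_space_derivative:
  assumes g: "BUC g" and t: "0 \<le> t"
  shows "(duhamel g t has_vector_derivative duhamel_x g t x) (at x)"
proof -
  define h where "h = extend0 g"
  have ch: "continuous_on UNIV (case_prod h)" and bh: "BUC h" and hh: "extend0 h = h"
    unfolding h_def using continuous_on_extend0[OF g] BUC_extend0[OF g] by (auto simp: extend0_def)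
  have eq: "duhamel g t = duhamel h t" "duhamel_x g t = duhamel_x h t"
    using duhamel_cong[OF t, of g h] by (auto simp: h_def extend0_eq fun_eq_iff)
  obtain C where C: "0 \<le> C" "\<And>s y. s \<in> {0..t} \<Longrightarrow> norm (h s y) \<le> C" using BUC_bound[OF bh] by metis
  have ch1: "continuous_on UNIV (h s)" for s
    using continuous_on_compose2[OF ch continuous_on_Pair[OF continuous_on_const continuous_on_id], of s] by simp
  have "(duhamel h t has_vector_derivative duhamel_x h t x) (at x within {x - 1..x + 1})"
  proof (rule has_vector_derivative_from_integral)
    show "continuous_on {x - 1..x + 1} (duhamel_x h t)"
      using BUC_slice(2)[OF BUC_duhamel_x[OF bh] t] by (rule continuous_on_subset) simp
    fix b assume b: "b \<in> {x - 1..x + 1}"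
    define l where "l = x - 1"
    have lb: "l \<le> b" using b by (simp add: l_def)
    define \<tau> where "\<tau> \<omega> = t * (1 - fst \<omega>)" for \<omega> :: "real \<times> real"
    define k where "k \<omega> = sqrt t * sqrt (2 * fst \<omega>)" for \<omega> :: "real \<times> real"
    have arg: "sqrt t * (sqrt (2 * fst \<omega>) * snd \<omega>) = k \<omega> * snd \<omega>" for \<omega> by (simp add: k_def)
    have \<tau>: "\<tau> \<omega> \<in> {0..t}" if "0 < fst \<omega> \<and> fst \<omega> < 1" for \<omega> using that t by (auto simp: \<tau>_def mult_left_le)
    have cont: "continuous_on UNIV (\<lambda>\<omega>. \<tau> \<omega>)" "continuous_on UNIV (\<lambda>\<omega>. k \<omega> * snd \<omega>)"
      unfolding \<tau>_def k_def by (intro continuous_intros)+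
    define F where "F y \<omega> = (indicator {l..b} y * wt1 \<omega>) *\<^sub>R h (\<tau> \<omega>) (y + k \<omega> * snd \<omega>)" for y \<omega>
    have Feq: "F y \<omega> = wt1 \<omega> *\<^sub>R (indicator {l..b} y *\<^sub>R h (\<tau> \<omega>) (y + k \<omega> * snd \<omega>))" for y \<omega>
      by (simp add: F_def mult.commute)
    have wm: "wt0 \<in> borel_measurable borel" "wt1 \<in> borel_measurable borel"
      using integrable_wt0 integrable_wt1 by auto
    have Fm: "(\<lambda>p. h (\<tau> (snd p)) (fst p + k (snd p) * snd (snd p))) \<in> borel_measurable borel"
    proof (rule borel_measurable_continuous_onI)
      have "continuous_on UNIV (\<lambda>p :: real \<times> real \<times> real. (\<tau> (snd p), fst p + k (snd p) * snd (snd p)))"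
        unfolding \<tau>_def k_def by (intro continuous_intros)
      from continuous_on_compose2[OF ch this] show "continuous_on UNIV (\<lambda>p. h (\<tau> (snd p)) (fst p + k (snd p) * snd (snd p)))"
        by simp
    qed
    have Fi: "integrable lborel (\<lambda>p. F (fst p) (snd p))"
      unfolding F_def
    proof (rule integrable_scaled_bounded[where C = C])
      show i: "integrable lborel (\<lambda>p. indicator {l..b} (fst p) * wt1 (snd p))"
        by (rule integrable_times_lborel[OF integrable_indicator_Icc integrable_wt1])
      show "(\<lambda>p. (indicator {l..b} (fst p) * wt1 (snd p)) *\<^sub>R h (\<tau> (snd p)) (fst p + k (snd p) * snd (snd p))) \<in> borel_measurable lborel"
        using borel_measurable_integrable[OF i] Fm by simp
      show "norm (h (\<tau> (snd p)) (fst p + k (snd p) * snd (snd p))) \<le> C" if "indicator {l..b} (fst p) * wt1 (snd p) \<noteq> 0" for p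
        using C(2)[OF \<tau>] wt_nonzero(2)[of "snd p"] that by simp
    qed
    have "(\<integral>y. indicator {l..b} y *\<^sub>R duhamel_x h t y \<partial>lborel) = sqrt t *\<^sub>R (\<integral>y. (\<integral>\<omega>. F y \<omega> \<partial>lborel) \<partial>lborel)"
    proof -
      have "indicator {l..b} y *\<^sub>R duhamel_x h t y = sqrt t *\<^sub>R (\<integral>\<omega>. F y \<omega> \<partial>lborel)" for y
        unfolding F_def duhamel_x_def arg \<tau>_def[symmetric] by (cases "y \<in> {l..b}") simp_all
      then show ?thesis by simp
    qed
    also have "(\<integral>y. (\<integral>\<omega>. F y \<omega> \<partial>lborel) \<partial>lborel) = (\<integral>\<omega>. (\<integral>y. F y \<omega> \<partial>lborel) \<partial>lborel)"
      using integral_lborel_pair[OF Fi] by simp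
    also have "\<dots> = (\<integral>\<omega>. wt1 \<omega> *\<^sub>R (\<integral>y. indicator {l..b} y *\<^sub>R h (\<tau> \<omega>) (y + k \<omega> * snd \<omega>) \<partial>lborel) \<partial>lborel)"
      unfolding Feq integral_scaleR_right ..
    also have "\<dots> = (\<integral>\<rho>. (\<integral>z. wt1 (\<rho>, z) *\<^sub>R (\<integral>y. indicator {l..b} y *\<^sub>R h (\<tau> (\<rho>, z)) (y + k (\<rho>, z) * z) \<partial>lborel) \<partial>lborel) \<partial>lborel)"
    proof -
      have "integrable (lborel \<Otimes>\<^sub>M lborel) (\<lambda>p. F (fst p) (snd p))" using Fi by (simp add: lborel_prod)
      then have "integrable (lborel \<Otimes>\<^sub>M lborel) (\<lambda>(\<omega>, y). F y \<omega>)"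
        using lborel_pair.integrable_product_swap[of "\<lambda>p. F (fst p) (snd p)"] by (simp add: case_prod_beta)
      from lborel_pair.integrable_fst[OF this]
      have "integrable lborel (\<lambda>\<omega>. \<integral>y. F y \<omega> \<partial>lborel)" by simp
      then have "integrable lborel (\<lambda>\<omega>. wt1 \<omega> *\<^sub>R (\<integral>y. indicator {l..b} y *\<^sub>R h (\<tau> \<omega>) (y + k \<omega> * snd \<omega>) \<partial>lborel))"
        unfolding Feq integral_scaleR_right .
      from integral_lborel_pair(1)[OF this] show ?thesis by simp
    qed
    also have "\<dots> = (\<integral>\<rho>. (\<integral>z. wt0 (\<rho>, z) *\<^sub>R (sqrt t *\<^sub>R (h (\<tau> (\<rho>, z)) (b + k (\<rho>, z) * z) - h (\<tau> (\<rho>, z)) (l + k (\<rho>, z) * z))) \<partial>lborel) \<partial>lborel)"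
    proof (rule Bochner_Integration.integral_cong[OF refl])
      fix \<rho> :: real
      show "(\<integral>z. wt1 (\<rho>, z) *\<^sub>R (\<integral>y. indicator {l..b} y *\<^sub>R h (\<tau> (\<rho>, z)) (y + k (\<rho>, z) * z) \<partial>lborel) \<partial>lborel)
        = (\<integral>z. wt0 (\<rho>, z) *\<^sub>R (sqrt t *\<^sub>R (h (\<tau> (\<rho>, z)) (b + k (\<rho>, z) * z) - h (\<tau> (\<rho>, z)) (l + k (\<rho>, z) * z))) \<partial>lborel)"
      proof (cases "0 < \<rho> \<and> \<rho> < 1")
        case False
        then show ?thesis by (simp add: wt0_def wt1_def)
      next
        case True
        define s where "s = t * (1 - \<rho>)"
        define c where "c = sqrt t * sqrt (2 * \<rho>)"
        have s: "s \<in> {0..t}" using True t by (auto simp: s_def mult_left_le)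
        define f where "f z = (\<integral>y. indicator {l..b} y *\<^sub>R h s (y + c * z) \<partial>lborel)" for z
        note win = window_integral[OF ch1 C(2)[OF s] lb, of c]
        \<comment> \<open>Differentiating the window in \<open>z\<close> brings out
          \<open>c = sqrt t * sqrt (2 * \<rho>)\<close>: the second factor cancels the singularity
          of \<open>wt1\<close>, and \<open>sqrt t\<close> completes the prefactor
          \<open>sqrt t\<close> of \<open>duhamel_x\<close> to the prefactor \<open>t\<close> of
          \<open>duhamel\<close>.\<close>
        have st: "(\<integral>z. (z * gauss z) *\<^sub>R f z \<partial>lborel) = (\<integral>z. gauss z *\<^sub>R (c *\<^sub>R (h s (b + c * z) - h s (l + c * z))) \<partial>lborel)"
        proof (rule stein)
          show "(f has_vector_derivative c *\<^sub>R (h s (b + c * z) - h s (l + c * z))) (at z)" for z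
            unfolding f_def[abs_def] by (rule win(1))
          show "continuous_on UNIV (\<lambda>z. c *\<^sub>R (h s (b + c * z) - h s (l + c * z)))"
            by (intro continuous_intros continuous_on_compose2[OF ch1]) auto
          show "norm (f z) \<le> max (C * (b - l)) (\<bar>c\<bar> * (C + C))" for z
            using win(2)[of z] unfolding f_def by simp
          have "norm (h s (b + c * z) - h s (l + c * z)) \<le> C + C" for z
            using norm_triangle_ineq4 C(2)[OF s] by (metis add_mono order_trans)
          then show "norm (c *\<^sub>R (h s (b + c * z) - h s (l + c * z))) \<le> max (C * (b - l)) (\<bar>c\<bar> * (C + C))" for z
            by (simp add: mult_left_mono le_max_iff_disj)
        qed
        have e1: "wt1 (\<rho>, z) *\<^sub>R (\<integral>y. indicator {l..b} y *\<^sub>R h (\<tau> (\<rho>, z)) (y + k (\<rho>, z) * z) \<partial>lborel)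
          = (1 / sqrt (2 * \<rho>)) *\<^sub>R ((z * gauss z) *\<^sub>R f z)" for z
          using True by (simp add: wt1_def f_def \<tau>_def k_def s_def c_def)
        have e2: "wt0 (\<rho>, z) *\<^sub>R (sqrt t *\<^sub>R (h (\<tau> (\<rho>, z)) (b + k (\<rho>, z) * z) - h (\<tau> (\<rho>, z)) (l + k (\<rho>, z) * z)))
          = (1 / sqrt (2 * \<rho>)) *\<^sub>R (gauss z *\<^sub>R (c *\<^sub>R (h s (b + c * z) - h s (l + c * z))))" for z
          using True by (simp add: wt0_def \<tau>_def k_def s_def c_def mult.commute)
        show ?thesis unfolding e1 e2 integral_scaleR_right st ..
      qed
    qed
    also have "sqrt t *\<^sub>R \<dots> = duhamel h t b - duhamel h t l"
    proof -
      have i: "integrable lborel (\<lambda>\<omega>. wt0 \<omega> *\<^sub>R h (\<tau> \<omega>) (y + k \<omega> * snd \<omega>))" for y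
        using integrable_parabolic_avg[OF integrable_wt0 wt_nonzero(1) bh t
            borel_measurable_continuous_onI[OF continuous_on_add[OF continuous_on_const cont(2)]], of y]
        unfolding \<tau>_def hh by simp
      have i2: "integrable lborel (\<lambda>\<omega>. wt0 \<omega> *\<^sub>R (sqrt t *\<^sub>R (h (\<tau> \<omega>) (b + k \<omega> * snd \<omega>) - h (\<tau> \<omega>) (l + k \<omega> * snd \<omega>))))"
        using integrable_scaleR_right[OF Bochner_Integration.integrable_diff[OF i[of b] i[of l]], of "sqrt t"]
        by (simp add: algebra_simps)
      have "(\<integral>\<rho>. (\<integral>z. wt0 (\<rho>, z) *\<^sub>R (sqrt t *\<^sub>R (h (\<tau> (\<rho>, z)) (b + k (\<rho>, z) * z) - h (\<tau> (\<rho>, z)) (l + k (\<rho>, z) * z))) \<partial>lborel) \<partial>lborel)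
        = (\<integral>\<omega>. wt0 \<omega> *\<^sub>R (sqrt t *\<^sub>R (h (\<tau> \<omega>) (b + k \<omega> * snd \<omega>) - h (\<tau> \<omega>) (l + k \<omega> * snd \<omega>))) \<partial>lborel)"
        using integral_lborel_pair(1)[OF i2] by simp
      also have "\<dots> = sqrt t *\<^sub>R ((\<integral>\<omega>. wt0 \<omega> *\<^sub>R h (\<tau> \<omega>) (b + k \<omega> * snd \<omega>) \<partial>lborel) - (\<integral>\<omega>. wt0 \<omega> *\<^sub>R h (\<tau> \<omega>) (l + k \<omega> * snd \<omega>) \<partial>lborel))"
        unfolding Bochner_Integration.integral_diff[OF i i, symmetric] integral_scaleR_right[symmetric]
        by (rule Bochner_Integration.integral_cong) (auto simp: algebra_simps)
      finally show ?thesis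
        unfolding duhamel_def arg \<tau>_def[symmetric] using t by (simp add: scaleR_diff_right)
    qed
    finally show "duhamel h t b - duhamel h t (x - 1) = (\<integral>y. indicator {x - 1..b} y *\<^sub>R duhamel_x h t y \<partial>lborel)"
      by (simp add: l_def)
  qed auto
  moreover have "at x within {x - 1..x + 1} = at x" by (rule at_within_interior) simp
  ultimately show ?thesis unfolding eq by simp
qed

lemma bounded_rangeE:
  fixes f :: "'a \<Rightarrow> 'b::real_normed_vector"
  assumes "bounded (range f)"
  obtains C where "0 \<le> C" "\<And>x. norm (f x) \<le> C"
  using assms unfolding bounded_iff by (metis norm_ge_zero order_trans rangeI)

text \<open>When the source is differentiable, its derivative can stay inside the integral. The
  space derivative is then itself a Duhamel integral with a continuous source, and
  \<open>duhamel_has_space_derivative\<close> can be applied to it to reach second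
  derivatives.\<close>

lemma duhamel_C1_space_derivative:
  assumes g: "BUC g" and gx: "BUC gx" and t: "0 \<le> t"
    and der: "\<And>s y. s \<in> {0..t} \<Longrightarrow> (g s has_vector_derivative gx s y) (at y)"
  shows "(duhamel g t has_vector_derivative duhamel gx t x) (at x)"
proof -
  obtain C where C: "0 \<le> C" "\<And>s y. s \<in> {0..t} \<Longrightarrow> norm (gx s y) \<le> C" using BUC_bound[OF gx] by metis
  define \<tau> where "\<tau> \<omega> = t * (1 - fst \<omega>)" for \<omega> :: "real \<times> real"
  define k where "k \<omega> = sqrt t * (sqrt (2 * fst \<omega>) * snd \<omega>)" for \<omega> :: "real \<times> real"
  have \<tau>: "\<tau> \<omega> \<in> {0..t}" if "wt0 \<omega> \<noteq> 0" for \<omega>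
    using wt_nonzero(1)[OF that] t by (auto simp: \<tau>_def mult_left_le)
  have ym: "(\<lambda>\<omega>. y + k \<omega>) \<in> borel_measurable borel" for y
    unfolding k_def by (intro borel_measurable_continuous_onI continuous_intros)
  have "((\<lambda>y. \<integral>\<omega>. wt0 \<omega> *\<^sub>R extend0 g (\<tau> \<omega>) (y + k \<omega>) \<partial>lborel)
    has_vector_derivative (\<integral>\<omega>. wt0 \<omega> *\<^sub>R extend0 gx (\<tau> \<omega>) (x + k \<omega>) \<partial>lborel)) (at x within UNIV)"
  proof (rule has_vector_derivative_integral[where H = "\<lambda>\<omega>. \<bar>wt0 \<omega>\<bar> * C"])
    show "((\<lambda>y. wt0 \<omega> *\<^sub>R extend0 g (\<tau> \<omega>) (y + k \<omega>)) has_vector_derivative wt0 \<omega> *\<^sub>R extend0 gx (\<tau> \<omega>) (y + k \<omega>)) (at y within UNIV)" for y \<omega>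
    proof (cases "wt0 \<omega> = 0")
      case False
      have "((\<lambda>y. y + k \<omega>) has_vector_derivative 1) (at y)"
        unfolding has_real_derivative_iff_has_vector_derivative[symmetric] by (auto intro!: derivative_eq_intros)
      from vector_diff_chain_at[OF this der[OF \<tau>[OF False]]]
      have "((\<lambda>y. g (\<tau> \<omega>) (y + k \<omega>)) has_vector_derivative gx (\<tau> \<omega>) (y + k \<omega>)) (at y)" by (simp add: comp_def)
      then show ?thesis using \<tau>[OF False] by (auto simp: extend0_eq intro!: derivative_eq_intros)
    qed simp
    show "norm (wt0 \<omega> *\<^sub>R extend0 gx (\<tau> \<omega>) (y + k \<omega>)) \<le> \<bar>wt0 \<omega>\<bar> * C" for y \<omega>
      using C(2)[OF \<tau>] \<tau>[of \<omega>] by (cases "wt0 \<omega> = 0") (auto simp: extend0_eq mult_left_mono)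
    show "integrable lborel (\<lambda>\<omega>. wt0 \<omega> *\<^sub>R extend0 g (\<tau> \<omega>) (y + k \<omega>))" for y
      unfolding \<tau>_def by (rule integrable_parabolic_avg[OF integrable_wt0 wt_nonzero(1) g t ym])
    show "integrable lborel (\<lambda>\<omega>. \<bar>wt0 \<omega>\<bar> * C)" using integrable_wt0 by simp
    have "integrable lborel (\<lambda>\<omega>. wt0 \<omega> *\<^sub>R extend0 gx (\<tau> \<omega>) (x + k \<omega>))"
      unfolding \<tau>_def by (rule integrable_parabolic_avg[OF integrable_wt0 wt_nonzero(1) gx t ym])
    then show "(\<lambda>\<omega>. wt0 \<omega> *\<^sub>R extend0 gx (\<tau> \<omega>) (x + k \<omega>)) \<in> borel_measurable lborel" by (rule borel_measurable_integrable)
  qed auto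
  from bounded_linear.has_vector_derivative[OF bounded_linear_scaleR_right this, of t]
  have "(duhamel (extend0 g) t has_vector_derivative duhamel (extend0 gx) t x) (at x)"
    unfolding duhamel_def[abs_def] \<tau>_def k_def .
  moreover have "duhamel (extend0 g) t = duhamel g t" "duhamel (extend0 gx) t x = duhamel gx t x"
    using duhamel_cong(1)[OF t, of "extend0 g" g] duhamel_cong(1)[OF t, of "extend0 gx" gx] by (auto simp: extend0_eq)
  ultimately show ?thesis by simp
qed

lemma heat_space_derivative:
  assumes f: "continuous_on UNIV f" "bounded (range f)" and f': "continuous_on UNIV f'" "bounded (range f')"
    and der: "\<And>y. (f has_vector_derivative f' y) (at y)"
  shows "(heat f t has_vector_derivative heat f' t x) (at x)"
proof -
  obtain C where C: "0 \<le> C" "\<And>y. norm (f y) \<le> C" using f(2) by (rule bounded_rangeE) auto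
  obtain C' where C': "0 \<le> C'" "\<And>y. norm (f' y) \<le> C'" using f'(2) by (rule bounded_rangeE) auto
  have i: "integrable lborel (\<lambda>z. gauss z *\<^sub>R h (y + sqrt t * (sqrt 2 * z)))"
    if "continuous_on UNIV h" "\<And>y. norm (h y) \<le> B" for h :: "real \<Rightarrow> complex" and y B
  proof (rule integrable_scaled_bounded[OF integrable_gauss _ that(2)])
    have "(\<lambda>z. h (y + sqrt t * (sqrt 2 * z))) \<in> borel_measurable borel"
      by (intro borel_measurable_continuous_onI continuous_on_compose2[OF that(1)] continuous_intros) auto
    then show "(\<lambda>z. gauss z *\<^sub>R h (y + sqrt t * (sqrt 2 * z))) \<in> borel_measurable lborel" by simp
  qed
  show ?thesis unfolding heat_def[abs_def]
  proof (rule has_vector_derivative_integral[where S = UNIV and H = "\<lambda>z. gauss z * C'"])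
    show "((\<lambda>y. gauss z *\<^sub>R f (y + sqrt t * (sqrt 2 * z))) has_vector_derivative gauss z *\<^sub>R f' (y + sqrt t * (sqrt 2 * z))) (at y)" for y z
    proof -
      have "((\<lambda>y. y + sqrt t * (sqrt 2 * z)) has_vector_derivative 1) (at y)"
        unfolding has_real_derivative_iff_has_vector_derivative[symmetric] by (auto intro!: derivative_eq_intros)
      from vector_diff_chain_at[OF this der]
      have "((\<lambda>y. f (y + sqrt t * (sqrt 2 * z))) has_vector_derivative f' (y + sqrt t * (sqrt 2 * z))) (at y)" by (simp add: comp_def)
      from bounded_linear.has_vector_derivative[OF bounded_linear_scaleR_right this] show ?thesis .
    qed
    show "integrable lborel (\<lambda>z. gauss z *\<^sub>R f (y + sqrt t * (sqrt 2 * z)))" for y by (rule i[OF f(1) C(2)])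
    show "(\<lambda>z. gauss z *\<^sub>R f' (x + sqrt t * (sqrt 2 * z))) \<in> borel_measurable lborel"
      by (rule borel_measurable_integrable[OF i[OF f'(1) C'(2)]])
  qed (use integrable_gauss C' in \<open>auto simp: mult_left_mono\<close>)
qed

text \<open>The integral of \<open>F\<close> over time and \<open>z\<close> is evaluated in both
  orders. Integrating over \<open>z\<close> first turns the factor \<open>z\<close> into a
  derivative by \<open>stein\<close> and gives \<open>heat f''\<close>; integrating over time first
  gives the increment of \<open>f\<close> along the path of \<open>sqrt_path_integral\<close>, whose
  Gaussian mean is \<open>heat f t x - f x\<close>.\<close>

lemma heat_time_identity:
  assumes f: "continuous_on UNIV f" "bounded (range f)" and f': "continuous_on UNIV f'" "bounded (range f')"
    and f'': "continuous_on UNIV f''" "bounded (range f'')"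
    and der: "\<And>y. (f has_vector_derivative f' y) (at y)" "\<And>y. (f' has_vector_derivative f'' y) (at y)"
    and t: "0 \<le> t"
  shows "heat f t x - f x = (\<integral>s. indicator {0..t} s *\<^sub>R heat f'' s x \<partial>lborel)"
proof -
  obtain C where C: "0 \<le> C" "\<And>y. norm (f y) \<le> C" using f(2) by (rule bounded_rangeE) auto
  obtain C' where C': "0 \<le> C'" "\<And>y. norm (f' y) \<le> C'" using f'(2) by (rule bounded_rangeE) auto
  obtain C'' where C'': "0 \<le> C''" "\<And>y. norm (f'' y) \<le> C''" using f''(2) by (rule bounded_rangeE) auto
  define F where "F p = (indicator {0<..<t} (fst p) / sqrt (2 * fst p) * (snd p * gauss (snd p))) *\<^sub>R f' (x + sqrt (2 * fst p) * snd p)" for p :: "real \<times> real"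
  have Fi: "integrable lborel F"
    unfolding F_def[abs_def]
  proof (rule integrable_scaled_bounded[OF integrable_times_lborel[OF integral_inverse_sqrt(1)[OF t] integrable_gauss_ident] _ C'(2)])
    have "(\<lambda>p. f' (x + sqrt (2 * fst p) * snd p)) \<in> borel_measurable (borel :: (real \<times> real) measure)"
      by (intro borel_measurable_continuous_onI continuous_on_compose2[OF f'(1)] continuous_intros) auto
    then show "(\<lambda>p. (indicator {0<..<t} (fst p) / sqrt (2 * fst p) * (snd p * gauss (snd p))) *\<^sub>R f' (x + sqrt (2 * fst p) * snd p)) \<in> borel_measurable lborel"
      using borel_measurable_integrable[OF integrable_times_lborel[OF integral_inverse_sqrt(1)[OF t] integrable_gauss_ident]] by simp
  qed
  have e1: "indicator {0<..<t} s *\<^sub>R heat f'' s x = (\<integral>z. F (s, z) \<partial>lborel)" for s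
  proof (cases "s \<in> {0<..<t}")
    case True
    define c where "c = sqrt s * sqrt 2"
    have c: "0 < c" "sqrt (2 * s) = c" using True by (auto simp: c_def real_sqrt_mult)
    have "(\<integral>z. (z * gauss z) *\<^sub>R f' (x + c * z) \<partial>lborel) = (\<integral>z. gauss z *\<^sub>R (c *\<^sub>R f'' (x + c * z)) \<partial>lborel)"
    proof (rule stein)
      show "((\<lambda>z. f' (x + c * z)) has_vector_derivative c *\<^sub>R f'' (x + c * z)) (at z)" for z
      proof -
        have "((\<lambda>z. x + c * z) has_vector_derivative c) (at z)"
          unfolding has_real_derivative_iff_has_vector_derivative[symmetric] by (auto intro!: derivative_eq_intros)
        from vector_diff_chain_at[OF this der(2)] show ?thesis by (simp add: comp_def)
      qed
      show "continuous_on UNIV (\<lambda>z. c *\<^sub>R f'' (x + c * z))"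
        by (intro continuous_intros continuous_on_compose2[OF f''(1)]) auto
      show "norm (f' (x + c * z)) \<le> max C' (c * C'')" for z using C'(2) by (simp add: le_max_iff_disj)
      show "norm (c *\<^sub>R f'' (x + c * z)) \<le> max C' (c * C'')" for z using C''(2) c by (simp add: le_max_iff_disj mult_left_mono)
    qed
    also have "\<dots> = c *\<^sub>R heat f'' s x"
    proof -
      have a: "sqrt s * (sqrt 2 * z) = c * z" for z by (simp add: c_def)
      show ?thesis unfolding heat_def a integral_scaleR_right[symmetric] by (simp add: mult.commute)
    qed
    finally have st: "c *\<^sub>R heat f'' s x = (\<integral>z. (z * gauss z) *\<^sub>R f' (x + c * z) \<partial>lborel)" by simp
    have "F (s, z) = (1 / c) *\<^sub>R ((z * gauss z) *\<^sub>R f' (x + c * z))" for z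
      using True by (simp add: F_def c)
    then have "(\<integral>z. F (s, z) \<partial>lborel) = (1 / c) *\<^sub>R (c *\<^sub>R heat f'' s x)"
      unfolding st by (simp only: integral_scaleR_right)
    then show ?thesis using True c by simp
  qed (simp add: F_def)
  have e2: "(\<integral>s. F (s, z) \<partial>lborel) = gauss z *\<^sub>R (f (x + sqrt (2 * t) * z) - f x)" for z
  proof -
    have "F (s, z) = gauss z *\<^sub>R ((indicator {0<..<t} s / sqrt (2 * s) * z) *\<^sub>R f' (x + sqrt (2 * s) * z))" for s
      by (simp add: F_def mult_ac)
    then have "(\<integral>s. F (s, z) \<partial>lborel) = gauss z *\<^sub>R (\<integral>s. (indicator {0<..<t} s / sqrt (2 * s) * z) *\<^sub>R f' (x + sqrt (2 * s) * z) \<partial>lborel)"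
      by (simp only: integral_scaleR_right)
    then show ?thesis using sqrt_path_integral[OF der(1) f'(1) C'(2) t, of z x] by simp
  qed
  have i: "integrable lborel (\<lambda>z. gauss z *\<^sub>R f (y + b * z))" for y b
  proof (rule integrable_scaled_bounded[OF integrable_gauss _ C(2)])
    have "(\<lambda>z. f (y + b * z)) \<in> borel_measurable borel"
      by (intro borel_measurable_continuous_onI continuous_on_compose2[OF f(1)] continuous_intros) auto
    then show "(\<lambda>z. gauss z *\<^sub>R f (y + b * z)) \<in> borel_measurable lborel" by simp
  qed
  have "(\<integral>s. indicator {0..t} s *\<^sub>R heat f'' s x \<partial>lborel) = (\<integral>s. (\<integral>z. F (s, z) \<partial>lborel) \<partial>lborel)"
    unfolding integral_indicator_Icc_Ioo e1 ..
  also have "\<dots> = (\<integral>z. (\<integral>s. F (s, z) \<partial>lborel) \<partial>lborel)"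
    using integral_lborel_pair[OF Fi] by simp
  also have "\<dots> = (\<integral>z. gauss z *\<^sub>R f (x + sqrt (2 * t) * z) - gauss z *\<^sub>R f (x + 0 * z) \<partial>lborel)"
    unfolding e2 by (simp add: scaleR_diff_right)
  also have "\<dots> = (\<integral>z. gauss z *\<^sub>R f (x + sqrt (2 * t) * z) \<partial>lborel) - (\<integral>z. gauss z *\<^sub>R f (x + 0 * z) \<partial>lborel)"
    by (rule Bochner_Integration.integral_diff[OF i i])
  also have "\<dots> = heat f t x - f x"
    by (simp add: heat_def real_sqrt_mult integral_gauss mult_ac)
  finally show ?thesis by simp
qed

text \<open>The integrated form of the statement that \<open>duhamel g\<close> solves the heat
  equation with source \<open>g\<close> and initial value 0, its second space derivative being
  \<open>duhamel_x gx\<close>. As in \<open>heat_time_identity\<close>, one kernel is integrated in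
  two orders, now with the emission time of the source as an additional variable.\<close>

lemma duhamel_time_identity:
  assumes g: "BUC g" and gx: "BUC gx" and t: "0 \<le> t"
    and der: "\<And>s y. s \<in> {0..t} \<Longrightarrow> (g s has_vector_derivative gx s y) (at y)"
  shows "duhamel g t x = (\<integral>s. indicator {0..t} s *\<^sub>R (duhamel_x gx s x + g s x) \<partial>lborel)"
proof -
  define h where "h = extend0 g"
  define hx where "hx = extend0 gx"
  have ch: "continuous_on UNIV (case_prod h)" "continuous_on UNIV (case_prod hx)"
    unfolding h_def hx_def using continuous_on_extend0 g gx by auto
  have ch1: "continuous_on UNIV (hx s)" for s
    using continuous_on_compose2[OF ch(2) continuous_on_Pair[OF continuous_on_const continuous_on_id], of s] by simp
  have hd: "(h s has_vector_derivative hx s y) (at y)" if "s \<in> {0..t}" for s y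
    using der[OF that] that by (simp add: h_def hx_def extend0_eq)
  obtain C where C: "0 \<le> C" "\<And>s y. s \<in> {0..t} \<Longrightarrow> norm (h s y) \<le> C"
    using BUC_bound[OF BUC_extend0[OF g]] unfolding h_def by metis
  obtain C' where C': "0 \<le> C'" "\<And>s y. s \<in> {0..t} \<Longrightarrow> norm (hx s y) \<le> C'"
    using BUC_bound[OF BUC_extend0[OF gx]] unfolding hx_def by metis
  \<comment> \<open>A point \<open>p = ((r, z), s)\<close> consists of the emission time
    \<open>r\<close>, the Gaussian variable \<open>z\<close> and the observation time
    \<open>s\<close>. The weight restricts to \<open>0 < r < s < t\<close> and carries the singular
    velocity for the lag \<open>s - r\<close>.\<close>
  define W where "W p = (indicator {0<..<t} (fst (fst p)) * (indicator {0<..<t - fst (fst p)} (snd p - fst (fst p)) / sqrt (2 * (snd p - fst (fst p)))))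
    * (snd (fst p) * gauss (snd (fst p)))" for p :: "(real \<times> real) \<times> real"
  define K where "K p = W p *\<^sub>R hx (fst (fst p)) (x + sqrt (2 * (snd p - fst (fst p))) * snd (fst p))" for p
  have bm: "(\<lambda>p::(real \<times> real) \<times> real. fst (fst p)) \<in> borel_measurable borel"
    "(\<lambda>p::(real \<times> real) \<times> real. snd (fst p)) \<in> borel_measurable borel"
    "(\<lambda>p::(real \<times> real) \<times> real. snd p) \<in> borel_measurable borel"
    by (intro borel_measurable_continuous_onI continuous_intros)+
  note [measurable] = bm
  have Wm: "W \<in> borel_measurable borel"
  proof -
    have "W = (\<lambda>p. (indicator {0<..<t} (fst (fst p)) * (indicator {p. 0 < snd p - fst (fst p) \<and> snd p - fst (fst p) < t - fst (fst p)} p / sqrt (2 * (snd p - fst (fst p)))))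
      * (snd (fst p) * gauss (snd (fst p))))"
      by (auto simp: W_def fun_eq_iff split: split_indicator)
    also have "\<dots> \<in> borel_measurable borel" by measurable
    finally show ?thesis .
  qed
  have base: "integrable lborel (\<lambda>s. indicator {0<..<t - r} (s - r) / sqrt (2 * (s - r)))"
    "(\<integral>s. indicator {0<..<t - r} (s - r) / sqrt (2 * (s - r)) \<partial>lborel) = sqrt (2 * (t - r))" if "r \<le> t" for r
    using lborel_integrable_real_affine[OF integral_inverse_sqrt(1)[of "t - r"], of 1 "- r"]
      lborel_integral_real_affine[of 1 "\<lambda>\<sigma>. indicator {0<..<t - r} \<sigma> / sqrt (2 * \<sigma>)" "- r"]
      integral_inverse_sqrt(2)[of "t - r"] that by simp_all
  have Wi: "integrable lborel W"
  proof -
    have "integrable (lborel \<Otimes>\<^sub>M lborel) W"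
    proof (rule lborel_pair.Fubini_integrable)
      show "W \<in> borel_measurable (lborel \<Otimes>\<^sub>M lborel)" using Wm by (simp add: lborel_prod)
      have "(\<integral>s. norm (W (\<omega>, s)) \<partial>lborel) = (indicator {0<..<t} (fst \<omega>) * sqrt (2 * (t - fst \<omega>))) * \<bar>snd \<omega> * gauss (snd \<omega>)\<bar>" for \<omega>
      proof (cases "fst \<omega> \<in> {0<..<t}")
        case True
        have "norm (W (\<omega>, s)) = (indicator {0<..<t - fst \<omega>} (s - fst \<omega>) / sqrt (2 * (s - fst \<omega>))) * \<bar>snd \<omega> * gauss (snd \<omega>)\<bar>" for s
          using True by (auto simp: W_def abs_mult split: split_indicator)
        then have "(\<integral>s. norm (W (\<omega>, s)) \<partial>lborel) = (\<integral>s. indicator {0<..<t - fst \<omega>} (s - fst \<omega>) / sqrt (2 * (s - fst \<omega>)) \<partial>lborel) * \<bar>snd \<omega> * gauss (snd \<omega>)\<bar>"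
          by (simp only: integral_mult_left_zero)
        also have "\<dots> = sqrt (2 * (t - fst \<omega>)) * \<bar>snd \<omega> * gauss (snd \<omega>)\<bar>"
          by (subst base(2)) (use True in auto)
        finally show ?thesis using True by simp
      qed (simp add: W_def)
      moreover have "integrable lborel (\<lambda>\<omega>. (indicator {0<..<t} (fst \<omega>) * sqrt (2 * (t - fst \<omega>))) * \<bar>snd \<omega> * gauss (snd \<omega>)\<bar>)"
      proof (rule integrable_times_lborel)
        show "integrable lborel (\<lambda>r. indicator {0<..<t} r * sqrt (2 * (t - r)))"
        proof (rule Bochner_Integration.integrable_bound[of _ "\<lambda>r. indicator {0..t} r * sqrt (2 * t)"])
          show "integrable lborel (\<lambda>r. indicator {0..t} r * sqrt (2 * t))"
            using integrable_indicator_Icc[of 0 t] by simp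
          show "(\<lambda>r. indicator {0<..<t} r * sqrt (2 * (t - r))) \<in> borel_measurable lborel" by simp
        qed (auto intro!: AE_I2 split: split_indicator)
        show "integrable lborel (\<lambda>z. \<bar>z * gauss z\<bar>)" using integrable_gauss_ident by (rule integrable_abs)
      qed
      ultimately show "integrable lborel (\<lambda>\<omega>. \<integral>s. norm (W (\<omega>, s)) \<partial>lborel)" by simp
      show "AE \<omega> in lborel. integrable lborel (\<lambda>s. W (\<omega>, s))"
      proof (rule AE_I2)
        fix \<omega> :: "real \<times> real"
        show "integrable lborel (\<lambda>s. W (\<omega>, s))"
        proof (cases "fst \<omega> \<in> {0<..<t}")
          case True
          then show ?thesis
            using integrable_mult_left[OF base(1)[of "fst \<omega>"], of "snd \<omega> * gauss (snd \<omega>)"] by (simp add: W_def)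
        qed (simp add: W_def)
      qed
    qed
    then show ?thesis by (simp add: lborel_prod)
  qed
  have Ki: "integrable lborel K"
    unfolding K_def[abs_def]
  proof (rule integrable_scaled_bounded[OF Wi, where C = C'])
    have "(\<lambda>p. hx (fst (fst p)) (x + sqrt (2 * (snd p - fst (fst p))) * snd (fst p))) \<in> borel_measurable borel"
      by (rule borel_measurable_case_prod_comp[OF ch(2)]) (intro borel_measurable_continuous_onI continuous_intros)+
    then show "(\<lambda>p. W p *\<^sub>R hx (fst (fst p)) (x + sqrt (2 * (snd p - fst (fst p))) * snd (fst p))) \<in> borel_measurable lborel"
      using Wm by simp
    fix p assume "W p \<noteq> 0"
    then have "fst (fst p) \<in> {0..t}" by (auto simp: W_def split: split_indicator_asm)
    then show "norm (hx (fst (fst p)) (x + sqrt (2 * (snd p - fst (fst p))) * snd (fst p))) \<le> C'" by (rule C'(2))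
  qed
  have e1: "indicator {0<..<t} s *\<^sub>R duhamel_x hx s x = (\<integral>\<omega>. K (\<omega>, s) \<partial>lborel)" for s
  proof (cases "s \<in> {0<..<t}")
    case False
    then have "K (\<omega>, s) = 0" for \<omega> by (auto simp: K_def W_def split: split_indicator)
    then show ?thesis using False by simp
  next
    case True
    then have s: "0 < s" "s < t" by auto
    have m: "(\<lambda>\<omega>. K (\<omega>, s)) \<in> borel_measurable borel"
    proof -
      have "K \<in> borel_measurable borel" using Ki by auto
      moreover have "(\<lambda>\<omega>. (\<omega>, s)) \<in> (borel :: (real \<times> real) measure) \<rightarrow>\<^sub>M borel"
        by (intro borel_measurable_continuous_onI continuous_intros)
      ultimately show ?thesis using measurable_compose by blast
    qed
    \<comment> \<open>For fixed \<open>s\<close> the substitution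
      \<open>r = s * (1 - \<rho>)\<close> makes the lag \<open>s * \<rho>\<close>. The Jacobian
      \<open>s\<close> against the \<open>sqrt s\<close> in the denominator of the weight leaves the
      prefactor of \<open>duhamel_x\<close>.\<close>
    have "(\<integral>\<omega>. K (\<omega>, s) \<partial>lborel) = \<bar>- s\<bar> *\<^sub>R (\<integral>\<omega>. K ((s + - s * fst \<omega>, snd \<omega>), s) \<partial>lborel)"
      using lborel_integral_pair_fst_affine[OF _ m, of "- s" s] s by simp
    also have "\<dots> = (\<integral>\<omega>. s *\<^sub>R K ((s + - s * fst \<omega>, snd \<omega>), s) \<partial>lborel)" using s by simp
    also have "\<dots> = (\<integral>\<omega>. sqrt s *\<^sub>R (wt1 \<omega> *\<^sub>R hx (s * (1 - fst \<omega>)) (x + sqrt s * (sqrt (2 * fst \<omega>) * snd \<omega>))) \<partial>lborel)"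
    proof (rule Bochner_Integration.integral_cong[OF refl])
      fix \<omega> :: "real \<times> real"
      define \<rho> where "\<rho> = fst \<omega>"
      show "s *\<^sub>R K ((s + - s * fst \<omega>, snd \<omega>), s) = sqrt s *\<^sub>R (wt1 \<omega> *\<^sub>R hx (s * (1 - fst \<omega>)) (x + sqrt s * (sqrt (2 * fst \<omega>) * snd \<omega>)))"
      proof (cases "0 < \<rho> \<and> \<rho> < 1")
        case True
        then have r: "0 < s - s * \<rho>" "s - s * \<rho> < t" "s * \<rho> < t - (s - s * \<rho>)" using s by (auto simp: algebra_simps intro: order.strict_trans2[OF _ less_imp_le])
        have W: "W ((s + - s * \<rho>, snd \<omega>), s) = 1 / (sqrt s * sqrt (2 * \<rho>)) * (snd \<omega> * gauss (snd \<omega>))"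
          using True s r by (simp add: W_def real_sqrt_mult mult_ac)
        have "s *\<^sub>R K ((s + - s * \<rho>, snd \<omega>), s) = (s * W ((s + - s * \<rho>, snd \<omega>), s)) *\<^sub>R hx (s * (1 - \<rho>)) (x + sqrt s * (sqrt (2 * \<rho>) * snd \<omega>))"
          by (simp add: K_def algebra_simps real_sqrt_mult)
        also have "s * W ((s + - s * \<rho>, snd \<omega>), s) = sqrt s * (1 / sqrt (2 * \<rho>) * (snd \<omega> * gauss (snd \<omega>)))"
        proof -
          have "s * W ((s + - s * \<rho>, snd \<omega>), s) = (s / sqrt s) * (1 / sqrt (2 * \<rho>) * (snd \<omega> * gauss (snd \<omega>)))"
            unfolding W by simp
          then show ?thesis using real_div_sqrt[of s] s by simp
        qed
        finally show ?thesis using True by (simp add: wt1_def \<rho>_def)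
      next
        case False
        have "\<not> (0 < s - s * \<rho> \<and> 0 < s * \<rho>)"
        proof
          assume "0 < s - s * \<rho> \<and> 0 < s * \<rho>"
          then have "0 < s * (1 - \<rho>)" "0 < s * \<rho>" by (auto simp: algebra_simps)
          then show False using False s by (auto simp: zero_less_mult_iff)
        qed
        then have "W ((s + - s * \<rho>, snd \<omega>), s) = 0" by (auto simp: W_def split: split_indicator)
        moreover have "wt1 \<omega> = 0" using False wt_nonzero(2)[of \<omega>] by (auto simp: \<rho>_def)
        ultimately show ?thesis by (simp add: K_def \<rho>_def)
      qed
    qed
    also have "\<dots> = duhamel_x hx s x" unfolding duhamel_x_def integral_scaleR_right ..
    finally show ?thesis using True by simp
  qed
  have e2: "(\<integral>s. K (\<omega>, s) \<partial>lborel) = (indicator {0<..<t} (fst \<omega>) * gauss (snd \<omega>)) *\<^sub>R (h (fst \<omega>) (x + sqrt (2 * (t - fst \<omega>)) * snd \<omega>) - h (fst \<omega>) x)" for \<omega>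
  proof (cases "fst \<omega> \<in> {0<..<t}")
    case True
    define r where "r = fst \<omega>"
    have r: "r \<in> {0..t}" "0 \<le> t - r" using True by (auto simp: r_def)
    define P where "P \<sigma> = (indicator {0<..<t - r} \<sigma> / sqrt (2 * \<sigma>) * snd \<omega>) *\<^sub>R hx r (x + sqrt (2 * \<sigma>) * snd \<omega>)" for \<sigma>
    have "K (\<omega>, s) = gauss (snd \<omega>) *\<^sub>R P (- r + 1 * s)" for s
      using True by (simp add: K_def W_def P_def r_def mult_ac)
    then have "(\<integral>s. K (\<omega>, s) \<partial>lborel) = gauss (snd \<omega>) *\<^sub>R (\<integral>s. P (- r + 1 * s) \<partial>lborel)"
      by (simp only: integral_scaleR_right)
    also have "(\<integral>s. P (- r + 1 * s) \<partial>lborel) = (\<integral>\<sigma>. P \<sigma> \<partial>lborel)"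
      using lborel_integral_real_affine[of 1 P "- r"] by simp
    also have "\<dots> = h r (x + sqrt (2 * (t - r)) * snd \<omega>) - h r x"
      unfolding P_def by (rule sqrt_path_integral[OF hd[OF r(1)] ch1 C'(2)[OF r(1)] r(2)])
    finally show ?thesis using True by (simp add: r_def)
  qed (simp add: K_def W_def)
  \<comment> \<open>The two ends of the path in \<open>e2\<close>. \<open>G1\<close> is the source
    transported from time \<open>r\<close> to time \<open>t\<close>, which integrates to the Duhamel
    integral; in \<open>G2\<close> the source is evaluated at \<open>x\<close> itself, so the
    Gaussian integrates out and the time integral of the source remains.\<close>
  define G1 where "G1 \<omega> = (indicator {0<..<t} (fst \<omega>) * gauss (snd \<omega>)) *\<^sub>R h (fst \<omega>) (x + sqrt (2 * (t - fst \<omega>)) * snd \<omega>)" for \<omega>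
  define G2 where "G2 \<omega> = (indicator {0<..<t} (fst \<omega>) * gauss (snd \<omega>)) *\<^sub>R h (fst \<omega>) x" for \<omega>
  have ioo: "integrable lborel (\<lambda>r. indicator {0<..<t} r :: real)"
    by (rule integrable_real_indicator) (auto simp: t)
  have wi: "integrable lborel (\<lambda>\<omega>. indicator {0<..<t} (fst \<omega>) * gauss (snd \<omega>))"
    by (rule integrable_times_lborel[OF ioo integrable_gauss])
  have Gi: "integrable lborel (\<lambda>\<omega>. (indicator {0<..<t} (fst \<omega>) * gauss (snd \<omega>)) *\<^sub>R h (fst \<omega>) (y \<omega>))"
    if "continuous_on UNIV y" for y :: "real \<times> real \<Rightarrow> real"
  proof (rule integrable_scaled_bounded[OF wi, where C = C])
    have "(\<lambda>\<omega>. h (fst \<omega>) (y \<omega>)) \<in> borel_measurable borel"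
      by (rule borel_measurable_case_prod_comp[OF ch(1)]) (auto intro!: borel_measurable_continuous_onI continuous_intros that)
    then show "(\<lambda>\<omega>. (indicator {0<..<t} (fst \<omega>) * gauss (snd \<omega>)) *\<^sub>R h (fst \<omega>) (y \<omega>)) \<in> borel_measurable lborel"
      using borel_measurable_integrable[OF wi] by simp
    show "norm (h (fst \<omega>) (y \<omega>)) \<le> C" if "indicator {0<..<t} (fst \<omega>) * gauss (snd \<omega>) \<noteq> 0" for \<omega>
      using that by (intro C(2)) (auto split: split_indicator_asm)
  qed
  have G1i: "integrable lborel G1" unfolding G1_def[abs_def] by (rule Gi) (intro continuous_intros)
  have G2i: "integrable lborel G2" unfolding G2_def[abs_def] by (rule Gi) (intro continuous_intros)
  have d1: "(\<integral>\<omega>. G1 \<omega> \<partial>lborel) = duhamel h t x"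
  proof (cases "t = 0")
    case False
    then have t0: "0 < t" using t by simp
    have "(\<integral>\<omega>. G1 \<omega> \<partial>lborel) = \<bar>- t\<bar> *\<^sub>R (\<integral>\<omega>. G1 (t + - t * fst \<omega>, snd \<omega>) \<partial>lborel)"
      using borel_measurable_integrable[OF G1i] False by (intro lborel_integral_pair_fst_affine) auto
    also have "(\<integral>\<omega>. G1 (t + - t * fst \<omega>, snd \<omega>) \<partial>lborel) = (\<integral>\<omega>. wt0 \<omega> *\<^sub>R h (t * (1 - fst \<omega>)) (x + sqrt t * (sqrt (2 * fst \<omega>) * snd \<omega>)) \<partial>lborel)"
    proof (rule Bochner_Integration.integral_cong[OF refl])
      fix \<omega> :: "real \<times> real"
      have "(indicator {0<..<t} (t - t * fst \<omega>) :: real) = indicator {0<..<1} (fst \<omega>)"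
        using t0 by (auto split: split_indicator simp: algebra_simps zero_less_mult_iff mult_less_cancel_left2)
      then show "G1 (t + - t * fst \<omega>, snd \<omega>) = wt0 \<omega> *\<^sub>R h (t * (1 - fst \<omega>)) (x + sqrt t * (sqrt (2 * fst \<omega>) * snd \<omega>))"
        by (simp add: G1_def wt0_def algebra_simps real_sqrt_mult)
    qed
    finally show ?thesis using t0 by (simp add: duhamel_def)
  qed (simp add: G1_def duhamel_def)
  have d2: "(\<integral>\<omega>. G2 \<omega> \<partial>lborel) = (\<integral>r. indicator {0<..<t} r *\<^sub>R h r x \<partial>lborel)"
  proof -
    have "(\<integral>z. G2 (r, z) \<partial>lborel) = indicator {0<..<t} r *\<^sub>R h r x" for r
      by (simp add: G2_def integral_gauss)
    then show ?thesis unfolding integral_lborel_pair(1)[OF G2i] by simp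
  qed
  have h0: "integrable lborel (\<lambda>s. indicator {0<..<t} s *\<^sub>R h s x)"
  proof (rule integrable_scaled_bounded[OF ioo, where C = C])
    have "(\<lambda>s. h s x) \<in> borel_measurable borel"
      by (rule borel_measurable_case_prod_comp[OF ch(1)]) (auto intro!: borel_measurable_continuous_onI continuous_intros)
    then show "(\<lambda>s. indicator {0<..<t} s *\<^sub>R h s x) \<in> borel_measurable lborel" by simp
    show "norm (h s x) \<le> C" if "(indicator {0<..<t} s :: real) \<noteq> 0" for s
      using that by (intro C(2)) (auto split: split_indicator_asm)
  qed
  have k0: "integrable lborel (\<lambda>s. indicator {0<..<t} s *\<^sub>R duhamel_x hx s x)"
  proof -
    have "integrable (lborel \<Otimes>\<^sub>M lborel) (\<lambda>(\<omega>, s). K (\<omega>, s))" using Ki by (simp add: lborel_prod)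
    from lborel_pair.integrable_snd[OF this] show ?thesis unfolding e1 .
  qed
  have "(\<integral>s. indicator {0<..<t} s *\<^sub>R duhamel_x hx s x \<partial>lborel) = (\<integral>\<omega>. (\<integral>s. K (\<omega>, s) \<partial>lborel) \<partial>lborel)"
    unfolding e1 using integral_lborel_pair[OF Ki] by simp
  also have "\<dots> = (\<integral>\<omega>. G1 \<omega> - G2 \<omega> \<partial>lborel)"
    unfolding e2 G1_def G2_def by (simp add: scaleR_diff_right)
  also have "\<dots> = duhamel h t x - (\<integral>s. indicator {0<..<t} s *\<^sub>R h s x \<partial>lborel)"
    unfolding Bochner_Integration.integral_diff[OF G1i G2i] d1 d2 ..
  finally have "duhamel h t x = (\<integral>s. indicator {0<..<t} s *\<^sub>R duhamel_x hx s x + indicator {0<..<t} s *\<^sub>R h s x \<partial>lborel)"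
    unfolding Bochner_Integration.integral_add[OF k0 h0] by simp
  also have "\<dots> = (\<integral>s. indicator {0<..<t} s *\<^sub>R (duhamel_x gx s x + g s x) \<partial>lborel)"
  proof (rule Bochner_Integration.integral_cong[OF refl])
    fix s
    have "duhamel_x hx s x = duhamel_x gx s x" "h s x = g s x" if "0 \<le> s"
      using duhamel_cong(2)[OF that, of hx gx] that by (auto simp: h_def hx_def extend0_eq)
    then show "indicator {0<..<t} s *\<^sub>R duhamel_x hx s x + indicator {0<..<t} s *\<^sub>R h s x
      = indicator {0<..<t} s *\<^sub>R (duhamel_x gx s x + g s x)"
      by (auto split: split_indicator)
  qed
  also have "\<dots> = (\<integral>s. indicator {0..t} s *\<^sub>R (duhamel_x gx s x + g s x) \<partial>lborel)"
    by (rule integral_indicator_Icc_Ioo[symmetric])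
  also have "duhamel h t x = duhamel g t x"
    using duhamel_cong(1)[OF t, of h g] by (simp add: h_def extend0_eq)
  finally show ?thesis .
qed

section \<open>The truncated equation\<close>

text \<open>The polynomial factor admits products, whose Lipschitz constant grows with the
  arguments. On a slab \<open>g\<close> and \<open>h\<close> are bounded, so the factor is dominated
  by the constant \<open>B\<close>. Sums, differences, conjugates and globally Lipschitz maps are
  instances as well.\<close>

lemma BUC_compose:
  assumes g: "BUC g" "BUC h" and le: "\<And>p q. norm (\<Phi> p - \<Phi> q) \<le> norm (fst p - fst q) * (1 + norm (fst p) + norm (snd p) + norm (fst q) + norm (snd q)) ^ 2 * L
      + norm (snd p - snd q) * (1 + norm (fst p) + norm (snd p) + norm (fst q) + norm (snd q)) ^ 2 * L" and L: "0 \<le> L"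
  shows "BUC (\<lambda>t x. \<Phi> (g t x, h t x))"
proof (rule BUCI)
  fix T :: real assume T: "0 \<le> T"
  obtain C where C: "0 \<le> C" "\<And>t x. t \<in> {0..T} \<Longrightarrow> norm (g t x) \<le> C" using BUC_bound[OF g(1)] by metis
  obtain C' where C': "0 \<le> C'" "\<And>t x. t \<in> {0..T} \<Longrightarrow> norm (h t x) \<le> C'" using BUC_bound[OF g(2)] by metis
  define B where "B = (1 + C + C' + C + C')\<^sup>2 * L"
  have B: "0 \<le> B" using L by (simp add: B_def)
  have est: "norm (\<Phi> (g t x, h t x) - \<Phi> (g s y, h s y)) \<le> norm (g t x - g s y) * B + norm (h t x - h s y) * B"
    if "t \<in> {0..T}" "s \<in> {0..T}" for t s x y
  proof -
    have "(1 + norm (g t x) + norm (h t x) + norm (g s y) + norm (h s y))\<^sup>2 * L \<le> B"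
      unfolding B_def using C C' that L by (intro mult_right_mono power_mono add_mono) auto
    then have "norm (g t x - g s y) * ((1 + norm (g t x) + norm (h t x) + norm (g s y) + norm (h s y))\<^sup>2 * L)
       + norm (h t x - h s y) * ((1 + norm (g t x) + norm (h t x) + norm (g s y) + norm (h s y))\<^sup>2 * L)
      \<le> norm (g t x - g s y) * B + norm (h t x - h s y) * B"
      by (intro add_mono mult_left_mono) auto
    then show ?thesis using le[of "(g t x, h t x)" "(g s y, h s y)"] by (simp add: mult.assoc)
  qed
  show "uniformly_continuous_on ({0..T} \<times> UNIV) (\<lambda>(t, x). \<Phi> (g t x, h t x))"
    unfolding uniformly_continuous_on_sequentially
  proof (intro allI impI, elim conjE)
    fix X Y :: "nat \<Rightarrow> real \<times> real"
    assume X: "\<forall>n. X n \<in> {0..T} \<times> UNIV" and Y: "\<forall>n. Y n \<in> {0..T} \<times> UNIV"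
      and XY: "(\<lambda>n. dist (X n) (Y n)) \<longlonglongrightarrow> 0"
    have "(\<lambda>n. dist (case_prod g (X n)) (case_prod g (Y n))) \<longlonglongrightarrow> 0" "(\<lambda>n. dist (case_prod h (X n)) (case_prod h (Y n))) \<longlonglongrightarrow> 0"
      using BUCD[OF g(1), of T] BUCD[OF g(2), of T] X Y XY unfolding uniformly_continuous_on_sequentially by blast+
    then have lim: "(\<lambda>n. dist (case_prod g (X n)) (case_prod g (Y n)) * B + dist (case_prod h (X n)) (case_prod h (Y n)) * B) \<longlonglongrightarrow> 0"
      by (auto intro!: tendsto_add_zero tendsto_mult_left_zero)
    show "(\<lambda>n. dist (case X n of (t, x) \<Rightarrow> \<Phi> (g t x, h t x)) (case Y n of (t, x) \<Rightarrow> \<Phi> (g t x, h t x))) \<longlonglongrightarrow> 0"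
    proof (rule Lim_null_comparison[OF always_eventually lim], intro allI)
      fix n
      show "norm (dist (case X n of (t, x) \<Rightarrow> \<Phi> (g t x, h t x)) (case Y n of (t, x) \<Rightarrow> \<Phi> (g t x, h t x)))
        \<le> dist (case_prod g (X n)) (case_prod g (Y n)) * B + dist (case_prod h (X n)) (case_prod h (Y n)) * B"
        using est[of "fst (X n)" "fst (Y n)" "snd (X n)" "snd (Y n)"] X Y
        unfolding case_prod_beta dist_norm by (auto simp: mem_Times_iff)
    qed
  qed
  have "norm (\<Phi> (g t x, h t x)) \<le> norm (\<Phi> (g 0 0, h 0 0)) + ((C + C) * B + (C' + C') * B)" if t: "t \<in> {0..T}" for t x
  proof -
    have 0: "0 \<in> {0..T}" using T by simp
    have "norm (\<Phi> (g t x, h t x) - \<Phi> (g 0 0, h 0 0)) \<le> norm (g t x - g 0 0) * B + norm (h t x - h 0 0) * B"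
      by (rule est[OF t 0])
    also have "\<dots> \<le> (C + C) * B + (C' + C') * B"
      using B C(2)[OF t] C(2)[OF 0] C'(2)[OF t] C'(2)[OF 0]
      by (intro add_mono mult_right_mono order_trans[OF norm_triangle_ineq4]) auto
    finally show ?thesis using norm_triangle_sub[of "\<Phi> (g t x, h t x)" "\<Phi> (g 0 0, h 0 0)"] by linarith
  qed
  then show "\<exists>C. \<forall>t\<in>{0..T}. \<forall>x. norm (\<Phi> (g t x, h t x)) \<le> C" by blast
qed

lemma BUC_add: "BUC g \<Longrightarrow> BUC h \<Longrightarrow> BUC (\<lambda>t x. g t x + h t x)"
  and BUC_diff: "BUC g \<Longrightarrow> BUC h \<Longrightarrow> BUC (\<lambda>t x. g t x - h t x)"
  and BUC_mult: "BUC g \<Longrightarrow> BUC h \<Longrightarrow> BUC (\<lambda>t x. g t x * h t x)"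
  and BUC_cnj: "BUC g \<Longrightarrow> BUC (\<lambda>t x. cnj (g t x))"
proof -
  have one: "1 \<le> (1 + norm (fst p) + norm (snd p) + norm (fst q) + norm (snd q)) ^ 2" for p q :: "complex \<times> complex"
    by (rule one_le_power) simp
  have lip: "norm (fst p - fst q) + norm (snd p - snd q) \<le> norm (fst p - fst q) * (1 + norm (fst p) + norm (snd p) + norm (fst q) + norm (snd q)) ^ 2 * 1
      + norm (snd p - snd q) * (1 + norm (fst p) + norm (snd p) + norm (fst q) + norm (snd q)) ^ 2 * 1" for p q :: "complex \<times> complex"
    using mult_left_mono[OF one[of p q], of "norm (fst p - fst q)"] mult_left_mono[OF one[of p q], of "norm (snd p - snd q)"] by simp
  assume g: "BUC g"
  have "norm (cnj (fst p) - cnj (fst q)) \<le> norm (fst p - fst q) + norm (snd p - snd q)" for p q :: "complex \<times> complex"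
    by (simp flip: complex_cnj_diff)
  from BUC_compose[OF g g order_trans[OF this lip]] show "BUC (\<lambda>t x. cnj (g t x))" by simp
  assume h: "BUC h"
  have "norm ((fst p + snd p) - (fst q + snd q)) \<le> norm (fst p - fst q) + norm (snd p - snd q)" for p q :: "complex \<times> complex"
    by (metis add_diff_add norm_triangle_ineq)
  from BUC_compose[OF g h order_trans[OF this lip]] show "BUC (\<lambda>t x. g t x + h t x)" by simp
  have "norm ((fst p - snd p) - (fst q - snd q)) \<le> norm (fst p - fst q) + norm (snd p - snd q)" for p q :: "complex \<times> complex"
    using norm_triangle_ineq4[of "fst p - fst q" "snd p - snd q"] by (simp add: algebra_simps)
  from BUC_compose[OF g h order_trans[OF this lip]] show "BUC (\<lambda>t x. g t x - h t x)" by simp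
  have "norm (fst p * snd p - fst q * snd q) \<le> norm (fst p - fst q) * (1 + norm (fst p) + norm (snd p) + norm (fst q) + norm (snd q)) ^ 2 * 1
      + norm (snd p - snd q) * (1 + norm (fst p) + norm (snd p) + norm (fst q) + norm (snd q)) ^ 2 * 1" for p q :: "complex \<times> complex"
  proof -
    define m where "m = 1 + norm (fst p) + norm (snd p) + norm (fst q) + norm (snd q)"
    have "1 \<le> m" by (simp add: m_def)
    then have mm: "m \<le> m\<^sup>2" by (simp add: power2_eq_square)
    have b: "norm (snd p) \<le> m\<^sup>2" "norm (fst q) \<le> m\<^sup>2"
      by (rule order_trans[OF _ mm], simp add: m_def)+
    have "fst p * snd p - fst q * snd q = (fst p - fst q) * snd p + fst q * (snd p - snd q)" by (simp add: algebra_simps)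
    then have "norm (fst p * snd p - fst q * snd q) \<le> norm (fst p - fst q) * norm (snd p) + norm (fst q) * norm (snd p - snd q)"
      by (metis norm_mult norm_triangle_ineq)
    also have "\<dots> \<le> norm (fst p - fst q) * m\<^sup>2 + m\<^sup>2 * norm (snd p - snd q)"
      using b by (intro add_mono mult_left_mono mult_right_mono) auto
    finally show ?thesis by (simp add: m_def mult.commute)
  qed
  from BUC_compose[OF g h this] show "BUC (\<lambda>t x. g t x * h t x)" by simp
qed

lemma BUC_lipschitz:
  fixes N :: "complex \<Rightarrow> complex"
  assumes g: "BUC g" and L: "0 \<le> L" and N: "\<And>z w. norm (N z - N w) \<le> L * norm (z - w)"
  shows "BUC (\<lambda>t x. N (g t x))"
proof -
  have "norm (N (fst p) - N (fst q)) \<le> norm (fst p - fst q) * (1 + norm (fst p) + norm (snd p) + norm (fst q) + norm (snd q)) ^ 2 * L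
      + norm (snd p - snd q) * (1 + norm (fst p) + norm (snd p) + norm (fst q) + norm (snd q)) ^ 2 * L" for p q :: "complex \<times> complex"
  proof -
    have one: "1 \<le> (1 + norm (fst p) + norm (snd p) + norm (fst q) + norm (snd q)) ^ 2" by (rule one_le_power) simp
    have "norm (N (fst p) - N (fst q)) \<le> norm (fst p - fst q) * 1 * L" using N[of "fst p" "fst q"] by (simp add: mult.commute)
    also have "\<dots> \<le> norm (fst p - fst q) * (1 + norm (fst p) + norm (snd p) + norm (fst q) + norm (snd q)) ^ 2 * L"
      using one L by (intro mult_right_mono mult_left_mono) auto
    finally show ?thesis using L by (simp add: add_increasing2)
  qed
  from BUC_compose[OF g g this L] show ?thesis by simp
qed

lemma BUC_uniform_limit:
  assumes A: "\<And>n::nat. BUC (A n)"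
    and lim: "\<And>T e. 0 < e \<Longrightarrow> \<exists>n. \<forall>t\<in>{0..T}. \<forall>x. norm (A n t x - B t x) < e"
  shows "BUC B"
proof (rule BUCI)
  fix T :: real
  show "uniformly_continuous_on ({0..T} \<times> UNIV) (case_prod B)"
    unfolding uniformly_continuous_on_def
  proof (intro allI impI)
    fix e :: real assume "0 < e"
    then have e3: "0 < e / 3" by simp
    obtain n where n: "\<And>t x. t \<in> {0..T} \<Longrightarrow> norm (A n t x - B t x) < e / 3" using lim[OF e3] by metis
    obtain d where d: "0 < d" "\<And>p p'. p \<in> {0..T} \<times> UNIV \<Longrightarrow> p' \<in> {0..T} \<times> UNIV \<Longrightarrow> dist p' p < d \<Longrightarrow> dist (case_prod (A n) p') (case_prod (A n) p) < e / 3"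
      using BUCD[OF A, of T n] e3 unfolding uniformly_continuous_on_def by metis
    have "dist (case_prod B p') (case_prod B p) < e" if p: "p \<in> {0..T} \<times> UNIV" "p' \<in> {0..T} \<times> UNIV" "dist p' p < d" for p p'
    proof -
      have 1: "dist (case_prod (A n) r) (case_prod B r) < e / 3" if "r \<in> {0..T} \<times> UNIV" for r
        using n[of "fst r" "snd r"] that by (cases r) (simp add: dist_norm)
      show ?thesis
        using 1[OF p(1)] 1[OF p(2)] d(2)[OF p] dist_triangle[of "case_prod B p'" "case_prod B p" "case_prod (A n) p'"]
          dist_triangle[of "case_prod (A n) p'" "case_prod B p" "case_prod (A n) p"]
        by (simp add: dist_commute)
    qed
    then show "\<exists>d>0. \<forall>p\<in>{0..T} \<times> UNIV. \<forall>p'\<in>{0..T} \<times> UNIV. dist p' p < d \<longrightarrow> dist (case_prod B p') (case_prod B p) < e"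
      using d(1) by blast
  qed
  obtain n where n: "\<And>t x. t \<in> {0..T} \<Longrightarrow> norm (A n t x - B t x) < 1" using lim[of 1 T] by (metis zero_less_one)
  obtain C where C: "\<And>t x. t \<in> {0..T} \<Longrightarrow> norm (A n t x) \<le> C" using BUC_bound[OF A] by metis
  have "norm (B t x) \<le> C + 1" if "t \<in> {0..T}" for t x
  proof -
    show ?thesis
      using C[OF that, of x] n[OF that, of x] norm_triangle_sub[of "B t x" "A n t x"] norm_minus_commute[of "B t x" "A n t x"] by linarith
  qed
  then show "\<exists>C. \<forall>t\<in>{0..T}. \<forall>x. norm (B t x) \<le> C" by blast
qed

section \<open>Global mild solutions by Picard iteration\<close>

lemma geometric_cauchy:
  fixes a :: "nat \<Rightarrow> 'a::banach"
  assumes "\<And>n. norm (a (Suc n) - a n) \<le> c / 2 ^ n"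
  shows "norm (a n - lim a) \<le> 2 * c / 2 ^ n"
proof -
  have step: "norm (a (n + k) - a n) \<le> 2 * c / 2 ^ n - 2 * c / 2 ^ (n + k)" for n k
  proof (induction k)
    case (Suc k)
    have "norm (a (n + Suc k) - a n) \<le> norm (a (Suc (n + k)) - a (n + k)) + norm (a (n + k) - a n)"
      using norm_triangle_ineq[of "a (Suc (n + k)) - a (n + k)" "a (n + k) - a n"] by simp
    also have "\<dots> \<le> c / 2 ^ (n + k) + (2 * c / 2 ^ n - 2 * c / 2 ^ (n + k))" by (rule add_mono[OF assms Suc.IH])
    also have "\<dots> = 2 * c / 2 ^ n - 2 * c / 2 ^ (n + Suc k)" by (simp add: field_simps)
    finally show ?case .
  qed simp
  have c0: "0 \<le> c" using order_trans[OF norm_ge_zero assms[of 0]] by simp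
  have bd: "norm (a (n + k) - a n) \<le> 2 * c / 2 ^ n" for n k
  proof -
    have "0 \<le> 2 * c / 2 ^ (n + k)" using c0 by simp
    then show ?thesis using step[of n k] by linarith
  qed
  have "summable (\<lambda>n. a (Suc n) - a n)"
  proof (rule summable_comparison_test')
    show "summable (\<lambda>n. c * (1 / 2) ^ n)" by (intro summable_mult summable_geometric) simp
    show "norm (a (Suc n) - a n) \<le> c * (1 / 2) ^ n" if "0 \<le> n" for n using assms[of n] by (simp add: power_divide)
  qed
  then have "convergent (\<lambda>n. a n - a 0)" by (simp add: summable_iff_convergent sum_lessThan_telescope)
  from convergent_add[OF this convergent_const[of "a 0"]] have "convergent a" by simp
  then have lim: "a \<longlonglongrightarrow> lim a" by (simp add: convergent_LIMSEQ_iff)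
  have "(\<lambda>k. norm (a (k + n) - a n)) \<longlonglongrightarrow> norm (lim a - a n)"
    by (intro tendsto_intros LIMSEQ_ignore_initial_segment lim)
  then have "norm (lim a - a n) \<le> 2 * c / 2 ^ n"
    by (rule LIMSEQ_le_const2) (use bd[of n] in \<open>auto simp: add.commute\<close>)
  then show ?thesis by (simp add: norm_minus_commute)
qed

text \<open>Bielecki's exponentially weighted supremum norm: the integral of
  \<open>exp (\<kappa> * s)\<close> over \<open>s\<close> from 0 to \<open>t\<close> is at most
  \<open>exp (\<kappa> * t) / \<kappa>\<close>, so a large \<kappa> makes the Duhamel operator small
  on all time intervals at once.\<close>

lemma duhamel_diff_bound:
  assumes g: "BUC g" and h: "BUC h" and t: "0 \<le> t" and \<kappa>: "0 < \<kappa>"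
    and le: "\<And>s y. s \<in> {0..t} \<Longrightarrow> norm (g s y - h s y) \<le> K * exp (\<kappa> * s)"
  shows "norm (duhamel g t x - duhamel h t x) \<le> K * exp (\<kappa> * t) / \<kappa>"
proof (cases "t = 0")
  case True
  have "0 \<le> K" using order_trans[OF norm_ge_zero le[of 0 0]] t by simp
  then show ?thesis using True \<kappa> by (simp add: duhamel_def)
next
  case False
  then have t0: "0 < t" using t by simp
  have K: "0 \<le> K" using order_trans[OF norm_ge_zero le[of 0 0]] t by simp
  define y where "y \<omega> = x + sqrt t * (sqrt (2 * fst \<omega>) * snd \<omega>)" for \<omega> :: "real \<times> real"
  define \<tau> where "\<tau> \<omega> = t * (1 - fst \<omega>)" for \<omega> :: "real \<times> real"
  have ym: "y \<in> borel_measurable borel" unfolding y_def[abs_def] by (intro borel_measurable_continuous_onI continuous_intros)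
  have i: "integrable lborel (\<lambda>\<omega>. wt0 \<omega> *\<^sub>R extend0 g (\<tau> \<omega>) (y \<omega>))" "integrable lborel (\<lambda>\<omega>. wt0 \<omega> *\<^sub>R extend0 h (\<tau> \<omega>) (y \<omega>))"
    unfolding \<tau>_def using integrable_parabolic_avg[OF integrable_wt0 wt_nonzero(1) _ t ym] g h by auto
  have F: "((\<lambda>\<rho>. - (1 / (\<kappa> * t)) * exp (\<kappa> * (t * (1 - \<rho>)))) has_vector_derivative exp (\<kappa> * (t * (1 - \<rho>)))) (at \<rho> within {0..1})" for \<rho>
    unfolding has_real_derivative_iff_has_vector_derivative[symmetric] using \<kappa> t0
    by (auto intro!: derivative_eq_intros)
  have ce: "continuous_on {0..1} (\<lambda>\<rho>. exp (\<kappa> * (t * (1 - \<rho>))))" by (intro continuous_intros)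
  have e1: "(\<integral>\<rho>. indicator {0<..<1} \<rho> * exp (\<kappa> * (t * (1 - \<rho>))) \<partial>lborel) = (exp (\<kappa> * t) - 1) / (\<kappa> * t)"
    using integral_FTC_atLeastAtMost[OF _ F ce] integral_indicator_Icc_Ioo[of 0 1 "\<lambda>\<rho>. exp (\<kappa> * (t * (1 - \<rho>)))"]
    by (simp add: diff_divide_distrib)
  have "integrable lborel (\<lambda>\<rho>. indicator {0..1} \<rho> *\<^sub>R exp (\<kappa> * (t * (1 - \<rho>))))"
    using borel_integrable_atLeastAtMost'[OF ce] by (simp add: set_integrable_def)
  then have ie: "integrable lborel (\<lambda>\<rho>. indicator {0<..<1} \<rho> * exp (\<kappa> * (t * (1 - \<rho>))))"
    by (rule Bochner_Integration.integrable_bound) (auto intro!: AE_I2 split: split_indicator)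
  have iw: "integrable lborel (\<lambda>\<omega>. (indicator {0<..<1} (fst \<omega>) * exp (\<kappa> * (t * (1 - fst \<omega>)))) * gauss (snd \<omega>))"
    by (rule integrable_times_lborel[OF ie integrable_gauss])
  have "duhamel g t x - duhamel h t x = duhamel (extend0 g) t x - duhamel (extend0 h) t x"
    using duhamel_cong(1)[OF t, of "extend0 g" g] duhamel_cong(1)[OF t, of "extend0 h" h] by (simp add: extend0_eq)
  also have "\<dots> = t *\<^sub>R (\<integral>\<omega>. wt0 \<omega> *\<^sub>R extend0 g (\<tau> \<omega>) (y \<omega>) - wt0 \<omega> *\<^sub>R extend0 h (\<tau> \<omega>) (y \<omega>) \<partial>lborel)"
    unfolding duhamel_def Bochner_Integration.integral_diff[OF i] by (simp add: \<tau>_def y_def scaleR_diff_right)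
  finally have "norm (duhamel g t x - duhamel h t x) = t * norm (\<integral>\<omega>. wt0 \<omega> *\<^sub>R extend0 g (\<tau> \<omega>) (y \<omega>) - wt0 \<omega> *\<^sub>R extend0 h (\<tau> \<omega>) (y \<omega>) \<partial>lborel)"
    using t by simp
  also have "\<dots> \<le> t * (\<integral>\<omega>. norm (wt0 \<omega> *\<^sub>R extend0 g (\<tau> \<omega>) (y \<omega>) - wt0 \<omega> *\<^sub>R extend0 h (\<tau> \<omega>) (y \<omega>)) \<partial>lborel)"
    using t by (intro mult_left_mono integral_norm_bound)
  also have "\<dots> \<le> t * (\<integral>\<omega>. K * ((indicator {0<..<1} (fst \<omega>) * exp (\<kappa> * (t * (1 - fst \<omega>)))) * gauss (snd \<omega>)) \<partial>lborel)"
  proof (intro mult_left_mono integral_mono' t)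
    show "integrable lborel (\<lambda>\<omega>. K * ((indicator {0<..<1} (fst \<omega>) * exp (\<kappa> * (t * (1 - fst \<omega>)))) * gauss (snd \<omega>)))"
      using iw by (rule integrable_mult_right)
    fix \<omega> :: "real \<times> real"
    show "0 \<le> K * ((indicator {0<..<1} (fst \<omega>) * exp (\<kappa> * (t * (1 - fst \<omega>)))) * gauss (snd \<omega>))" using K by simp
    show "norm (wt0 \<omega> *\<^sub>R extend0 g (\<tau> \<omega>) (y \<omega>) - wt0 \<omega> *\<^sub>R extend0 h (\<tau> \<omega>) (y \<omega>))
      \<le> K * ((indicator {0<..<1} (fst \<omega>) * exp (\<kappa> * (t * (1 - fst \<omega>)))) * gauss (snd \<omega>))"
    proof (cases "0 < fst \<omega> \<and> fst \<omega> < 1")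
      case True
      then have "\<tau> \<omega> \<in> {0..t}" using t by (auto simp: \<tau>_def mult_left_le)
      with le[OF this, of "y \<omega>"] have "norm (extend0 g (\<tau> \<omega>) (y \<omega>) - extend0 h (\<tau> \<omega>) (y \<omega>)) \<le> K * exp (\<kappa> * (t * (1 - fst \<omega>)))"
        by (simp add: extend0_eq) (simp add: \<tau>_def)
      from mult_left_mono[OF this, of "gauss (snd \<omega>)"] show ?thesis
        using True by (simp add: wt0_def scaleR_diff_right[symmetric] mult_ac)
    qed (simp add: wt0_def)
  qed
  also have "(\<integral>\<omega>. K * ((indicator {0<..<1} (fst \<omega>) * exp (\<kappa> * (t * (1 - fst \<omega>)))) * gauss (snd \<omega>)) \<partial>lborel) = K * ((exp (\<kappa> * t) - 1) / (\<kappa> * t))"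
  proof -
    have "(\<integral>\<omega>. (indicator {0<..<1} (fst \<omega>) * exp (\<kappa> * (t * (1 - fst \<omega>)))) * gauss (snd \<omega>) \<partial>lborel) = (exp (\<kappa> * t) - 1) / (\<kappa> * t)"
      unfolding integral_lborel_pair(1)[OF iw] by (simp add: integral_gauss e1)
    then show ?thesis by simp
  qed
  also have "t * (K * ((exp (\<kappa> * t) - 1) / (\<kappa> * t))) \<le> K * exp (\<kappa> * t) / \<kappa>"
    using t0 \<kappa> K by (simp add: divide_right_mono mult_left_mono)
  finally show ?thesis .
qed

lemma mild_solution_exists:
  fixes N :: "complex \<Rightarrow> complex"
  assumes f: "uniformly_continuous_on UNIV f" "bounded (range f)"
    and L: "0 < L" and N: "\<And>z w. norm (N z - N w) \<le> L * norm (z - w)"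
  obtains A where "BUC A" "\<And>t x. 0 \<le> t \<Longrightarrow> A t x = heat f t x + duhamel (\<lambda>s y. N (A s y)) t x"
proof -
  define \<Psi> where "\<Psi> A = (\<lambda>t x. heat f t x + duhamel (\<lambda>s y. N (A s y)) t x)" for A
  define A where "A n = (\<Psi> ^^ n) (heat f)" for n
  have AS: "A (Suc n) = \<Psi> (A n)" for n by (simp add: A_def)
  have BN: "BUC (\<lambda>t x. N (g t x))" if "BUC g" for g
    by (rule BUC_lipschitz[OF that _ N]) (use L in simp)
  have B\<Psi>: "BUC (\<Psi> g)" if "BUC g" for g
    unfolding \<Psi>_def by (intro BUC_add BUC_heat[OF f] BUC_duhamel BN that)
  have BA: "BUC (A n)" for n by (induction n) (simp_all add: AS B\<Psi>, simp add: A_def BUC_heat[OF f])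
  \<comment> \<open>With this rate the Picard map halves distances in the weighted norm. The
    iteration thus converges for all times, and no continuation of local solutions is
    required.\<close>
  define \<kappa> where "\<kappa> = 2 * L"
  have \<kappa>: "0 < \<kappa>" using L by (simp add: \<kappa>_def)
  have contr: "norm (\<Psi> g t x - \<Psi> h t x) \<le> (K / 2) * exp (\<kappa> * t)"
    if "BUC g" "BUC h" "0 \<le> t" and le: "\<And>s y. s \<in> {0..t} \<Longrightarrow> norm (g s y - h s y) \<le> K * exp (\<kappa> * s)" for g h t x K
  proof -
    have "norm (\<Psi> g t x - \<Psi> h t x) \<le> (L * K) * exp (\<kappa> * t) / \<kappa>"
      unfolding \<Psi>_def add_diff_cancel_left
    proof (rule duhamel_diff_bound[OF BN BN])
      show "norm (N (g s y) - N (h s y)) \<le> L * K * exp (\<kappa> * s)" if "s \<in> {0..t}" for s y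
        using order_trans[OF N mult_left_mono[OF le[OF that], of L]] L by (simp add: mult.assoc)
    qed (use that \<kappa> in auto)
    also have "\<dots> = (K / 2) * exp (\<kappa> * t)" using L by (simp add: \<kappa>_def)
    finally show ?thesis .
  qed
  obtain C where C: "0 \<le> C" "\<And>x. norm (f x) \<le> C" using f(2) by (rule bounded_rangeE) auto
  \<comment> \<open>The size of the first increment, obtained by comparing the source
    \<open>N (heat f)\<close> with 0 in \<open>duhamel_diff_bound\<close>.\<close>
  define M where "M = (norm (N 0) + L * C) / \<kappa>"
  have M: "0 \<le> M" using C L \<kappa> by (simp add: M_def)
  have zero: "duhamel (\<lambda>_ _. 0) t x = 0" for t x by (simp add: duhamel_def)
  have bz: "BUC (\<lambda>_ _. 0)" using BUC_const[of "\<lambda>_. 0"] by (simp add: uniformly_continuous_on_const)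
  have diff: "norm (A (Suc n) t x - A n t x) \<le> (M / 2 ^ n) * exp (\<kappa> * t)" if "0 \<le> t" for n t x
    using that
  proof (induction n arbitrary: t x)
    case 0
    have "norm (duhamel (\<lambda>s y. N (heat f s y)) t x - duhamel (\<lambda>_ _. 0) t x) \<le> (norm (N 0) + L * C) * exp (\<kappa> * t) / \<kappa>"
    proof (rule duhamel_diff_bound[OF BN[OF BUC_heat[OF f]] bz 0 \<kappa>])
      fix s y assume s: "s \<in> {0..t}"
      have "norm (N (heat f s y)) \<le> norm (N 0) + norm (N (heat f s y) - N 0)" by (rule norm_triangle_sub)
      also have "\<dots> \<le> norm (N 0) + L * C"
      proof -
        have "norm (heat f s y - 0) \<le> C" using heat_bound[of f C, OF C(2)] by simp
        from order_trans[OF N[of "heat f s y" 0] mult_left_mono[OF this]] show ?thesis using L by simp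
      qed
      also have "\<dots> \<le> (norm (N 0) + L * C) * exp (\<kappa> * s)"
      proof -
        have "1 \<le> exp (\<kappa> * s)" using s \<kappa> by simp
        from mult_left_mono[OF this, of "norm (N 0) + L * C"] show ?thesis using C L by simp
      qed
      finally show "norm (N (heat f s y) - 0) \<le> (norm (N 0) + L * C) * exp (\<kappa> * s)" by simp
    qed
    then show ?case by (simp add: AS) (simp add: A_def \<Psi>_def M_def zero)
  next
    case (Suc n)
    have "norm (\<Psi> (A (Suc n)) t x - \<Psi> (A n) t x) \<le> (M / 2 ^ n / 2) * exp (\<kappa> * t)"
      by (rule contr[OF BA BA Suc.prems]) (use Suc.IH in auto)
    then show ?case by (simp add: AS[symmetric] mult.commute)
  qed
  define B where "B t x = lim (\<lambda>n. A n t x)" for t x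
  have AB: "norm (A n t x - B t x) \<le> (2 * M / 2 ^ n) * exp (\<kappa> * t)" if "0 \<le> t" for n t x
    using geometric_cauchy[of "\<lambda>n. A n t x" "M * exp (\<kappa> * t)" n] diff[OF that] by (simp add: B_def mult_ac)
  have small: "\<exists>n. c / 2 ^ n < e" if "0 < e" for c e :: real
  proof -
    obtain n where "c / e < 2 ^ n" using real_arch_pow[of 2 "c / e"] by auto
    then show ?thesis using that by (auto simp: divide_less_eq mult.commute intro!: exI[of _ n])
  qed
  have BB: "BUC B"
  proof (rule BUC_uniform_limit[OF BA])
    fix T e :: real assume "0 < e"
    from small[OF this, of "2 * M * exp (\<kappa> * T)"] obtain n where n: "2 * M * exp (\<kappa> * T) / 2 ^ n < e" by blast
    have "norm (A n t x - B t x) < e" if t: "t \<in> {0..T}" for t x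
    proof -
      have "norm (A n t x - B t x) \<le> (2 * M / 2 ^ n) * exp (\<kappa> * t)" using AB t by simp
      also have "\<dots> \<le> (2 * M / 2 ^ n) * exp (\<kappa> * T)" using t \<kappa> M by (intro mult_left_mono) auto
      finally show ?thesis using n by simp
    qed
    then show "\<exists>n. \<forall>t\<in>{0..T}. \<forall>x. norm (A n t x - B t x) < e" by blast
  qed
  \<comment> \<open>The limit is within \<open>M / 2 ^ n\<close> of iterate \<open>Suc n\<close> in
    the weighted norm, and by contraction that iterate is within \<open>M / 2 ^ n\<close> of the
    image of the limit. A positive defect would exceed the sum of the two for large
    \<open>n\<close>.\<close>
  have "B t x = \<Psi> B t x" if t: "0 \<le> t" for t x
  proof (rule ccontr)
    assume "B t x \<noteq> \<Psi> B t x"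
    then have "0 < norm (B t x - \<Psi> B t x)" by simp
    from small[OF this, of "2 * M * exp (\<kappa> * t)"] obtain n where n: "2 * M * exp (\<kappa> * t) / 2 ^ n < norm (B t x - \<Psi> B t x)" by blast
    have "norm (\<Psi> (A n) t x - \<Psi> B t x) \<le> (2 * M / 2 ^ n / 2) * exp (\<kappa> * t)"
      by (rule contr[OF BA BB t]) (use AB in auto)
    moreover have "norm (A (Suc n) t x - B t x) \<le> (2 * M / 2 ^ Suc n) * exp (\<kappa> * t)" by (rule AB[OF t])
    moreover have "norm (B t x - \<Psi> B t x) \<le> norm (A (Suc n) t x - B t x) + norm (\<Psi> (A n) t x - \<Psi> B t x)"
      using norm_triangle_ineq4[of "\<Psi> (A n) t x - \<Psi> B t x" "A (Suc n) t x - B t x"] by (simp add: AS)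
    ultimately show False using n by simp
  qed
  then show ?thesis using that[OF BB] by (simp add: \<Psi>_def)
qed

section \<open>The cubic nonlinearity and regularity of the truncated flow\<close>

text \<open>A polynomial in \<open>z\<close> and \<open>cnj z\<close>, so that the closure
  properties of \<open>BUC\<close> and the product rule apply directly; \<open>ginzburg_eq\<close>
  returns to the modulus.\<close>

definition ginzburg :: "complex \<Rightarrow> complex" where
  "ginzburg z = z - z * (z * cnj z)"

lemma ginzburg_eq: "ginzburg z = z - z * complex_of_real ((cmod z)\<^sup>2)"
  by (simp only: ginzburg_def complex_norm_square)

text \<open>The metric projection onto the disc is nonexpansive, which makes the truncated
  nonlinearity globally Lipschitz. It is not differentiable across the circle of radius 2, so
  further space regularity is extracted only where it acts as the identity.\<close>

definition trunc :: "complex \<Rightarrow> complex" where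
  "trunc z = closest_point (cball 0 2) z"

lemma trunc_props: "norm (trunc z) \<le> 2" "norm (trunc z - trunc w) \<le> norm (z - w)" "norm z \<le> 2 \<Longrightarrow> trunc z = z"
proof -
  have S: "convex (cball (0 :: complex) 2)" "closed (cball (0 :: complex) 2)" "cball (0 :: complex) 2 \<noteq> {}" by auto
  show "norm (trunc z) \<le> 2" using closest_point_in_set[OF S(2,3), of z] by (simp add: trunc_def)
  show "norm (trunc z - trunc w) \<le> norm (z - w)"
    using closest_point_lipschitz[OF S, of z w] by (simp add: trunc_def dist_norm)
  show "norm z \<le> 2 \<Longrightarrow> trunc z = z" by (simp add: trunc_def closest_point_self)
qed

text \<open>The cubic difference is telescoped one factor at a time into three terms, each with two
  factors of modulus at most 2; together with the linear term this gives
  \<open>1 + 3 * 4 = 13\<close>.\<close>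

lemma ginzburg_lipschitz:
  assumes "norm z \<le> 2" "norm w \<le> 2"
  shows "norm (ginzburg z - ginzburg w) \<le> 13 * norm (z - w)"
proof -
  have "ginzburg z - ginzburg w = (z - w) - ((z - w) * (z * cnj z) + (w * (z - w)) * cnj z + (w * w) * cnj (z - w))"
    by (simp add: ginzburg_def algebra_simps)
  also have "norm \<dots> \<le> norm (z - w) + (norm ((z - w) * (z * cnj z)) + norm ((w * (z - w)) * cnj z) + norm ((w * w) * cnj (z - w)))"
    by (intro order_trans[OF norm_triangle_ineq4] add_left_mono order_trans[OF norm_triangle_ineq] add_right_mono norm_triangle_ineq)
  also have "\<dots> = norm (z - w) * (1 + norm z * norm z + norm w * norm z + norm w * norm w)"
    by (simp only: norm_mult complex_mod_cnj) (simp add: algebra_simps)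
  also have "\<dots> \<le> norm (z - w) * (1 + 2 * 2 + 2 * 2 + 2 * 2)"
    using assms by (intro mult_left_mono add_mono mult_mono) auto
  finally show ?thesis by simp
qed

lemma ginzburg_trunc_lipschitz: "norm (ginzburg (trunc z) - ginzburg (trunc w)) \<le> 13 * norm (z - w)"
  using ginzburg_lipschitz[OF trunc_props(1) trunc_props(1), of z w] trunc_props(2)[of z w] by linarith

text \<open>Two formulas for \<open>Ax\<close> are compared. The first moves the derivative to the
  kernel and asks nothing of the truncated source \<open>g\<close>. As long as the modulus of
  \<open>A\<close> stays at most 2, \<open>g\<close> is the smooth \<open>ginzburg A\<close>, whose
  space derivative \<open>Gx\<close> follows from the first formula; this gives the second one, with
  \<open>Gx\<close> as source, which can be differentiated again. \<open>Axx\<close> is defined for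
  all times, but is identified as a second derivative only on such intervals, hence the conditional
  form of the last two conclusions.\<close>

lemma truncated_solution:
  assumes f: "uniformly_continuous_on UNIV f" "bounded (range f)"
    and f': "uniformly_continuous_on UNIV f'" "bounded (range f')"
    and f'': "uniformly_continuous_on UNIV f''" "bounded (range f'')"
    and df: "\<And>x. (f has_vector_derivative f' x) (at x)" "\<And>x. (f' has_vector_derivative f'' x) (at x)"
  obtains A Ax Axx where "BUC A" "BUC Ax" "BUC Axx" "\<And>x. A 0 x = f x" "\<And>x. Ax 0 x = f' x"
    "\<And>t x. 0 \<le> t \<Longrightarrow> (A t has_vector_derivative Ax t x) (at x)"
    "\<And>T t x. (\<And>s y. s \<in> {0..T} \<Longrightarrow> cmod (A s y) \<le> 2) \<Longrightarrow> t \<in> {0..T} \<Longrightarrow> (Ax t has_vector_derivative Axx t x) (at x)"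
    "\<And>T t x. (\<And>s y. s \<in> {0..T} \<Longrightarrow> cmod (A s y) \<le> 2) \<Longrightarrow> t \<in> {0..T} \<Longrightarrow>
      ((\<lambda>s. A s x) has_vector_derivative Axx t x + ginzburg (A t x)) (at t within {0..T})"
proof -
  obtain A where A: "BUC A" "\<And>t x. 0 \<le> t \<Longrightarrow> A t x = heat f t x + duhamel (\<lambda>s y. ginzburg (trunc (A s y))) t x"
    using mild_solution_exists[OF f _ ginzburg_trunc_lipschitz] by auto
  note cf = uniformly_continuous_imp_continuous[OF f(1)] uniformly_continuous_imp_continuous[OF f'(1)] uniformly_continuous_imp_continuous[OF f''(1)]
  define g where "g s y = ginzburg (trunc (A s y))" for s y
  have g: "BUC g" unfolding g_def[abs_def] by (rule BUC_lipschitz[OF A(1) _ ginzburg_trunc_lipschitz]) simp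
  define Ax where "Ax t x = heat f' t x + duhamel_x g t x" for t x
  define G where "G s y = ginzburg (A s y)" for s y
  define Gx where "Gx s y = Ax s y - (Ax s y * (A s y * cnj (A s y)) + A s y * (Ax s y * cnj (A s y) + A s y * cnj (Ax s y)))" for s y
  define Axx where "Axx t x = heat f'' t x + duhamel_x Gx t x" for t x
  have BAx: "BUC Ax" unfolding Ax_def[abs_def] by (intro BUC_add BUC_heat f' BUC_duhamel_x g)
  have BG: "BUC G" unfolding G_def[abs_def] ginzburg_def by (intro BUC_diff BUC_mult BUC_cnj A)
  have BGx: "BUC Gx" unfolding Gx_def[abs_def] by (intro BUC_diff BUC_add BUC_mult BUC_cnj A BAx)
  have BAxx: "BUC Axx" unfolding Axx_def[abs_def] by (intro BUC_add BUC_heat f'' BUC_duhamel_x BGx)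
  have h0: "heat h 0 x = h x" for h x by (simp add: heat_def integral_gauss)
  have A0: "A 0 x = f x" "Ax 0 x = f' x" for x
    using A(2)[of 0 x] by (simp_all add: h0 duhamel_def Ax_def duhamel_x_def)
  have Aeq: "A t = (\<lambda>x. heat f t x + duhamel g t x)" if "0 \<le> t" for t
    using A(2)[OF that] by (simp add: g_def[abs_def] fun_eq_iff)
  have dA: "(A t has_vector_derivative Ax t x) (at x)" if t: "0 \<le> t" for t x
    unfolding Aeq[OF t] Ax_def
    by (intro has_vector_derivative_add heat_space_derivative cf f(2) f'(2) df duhamel_has_space_derivative g t)
  have dG: "(G s has_vector_derivative Gx s y) (at y)" if "0 \<le> s" for s y
  proof -
    note d = dA[OF that, of y]
    have c: "((\<lambda>x. cnj (A s x)) has_vector_derivative cnj (Ax s y)) (at y)"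
      by (rule bounded_linear.has_vector_derivative[OF bounded_linear_cnj d])
    show ?thesis unfolding G_def[abs_def] Gx_def ginzburg_def
      by (rule has_vector_derivative_eq_rhs, (rule has_vector_derivative_diff has_vector_derivative_mult d c)+)
         (simp add: algebra_simps)
  qed
  have main: "(Ax t has_vector_derivative Axx t x) (at x) \<and>
      ((\<lambda>s. A s x) has_vector_derivative Axx t x + ginzburg (A t x)) (at t within {0..T})"
    if small: "\<And>s y. s \<in> {0..T} \<Longrightarrow> cmod (A s y) \<le> 2" and t: "t \<in> {0..T}" for T t x
  proof
    have gG: "g s y = G s y" if "s \<in> {0..T}" for s y
      using small[OF that] by (simp add: g_def G_def trunc_props)
    have AG: "A s = (\<lambda>x. heat f s x + duhamel G s x)" if "s \<in> {0..T}" for s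
      using Aeq[of s] duhamel_cong(1)[of s g G] gG that by (auto simp: fun_eq_iff)
    \<comment> \<open>Both sides are derivatives of \<open>A s\<close> at \<open>y\<close>, so they
      coincide by uniqueness.\<close>
    have "Ax s y = heat f' s y + duhamel Gx s y" if s: "s \<in> {0..T}" for s y
    proof -
      have "(A s has_vector_derivative heat f' s y + duhamel Gx s y) (at y)"
        unfolding AG[OF s] using s
        by (intro has_vector_derivative_add heat_space_derivative cf f(2) f'(2) df duhamel_C1_space_derivative BG BGx dG) auto
      then show ?thesis using dA[of s y] s vector_derivative_unique_at by fastforce
    qed
    then have Axt: "Ax t = (\<lambda>y. heat f' t y + duhamel Gx t y)" using t by auto
    show "(Ax t has_vector_derivative Axx t x) (at x)"
      unfolding Axt Axx_def using t
      by (intro has_vector_derivative_add heat_space_derivative cf f'(2) f''(2) df duhamel_has_space_derivative BGx) auto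
    \<comment> \<open>The time identities for \<open>heat\<close> and \<open>duhamel\<close> add up
      to an integral equation with continuous integrand \<open>Axx + G\<close>; the fundamental
      theorem then includes the one-sided derivative at time 0.\<close>
    have "((\<lambda>s. A s x) has_vector_derivative Axx t x + G t x) (at t within {0..T})"
    proof (rule has_vector_derivative_from_integral[OF _ _ t])
      have slice: "continuous_on {0..T} (\<lambda>s. h s x)" if "BUC h" for h
      proof -
        have "continuous_on {0..T} (\<lambda>s. (s, x))" by (intro continuous_intros)
        from continuous_on_compose2[OF uniformly_continuous_imp_continuous[OF BUCD[OF that, of T]] this]
        show ?thesis by (simp add: image_subset_iff)
      qed
      show "continuous_on {0..T} (\<lambda>t. Axx t x + G t x)" by (intro continuous_on_add slice BAxx BG)
      fix b assume b: "b \<in> {0..T}"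
      have ib: "integrable lborel (\<lambda>s. indicator {0..b} s *\<^sub>R h s x)" if "BUC h" for h
        using borel_integrable_atLeastAtMost'[OF continuous_on_subset[OF slice[OF that]], of 0 b] b
        by (simp add: set_integrable_def)
      have "A b x - A 0 x = (heat f b x - f x) + duhamel G b x"
        using AG[OF b] A0 by simp
      also have "heat f b x - f x = (\<integral>s. indicator {0..b} s *\<^sub>R heat f'' s x \<partial>lborel)"
        using b by (intro heat_time_identity[OF cf(1) f(2) cf(2) f'(2) cf(3) f''(2) df]) auto
      also have "duhamel G b x = (\<integral>s. indicator {0..b} s *\<^sub>R (duhamel_x Gx s x + G s x) \<partial>lborel)"
        using b by (intro duhamel_time_identity BG BGx dG) auto
      also have "(\<integral>s. indicator {0..b} s *\<^sub>R heat f'' s x \<partial>lborel) + \<dots> = (\<integral>s. indicator {0..b} s *\<^sub>R heat f'' s x + indicator {0..b} s *\<^sub>R (duhamel_x Gx s x + G s x) \<partial>lborel)"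
        by (rule Bochner_Integration.integral_add[symmetric]; rule ib; intro BUC_add BUC_heat f'' BUC_duhamel_x BGx BG)
      also have "\<dots> = (\<integral>s. indicator {0..b} s *\<^sub>R (Axx s x + G s x) \<partial>lborel)"
        by (simp add: Axx_def scaleR_add_right add.assoc)
      finally show "A b x - A 0 x = (\<integral>s. indicator {0..b} s *\<^sub>R (Axx s x + G s x) \<partial>lborel)" .
    qed
    then show "((\<lambda>s. A s x) has_vector_derivative Axx t x + ginzburg (A t x)) (at t within {0..T})" by (simp add: G_def)
  qed
  show ?thesis
    by (rule that[OF A(1) BAx BAxx A0 dA]) (use main in blast)+
qed

section \<open>Classical solutions and the continuity argument\<close>

lemma iter_vderiv_0: "iter_vderiv 0 f = f"
  by (simp add: iter_vderiv_def)

lemma iter_vderiv_Suc: "iter_vderiv (Suc j) f x = vector_derivative (iter_vderiv j f) (at x)"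
  by (simp add: iter_vderiv_def)

lemma iter_vderiv_eq:
  assumes "\<And>j x. j < m \<Longrightarrow> (D j has_vector_derivative D (Suc j) x) (at x)" and "j \<le> m"
  shows "iter_vderiv j (D 0) = D j"
  using assms(2)
proof (induction j)
  case (Suc j)
  then have "iter_vderiv j (D 0) = D j" by simp
  then show ?case
    using vector_derivative_at[OF assms(1)[of j]] Suc.prems by (auto simp: iter_vderiv_Suc)
qed (simp add: iter_vderiv_0)

lemma C_ub_I:
  fixes D :: "nat \<Rightarrow> real \<Rightarrow> complex"
  assumes "\<And>j x. j < m \<Longrightarrow> (D j has_vector_derivative D (Suc j) x) (at x)"
    and "\<And>j. j \<le> m \<Longrightarrow> bounded (range (D j)) \<and> uniformly_continuous_on UNIV (D j)"
  shows "D 0 \<in> C_ub m"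
  unfolding C_ub_def using iter_vderiv_eq[of m D, OF assms(1)] assms
  by (auto intro: differentiableI_vector)

lemma W_norm_le:
  fixes D :: "nat \<Rightarrow> real \<Rightarrow> complex"
  assumes "\<And>j x. j < m \<Longrightarrow> (D j has_vector_derivative D (Suc j) x) (at x)"
    and bd: "\<And>j x. j \<le> m \<Longrightarrow> norm (D j x) \<le> e"
  shows "W_norm m (D 0) \<le> e" "0 \<le> W_norm m (D 0)"
proof -
  have eq: "(SUP x. norm (iter_vderiv j (D 0) x)) = (SUP x. norm (D j x))" if "j \<le> m" for j
    by (simp add: iter_vderiv_eq[of m D, OF assms(1) that])
  have W: "W_norm m (D 0) = (MAX j\<in>{..m}. SUP x. norm (D j x))"
    unfolding W_norm_def using eq by (intro arg_cong[where f = Max] image_cong) auto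
  show "W_norm m (D 0) \<le> e" unfolding W using bd by (subst Max_le_iff) (auto intro!: cSUP_least)
  have "0 \<le> norm (D 0 0)" by simp
  also have "\<dots> \<le> (SUP x. norm (D 0 x))" by (rule cSUP_upper) (use bd[of 0] in \<open>auto intro!: bdd_aboveI2[where M = e]\<close>)
  also have "\<dots> \<le> W_norm m (D 0)" unfolding W by (rule Max_ge) auto
  finally show "0 \<le> W_norm m (D 0)" .
qed

lemma C_ub_derivatives:
  assumes v: "v \<in> C_ub m" and j: "j \<le> m"
  shows "uniformly_continuous_on UNIV (iter_vderiv j v)" "bounded (range (iter_vderiv j v))"
    "norm (iter_vderiv j v x) \<le> W_norm m v"
proof -
  have b: "bounded (range (iter_vderiv j v))" using v j by (simp add: C_ub_def)
  then show "uniformly_continuous_on UNIV (iter_vderiv j v)" "bounded (range (iter_vderiv j v))"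
    using v j by (simp_all add: C_ub_def)
  have "norm (iter_vderiv j v x) \<le> (SUP x. norm (iter_vderiv j v x))"
  proof (rule cSUP_upper)
    obtain B where "\<forall>y\<in>range (iter_vderiv j v). norm y \<le> B" using b unfolding bounded_iff by blast
    then show "bdd_above (range (\<lambda>x. norm (iter_vderiv j v x)))" by (intro bdd_aboveI2[where M = B]) auto
  qed simp
  also have "\<dots> \<le> W_norm m v" unfolding W_norm_def using j by (intro Max_ge) auto
  finally show "norm (iter_vderiv j v x) \<le> W_norm m v" .
qed

lemma C_ub_has_derivative:
  assumes "v \<in> C_ub m" "j < m"
  shows "(iter_vderiv j v has_vector_derivative iter_vderiv (Suc j) v x) (at x)"
  using assms by (auto simp: C_ub_def iter_vderiv_Suc[abs_def] vector_derivative_works[symmetric])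

lemma BUC_uniform_in_time:
  assumes "BUC g" "0 \<le> t" "0 < e"
  obtains d where "0 < d" "d \<le> 1" "\<And>s x. 0 \<le> s \<Longrightarrow> \<bar>s - t\<bar> < d \<Longrightarrow> norm (g s x - g t x) < e"
proof -
  obtain d where d: "0 < d" "\<And>p p'. p \<in> {0..t + 1} \<times> UNIV \<Longrightarrow> p' \<in> {0..t + 1} \<times> UNIV \<Longrightarrow> dist p' p < d \<Longrightarrow> dist (case_prod g p') (case_prod g p) < e"
    using BUCD[OF assms(1), of "t + 1"] assms(3) unfolding uniformly_continuous_on_def by metis
  have "norm (g s x - g t x) < e" if "0 \<le> s" "\<bar>s - t\<bar> < min d 1" for s x
    using d(2)[of "(t, x)" "(s, x)"] that assms(2) by (auto simp: dist_Pair_Pair dist_norm)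
  with d(1) show ?thesis using that[of "min d 1"] by simp
qed

lemma C0_time_I:
  fixes D :: "nat \<Rightarrow> real \<Rightarrow> real \<Rightarrow> complex"
  assumes D: "\<And>j. j \<le> m \<Longrightarrow> BUC (D j)"
    and der: "\<And>j t x. j < m \<Longrightarrow> 0 \<le> t \<Longrightarrow> (D j t has_vector_derivative D (Suc j) t x) (at x)"
  shows "D 0 \<in> C0_time m"
  unfolding C0_time_def
proof (intro CollectI conjI allI impI)
  fix t :: real assume t: "0 \<le> t"
  show "D 0 t \<in> C_ub m"
    using C_ub_I[of m "\<lambda>j. D j t"] der t BUC_slice[OF D t] by blast
  show "((\<lambda>s. W_norm m (\<lambda>x. D 0 s x - D 0 t x)) \<longlongrightarrow> 0) (at t within {0..})"
    unfolding tendsto_iff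
  proof (intro allI impI)
    fix e :: real assume e: "0 < e"
    \<comment> \<open>A supremum preserves only non-strict bounds; aiming at \<open>e / 2\<close>
      keeps the final inequality strict.\<close>
    have "\<forall>j\<in>{..m}. \<exists>d>0. \<forall>s x. 0 \<le> s \<longrightarrow> \<bar>s - t\<bar> < d \<longrightarrow> norm (D j s x - D j t x) < e / 2"
    proof
      fix j assume "j \<in> {..m}"
      then show "\<exists>d>0. \<forall>s x. 0 \<le> s \<longrightarrow> \<bar>s - t\<bar> < d \<longrightarrow> norm (D j s x - D j t x) < e / 2"
        using BUC_uniform_in_time[OF D[of j] t, of "e / 2"] e by (metis atMost_iff half_gt_zero)
    qed
    from bchoice[OF this] obtain d where d: "\<And>j. j \<le> m \<Longrightarrow> 0 < d j"
      "\<And>j s x. j \<le> m \<Longrightarrow> 0 \<le> s \<Longrightarrow> \<bar>s - t\<bar> < d j \<Longrightarrow> norm (D j s x - D j t x) < e / 2" by auto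
    define d0 where "d0 = Min (d ` {..m})"
    have d0: "0 < d0" "\<And>j. j \<le> m \<Longrightarrow> d0 \<le> d j" unfolding d0_def using d(1) by auto
    have "dist (W_norm m (\<lambda>x. D 0 s x - D 0 t x)) 0 < e" if s: "0 \<le> s" "\<bar>s - t\<bar> < d0" for s
    proof -
      have 1: "((\<lambda>x. D j s x - D j t x) has_vector_derivative D (Suc j) s x - D (Suc j) t x) (at x)" if "j < m" for j x
        using der[OF that s(1)] der[OF that t] by (rule has_vector_derivative_diff)
      have 2: "norm (D j s x - D j t x) \<le> e / 2" if "j \<le> m" for j x
        using d(2)[OF that s(1)] d0(2)[OF that] s(2) by (meson less_imp_le order.strict_trans2)
      from W_norm_le[of m "\<lambda>j x. D j s x - D j t x", OF 1 2] show ?thesis using e by (simp add: dist_real_def)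
    qed
    then show "\<forall>\<^sub>F s in at t within {0..}. dist (W_norm m (\<lambda>x. D 0 s x - D 0 t x)) 0 < e"
      unfolding eventually_at using d0(1) by (auto simp: dist_real_def intro!: exI[of _ d0])
  qed
qed

text \<open>Pointwise time derivatives become derivatives in the supremum norm because
  \<open>B\<close> is uniformly continuous on slabs: the map taking \<open>r\<close> to
  \<open>A r x - r *\<^sub>R B t x\<close> has derivative \<open>B r x - B t x\<close>, small
  uniformly in \<open>x\<close>, and the mean value inequality bounds the error of the difference
  quotient.\<close>

lemma C1_time_I:
  assumes A: "BUC A" and B: "BUC B"
    and der: "\<And>T t x. t \<in> {0..T} \<Longrightarrow> ((\<lambda>s. A s x) has_vector_derivative B t x) (at t within {0..T})"
  shows "A \<in> C1_time 0"
  unfolding C1_time_def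
proof (intro CollectI conjI bexI[of _ B] allI impI)
  show "A \<in> C0_time 0" "B \<in> C0_time 0" using C0_time_I[of 0 "\<lambda>_. A"] C0_time_I[of 0 "\<lambda>_. B"] A B by auto
  fix t :: real assume t: "0 \<le> t"
  show "((\<lambda>s. W_norm 0 (\<lambda>x. (A s x - A t x) /\<^sub>R (s - t) - B t x)) \<longlongrightarrow> 0) (at t within {0..})"
    unfolding tendsto_iff
  proof (intro allI impI)
    fix e :: real assume e: "0 < e"
    then have e2: "0 < e / 2" by simp
    obtain d where d: "0 < d" "\<And>s x. 0 \<le> s \<Longrightarrow> \<bar>s - t\<bar> < d \<Longrightarrow> norm (B s x - B t x) < e / 2"
      using BUC_uniform_in_time[OF B t e2] by metis
    have "dist (W_norm 0 (\<lambda>x. (A s x - A t x) /\<^sub>R (s - t) - B t x)) 0 < e"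
      if s: "0 \<le> s" "\<bar>s - t\<bar> < d" "s \<noteq> t" for s
    proof -
      have "norm ((A s x - A t x) /\<^sub>R (s - t) - B t x) \<le> e / 2" for x
      proof -
        define S where "S = {min s t..max s t}"
        have S: "convex S" "s \<in> S" "t \<in> S" by (auto simp: S_def)
        have in_S: "0 \<le> r \<and> \<bar>r - t\<bar> < d" if "r \<in> S" for r using that s t by (auto simp: S_def)
        have dd: "((\<lambda>r. A r x - r *\<^sub>R B t x) has_vector_derivative B r x - B t x) (at r within S)" if "r \<in> S" for r
        proof -
          have "((\<lambda>s. A s x) has_vector_derivative B r x) (at r within {0..max s t})"
            by (rule der) (use that in_S[OF that] in \<open>auto simp: S_def\<close>)
          then have "((\<lambda>s. A s x) has_vector_derivative B r x) (at r within S)"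
            by (rule has_vector_derivative_within_subset) (use s t in \<open>auto simp: S_def\<close>)
          then show ?thesis by (auto intro!: derivative_eq_intros)
        qed
        have "norm ((A s x - s *\<^sub>R B t x) - (A t x - t *\<^sub>R B t x)) \<le> e / 2 * \<bar>s - t\<bar>"
          by (rule vector_derivative_lipschitz[OF S(1) dd _ S(3,2)])
            (use d(2) in_S in \<open>auto intro: less_imp_le\<close>)
        moreover have "(A s x - A t x) /\<^sub>R (s - t) - B t x = ((A s x - s *\<^sub>R B t x) - (A t x - t *\<^sub>R B t x)) /\<^sub>R (s - t)"
        proof -
          have "(A s x - s *\<^sub>R B t x) - (A t x - t *\<^sub>R B t x) = (A s x - A t x) - (s - t) *\<^sub>R B t x"
            by (simp add: algebra_simps)
          moreover have "((A s x - A t x) - (s - t) *\<^sub>R B t x) /\<^sub>R (s - t) = (A s x - A t x) /\<^sub>R (s - t) - ((s - t) *\<^sub>R B t x) /\<^sub>R (s - t)"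
            by (rule scaleR_diff_right)
          moreover have "((s - t) *\<^sub>R B t x) /\<^sub>R (s - t) = B t x" using s by simp
          ultimately show ?thesis by (simp only:)
        qed
        ultimately show ?thesis using s by (simp add: divide_simps mult.commute)
      qed
      from W_norm_le[of 0 "\<lambda>_ x. (A s x - A t x) /\<^sub>R (s - t) - B t x" "e / 2", OF _ this] show ?thesis
        using e by (simp add: dist_real_def)
    qed
    then show "\<forall>\<^sub>F s in at t within {0..}. dist (W_norm 0 (\<lambda>x. (A s x - A t x) /\<^sub>R (s - t) - B t x)) 0 < e"
      unfolding eventually_at using d(1) by (auto simp: dist_real_def intro!: exI[of _ d])
  qed
qed

lemma GL_classical_solutionI:
  assumes A: "BUC A" and Ax: "BUC Ax" and Axx: "BUC Axx"
    and dx: "\<And>t x. 0 \<le> t \<Longrightarrow> (A t has_vector_derivative Ax t x) (at x)"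
    and dxx: "\<And>t x. 0 \<le> t \<Longrightarrow> (Ax t has_vector_derivative Axx t x) (at x)"
    and dt: "\<And>T t x. t \<in> {0..T} \<Longrightarrow> ((\<lambda>s. A s x) has_vector_derivative Axx t x + ginzburg (A t x)) (at t within {0..T})"
  shows "GL_classical_solution A"
proof -
  define D where "D j = (if j = 0 then A else if j = 1 then Ax else Axx)" for j :: nat
  have der: "(D j t has_vector_derivative D (Suc j) t x) (at x)" if "j < 2" "0 \<le> t" for j t x
    using that dx dxx by (auto simp: D_def less_2_cases_iff)
  have "D 0 \<in> C0_time 2" by (rule C0_time_I[of 2 D, OF _ der]) (auto simp: D_def A Ax Axx)
  then have C0: "A \<in> C0_time 2" by (simp add: D_def)
  have "BUC (\<lambda>t x. Axx t x + ginzburg (A t x))" unfolding ginzburg_def by (intro BUC_add BUC_diff BUC_mult BUC_cnj A Axx)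
  then have C1: "A \<in> C1_time 0" by (rule C1_time_I[OF A _ dt])
  have "((\<lambda>s. A s x) has_vector_derivative
       (iter_vderiv 2 (A t) x + A t x - A t x * complex_of_real ((cmod (A t x))\<^sup>2))) (at t within {0..})" if t: "0 \<le> t" for t x
  proof -
    have "iter_vderiv 2 (D 0 t) = D 2 t" by (rule iter_vderiv_eq[of 2 "\<lambda>j. D j t"]) (use der t in auto)
    then have eq: "Axx t x + ginzburg (A t x) = iter_vderiv 2 (A t) x + A t x - A t x * complex_of_real ((cmod (A t x))\<^sup>2)"
      by (simp add: D_def ginzburg_eq)
    \<comment> \<open>With the right end moved to \<open>t + 1\<close>, the interval and the half
      line agree near \<open>t\<close>, including at \<open>t = 0\<close>.\<close>
    have "at t within {0..t + 1} = at t within {0..}"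
      by (rule at_within_nhd[of _ "{..<t + 1}"]) auto
    then show ?thesis using dt[of t "t + 1" x] t unfolding eq by simp
  qed
  then show ?thesis unfolding GL_classical_solution_def using C0 C1 by blast
qed

section \<open>The a priori bound in logarithmic variables\<close>

lemma norm_exp_minus_1_le:
  fixes z :: complex
  assumes "norm z \<le> 1"
  shows "norm (exp z - 1) \<le> 3 * norm z"
proof -
  have "norm (exp z - exp 0) \<le> 3 * norm (z - 0)"
  proof (rule field_differentiable_bound[of "cball 0 1"])
    show "(exp has_field_derivative exp y) (at y within cball 0 1)" for y :: complex
      by (auto intro!: derivative_eq_intros)
    fix y :: complex assume "y \<in> cball 0 1"
    then have "Re y \<le> 1" using complex_Re_le_cmod[of y] by simp
    then have "exp (Re y) \<le> exp 1" by simp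
    then show "norm (exp y) \<le> 3" using exp_le unfolding norm_exp_eq_Re by linarith
  qed (use assms in auto)
  then show ?thesis by simp
qed

lemma continuous_on_slab:
  "BUC g \<Longrightarrow> continuous_on ({0..T} \<times> UNIV) (\<lambda>p. g (fst p) (snd p))"
  using uniformly_continuous_imp_continuous[OF BUCD] by (auto simp: case_prod_beta)

lemma has_vector_derivative_quotient:
  fixes f g :: "real \<Rightarrow> complex"
  assumes "(f has_vector_derivative f') (at x)" "(g has_vector_derivative g') (at x)" "g x \<noteq> 0"
  shows "((\<lambda>x. f x / g x) has_vector_derivative (f' * g x - f x * g') / (g x * g x)) (at x)"
  unfolding has_vector_derivative_def
  by (rule has_derivative_eq_rhs[OF has_derivative_divide'[OF assms(1,2)[unfolded has_vector_derivative_def] assms(3)]])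
    (simp add: fun_eq_iff scaleR_conv_of_real divide_inverse algebra_simps)

lemma periodic_wave_nonzero:
  assumes "q\<^sup>2 < 1"
  shows "cmod (periodic_wave q x) = sqrt (1 - q\<^sup>2)" "periodic_wave q x \<noteq> 0"
  using assms by (auto simp: periodic_wave_def norm_mult)

lemma periodic_wave_deriv:
  "(periodic_wave q has_vector_derivative (\<i> * of_real q) * periodic_wave q x) (at x)"
proof -
  have 1: "((\<lambda>x. \<i> * complex_of_real (q * x)) has_vector_derivative \<i> * of_real q) (at x)"
  proof -
    have "((\<lambda>x. q * x) has_vector_derivative q) (at x)"
      unfolding has_real_derivative_iff_has_vector_derivative[symmetric] by (auto intro!: derivative_eq_intros)
    from bounded_linear.has_vector_derivative[OF bounded_linear_of_real this]
    have "((\<lambda>x. complex_of_real (q * x)) has_vector_derivative of_real q) (at x)" .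
    from has_vector_derivative_mult_right[OF this, of \<i>] show ?thesis .
  qed
  have "((exp \<circ> (\<lambda>x. \<i> * complex_of_real (q * x))) has_vector_derivative (\<i> * of_real q) * exp (\<i> * complex_of_real (q * x))) (at x)"
    by (rule field_vector_diff_chain_at[OF 1]) (rule DERIV_exp)
  from has_vector_derivative_mult_right[OF this, of "complex_of_real (sqrt (1 - q\<^sup>2))"] show ?thesis
    by (simp add: periodic_wave_def[abs_def] comp_def mult_ac)
qed

text \<open>The threshold in \<open>near\<close> bounds the relative perturbation by
  \<open>c / 64\<close>; the logarithm at most doubles this, which stays below the
  \<open>c / 16\<close> required by \<open>polar_GL\<close>. In the conclusion, 12 is the product of
  4, the factor relating \<open>e / sqrt a\<close> to the initial size of \<open>w\<close> and
  \<open>wx\<close>, and 3, the Lipschitz constant of the exponential on the unit disc. Passing to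
  relative quantities and back cancels \<open>sqrt a\<close>.\<close>

lemma a_priori_estimate:
  fixes q :: real
  defines "c \<equiv> 2 * (1 - 3 * q\<^sup>2) / 3" and "a \<equiv> 1 - q\<^sup>2"
  assumes q: "q\<^sup>2 < 1 / 3"
    and A: "BUC A" and Ax: "BUC Ax" and Axx: "BUC Axx" and T: "0 < T"
    and dx: "\<And>t x. t \<in> {0..T} \<Longrightarrow> (A t has_vector_derivative Ax t x) (at x)"
    and dxx: "\<And>t x. t \<in> {0..T} \<Longrightarrow> (Ax t has_vector_derivative Axx t x) (at x)"
    and dt: "\<And>t x. t \<in> {0..T} \<Longrightarrow> ((\<lambda>s. A s x) has_vector_derivative Axx t x + ginzburg (A t x)) (at t within {0..T})"
    and near: "\<And>t x. t \<in> {0..T} \<Longrightarrow> cmod (A t x - periodic_wave q x) \<le> sqrt a * (c / 64)"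
    and e0: "\<And>x. cmod (A 0 x - periodic_wave q x) \<le> e" "\<And>x. cmod (Ax 0 x - \<i> * of_real q * A 0 x) \<le> 2 * e"
  shows "cmod (A T y - periodic_wave q y) \<le> 12 * sqrt (3 * pi * exp (20 / c + 6) * (1 / c + 1)) * e"
proof -
  have c: "0 < c" "c \<le> 2 / 3" using q by (auto simp: c_def)
  have a: "0 < a" "a \<le> 1" using q by (auto simp: a_def)
  define W where "W = periodic_wave q"
  have W: "cmod (W x) = sqrt a" "W x \<noteq> 0" for x
    using periodic_wave_nonzero[of q x] a by (auto simp: W_def a_def)
  define B where "B t x = A t x / W x" for t x
  have B1: "cmod (B t x - 1) \<le> c / 64" if "t \<in> {0..T}" for t x
  proof -
    have "B t x - 1 = (A t x - W x) / W x" using W(2)[of x] by (simp add: B_def diff_divide_distrib)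
    then have "cmod (B t x - 1) = cmod (A t x - W x) / sqrt a" using W by (simp add: norm_divide)
    also have "\<dots> \<le> sqrt a * (c / 64) / sqrt a" using near[OF that, of x] a by (intro divide_right_mono) (auto simp: W_def)
    finally show ?thesis using a by simp
  qed
  have ReB: "1 / 2 \<le> Re (B t x)" if "t \<in> {0..T}" for t x
    using abs_Re_le_cmod[of "B t x - 1"] B1[OF that, of x] c by (simp add: abs_le_iff)
  have Bnz: "B t x \<noteq> 0" "B t x \<notin> \<real>\<^sub>\<le>\<^sub>0" if "t \<in> {0..T}" for t x
    using ReB[OF that, of x] by (auto simp: complex_nonpos_Reals_iff)
  have Anz: "A t x \<noteq> 0" if "t \<in> {0..T}" for t x using Bnz[OF that, of x] by (auto simp: B_def)
  have Alow: "1 / cmod (A t x) \<le> 2 / sqrt a" if "t \<in> {0..T}" for t x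
  proof -
    have "1 / 2 \<le> cmod (B t x)" using ReB[OF that, of x] complex_Re_le_cmod[of "B t x"] by linarith
    then have "sqrt a / 2 \<le> cmod (A t x)" using a by (simp add: B_def norm_divide W field_simps)
    moreover have "0 < cmod (A t x)" using Anz[OF that] by simp
    ultimately have "1 / cmod (A t x) \<le> 1 / (sqrt a / 2)" using a by (intro divide_left_mono) auto
    then show ?thesis by simp
  qed
  \<comment> \<open>By \<open>ReB\<close> the quotient stays in the right half plane, so the
    principal branch is smooth along the solution and no phase jump can occur.\<close>
  define w where "w t x = Ln (B t x)" for t x
  define wx where "wx t x = Ax t x / A t x - \<i> * of_real q" for t x
  define wxx where "wxx t x = Axx t x / A t x - (Ax t x / A t x) ^ 2" for t x
  define wt where "wt t x = Axx t x / A t x + 1 - complex_of_real ((cmod (A t x))\<^sup>2)" for t x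
  have w_le: "cmod (w t x) \<le> 2 * cmod (B t x - 1)" if "t \<in> {0..T}" for t x
    using norm_Ln_le[of "B t x - 1"] B1[OF that, of x] c by (simp add: w_def)
  have w_small: "cmod (w t x) \<le> c / 32" if "t \<in> {0..T}" for t x
    using w_le[OF that, of x] B1[OF that, of x] by simp
  have expw: "exp (w t x) = B t x" if "t \<in> {0..T}" for t x using Bnz[OF that] by (simp add: w_def)
  have Asq: "(cmod (A t x))\<^sup>2 = a * exp (2 * Re (w t x))" if "t \<in> {0..T}" for t x
  proof -
    have "cmod (A t x) = sqrt a * cmod (B t x)" using W[of x] a by (simp add: B_def norm_divide)
    also have "cmod (B t x) = exp (Re (w t x))" using expw[OF that, of x] by (metis norm_exp_eq_Re)
    finally show ?thesis using a by (simp add: power_mult_distrib exp_double)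
  qed
  have dLn: "(Ln has_field_derivative inverse (B t x)) (at (B t x) within S)" if "t \<in> {0..T}" for t x S
    by (rule has_field_derivative_at_within[OF has_field_derivative_Ln[OF Bnz(2)[OF that]]])
  have d_w: "(w t has_vector_derivative wx t x) (at x)" if t: "t \<in> {0..T}" for t x
  proof -
    have "(B t has_vector_derivative (Ax t x * W x - A t x * ((\<i> * of_real q) * W x)) / (W x * W x)) (at x)"
      unfolding B_def[abs_def]
      by (rule has_vector_derivative_quotient[OF dx[OF t] periodic_wave_deriv[of q x, folded W_def] W(2)])
    from field_vector_diff_chain_at[OF this dLn[OF t]]
    have "(w t has_vector_derivative (Ax t x * W x - A t x * ((\<i> * of_real q) * W x)) / (W x * W x) * inverse (B t x)) (at x)"
      by (simp add: w_def[abs_def] comp_def)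
    moreover have "(Ax t x * W x - A t x * ((\<i> * of_real q) * W x)) / (W x * W x) * inverse (B t x) = wx t x"
      using W(2)[of x] Anz[OF t, of x] by (simp add: wx_def B_def field_simps)
    ultimately show ?thesis by simp
  qed
  have d_wx: "(wx t has_vector_derivative wxx t x) (at x)" if t: "t \<in> {0..T}" for t x
  proof -
    have "((\<lambda>x. Ax t x / A t x - \<i> * of_real q) has_vector_derivative (Axx t x * A t x - Ax t x * Ax t x) / (A t x * A t x) - 0) (at x)"
      by (intro has_vector_derivative_diff has_vector_derivative_const has_vector_derivative_quotient dx[OF t] dxx[OF t] Anz[OF t])
    moreover have "(Axx t x * A t x - Ax t x * Ax t x) / (A t x * A t x) - 0 = wxx t x"
      using Anz[OF t, of x] by (simp add: wxx_def field_simps power2_eq_square)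
    ultimately show ?thesis by (simp add: wx_def[abs_def])
  qed
  have d_wt: "((\<lambda>s. w s x) has_vector_derivative wt t x) (at t within {0..T})" if t: "t \<in> {0..T}" for t x
  proof -
    have "((\<lambda>s. inverse (W x) * A s x) has_vector_derivative inverse (W x) * (Axx t x + ginzburg (A t x))) (at t within {0..T})"
      by (rule has_vector_derivative_mult_right[OF dt[OF t]])
    then have "((\<lambda>s. B s x) has_vector_derivative inverse (W x) * (Axx t x + ginzburg (A t x))) (at t within {0..T})"
      by (simp add: B_def divide_inverse mult.commute)
    from field_vector_diff_chain_within[OF this dLn[OF t]]
    have "((\<lambda>s. w s x) has_vector_derivative inverse (W x) * (Axx t x + ginzburg (A t x)) * inverse (B t x)) (at t within {0..T})"
      by (simp add: w_def comp_def)
    moreover have "inverse (W x) * (Axx t x + ginzburg (A t x)) * inverse (B t x) = wt t x"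
      using W(2)[of x] Anz[OF t, of x] by (simp add: wt_def B_def ginzburg_eq field_simps)
    ultimately show ?thesis by simp
  qed
  obtain C1 where C1: "0 \<le> C1" "\<And>t x. t \<in> {0..T} \<Longrightarrow> cmod (A t x) \<le> C1" using BUC_bound[OF A] by metis
  obtain C2 where C2: "0 \<le> C2" "\<And>t x. t \<in> {0..T} \<Longrightarrow> cmod (Ax t x) \<le> C2" using BUC_bound[OF Ax] by metis
  obtain C3 where C3: "0 \<le> C3" "\<And>t x. t \<in> {0..T} \<Longrightarrow> cmod (Axx t x) \<le> C3" using BUC_bound[OF Axx] by metis
  define D where "D = 2 / sqrt a"
  have D: "0 \<le> D" using a by (simp add: D_def)
  \<comment> \<open>A qualitative bound: it justifies differentiating the energies under the
    integral, and \<open>pointwise_bound\<close> does not depend on it.\<close>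
  define K where "K = 1 + \<bar>q\<bar> + C2 * D + C3 * D + (C2 * D)\<^sup>2 + C1\<^sup>2"
  have Knn: "0 \<le> C2 * D" "0 \<le> C3 * D" "0 \<le> (C2 * D)\<^sup>2" "0 \<le> C1\<^sup>2" using D C2 C3 by auto
  have quot: "cmod (Ax t x / A t x) \<le> C2 * D" "cmod (Axx t x / A t x) \<le> C3 * D" if t: "t \<in> {0..T}" for t x
    using mult_mono[OF C2(2)[OF t, of x] Alow[OF t, of x]] mult_mono[OF C3(2)[OF t, of x] Alow[OF t, of x]] C2(1) C3(1)
    by (auto simp: norm_divide D_def)
  have bw: "cmod (w t x) \<le> K" "cmod (wx t x) \<le> K" "cmod (wxx t x) \<le> K" "cmod (wt t x) \<le> K" if t: "t \<in> {0..T}" for t x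
  proof -
    show "cmod (w t x) \<le> K" using w_small[OF t, of x] c Knn abs_ge_zero[of q] unfolding K_def by linarith
    have "cmod (wx t x) \<le> cmod (Ax t x / A t x) + cmod (\<i> * of_real q)" unfolding wx_def by (rule norm_triangle_ineq4)
    also have "cmod (\<i> * of_real q) = \<bar>q\<bar>" by (simp add: norm_mult)
    finally show "cmod (wx t x) \<le> K" using quot(1)[OF t, of x] Knn unfolding K_def by linarith
    have "cmod (wxx t x) \<le> cmod (Axx t x / A t x) + cmod ((Ax t x / A t x)\<^sup>2)" unfolding wxx_def by (rule norm_triangle_ineq4)
    moreover have "cmod ((Ax t x / A t x)\<^sup>2) \<le> (C2 * D)\<^sup>2" unfolding norm_power using quot(1)[OF t, of x] by (rule power_mono) simp
    ultimately show "cmod (wxx t x) \<le> K" using quot(2)[OF t, of x] Knn abs_ge_zero[of q] unfolding K_def by linarith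
    have "cmod (wt t x) \<le> cmod (Axx t x / A t x + 1) + cmod (complex_of_real ((cmod (A t x))\<^sup>2))" unfolding wt_def by (rule norm_triangle_ineq4)
    moreover have "cmod (complex_of_real ((cmod (A t x))\<^sup>2)) \<le> C1\<^sup>2"
      unfolding norm_of_real using C1(2)[OF t, of x] by (simp add: power_mono)
    moreover have "cmod (Axx t x / A t x + 1) \<le> C3 * D + 1" using quot(2)[OF t, of x] norm_triangle_ineq[of "Axx t x / A t x" 1] by simp
    ultimately show "cmod (wt t x) \<le> K" using Knn abs_ge_zero[of q] unfolding K_def by linarith
  qed
  have nz: "\<forall>p\<in>{0..T} \<times> UNIV. A (fst p) (snd p) \<noteq> 0" using Anz by (auto simp: mem_Times_iff)
  note sl = continuous_on_slab[OF A, of T] continuous_on_slab[OF Ax, of T] continuous_on_slab[OF Axx, of T]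
  have cw: "continuous_on ({0..T} \<times> UNIV) (\<lambda>p. wx (fst p) (snd p))" "continuous_on ({0..T} \<times> UNIV) (\<lambda>p. wxx (fst p) (snd p))"
    "continuous_on ({0..T} \<times> UNIV) (\<lambda>p. wt (fst p) (snd p))"
    unfolding wx_def wxx_def wt_def by (intro continuous_intros sl nz)+
  have strip: "smooth_strip T K (\<lambda>t x. P (w t x)) (\<lambda>t x. P (wx t x)) (\<lambda>t x. P (wxx t x)) (\<lambda>t x. P (wt t x))"
    if P: "bounded_linear P" and Pn: "\<And>z. \<bar>P z\<bar> \<le> cmod z" for P :: "complex \<Rightarrow> real"
  proof
    fix t x assume t: "t \<in> {0..T}"
    note bl = bounded_linear.has_vector_derivative[OF P]
    show "((\<lambda>x. P (w t x)) has_real_derivative P (wx t x)) (at x)" "((\<lambda>x. P (wx t x)) has_real_derivative P (wxx t x)) (at x)"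
      "((\<lambda>s. P (w s x)) has_real_derivative P (wt t x)) (at t within {0..T})"
      unfolding has_real_derivative_iff_has_vector_derivative
      using bl[OF d_w[OF t]] bl[OF d_wx[OF t]] bl[OF d_wt[OF t]] by auto
    show "\<bar>P (w t x)\<bar> \<le> K" "\<bar>P (wx t x)\<bar> \<le> K" "\<bar>P (wxx t x)\<bar> \<le> K" "\<bar>P (wt t x)\<bar> \<le> K"
      using bw[OF t, of x] Pn order_trans by blast+
  next
    note cp = bounded_linear.continuous_on[OF P]
    show "continuous_on ({0..T} \<times> UNIV) (\<lambda>(t, x). P (wx t x))" "continuous_on ({0..T} \<times> UNIV) (\<lambda>(t, x). P (wxx t x))"
      "continuous_on ({0..T} \<times> UNIV) (\<lambda>(t, x). P (wt t x))"
      unfolding case_prod_beta using cp[OF cw(1)] cp[OF cw(2)] cp[OF cw(3)] by auto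
  qed
  interpret polar_GL q T K "\<lambda>t x. Re (w t x)" "\<lambda>t x. Re (wx t x)" "\<lambda>t x. Re (wxx t x)" "\<lambda>t x. Re (wt t x)"
    "\<lambda>t x. Im (w t x)" "\<lambda>t x. Im (wx t x)" "\<lambda>t x. Im (wxx t x)" "\<lambda>t x. Im (wt t x)" c
  proof (intro polar_GL.intro polar_GL_axioms.intro strip bounded_linear_Re bounded_linear_Im abs_Re_le_cmod abs_Im_le_cmod q T)
    show "c = 2 * (1 - 3 * q\<^sup>2) / 3" by (simp add: c_def)
    fix t x assume t: "t \<in> {0..T}"
    have "cmod (w t x) \<le> c / 16" using w_small[OF t, of x] c by simp
    then have "(cmod (w t x))\<^sup>2 \<le> (c / 16)\<^sup>2" by (rule power_mono) simp
    then show "(Re (w t x))\<^sup>2 + (Im (w t x))\<^sup>2 \<le> (c / 16)\<^sup>2" by (simp add: cmod_power2)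
    \<comment> \<open>Since \<open>Ax / A = wx + \<i> * q\<close>, its square supplies the drift
      \<open>2 * \<i> * q * wx\<close>, the quadratic term and \<open>- q\<^sup>2\<close>. The last
      combines with \<open>1\<close> to the amplitude \<open>a\<close> of the wave, and the squared
      modulus of \<open>A\<close> is \<open>a * exp (2 * Re w)\<close>.\<close>
    have eq: "wt t x = wxx t x + 2 * \<i> * of_real q * wx t x + (wx t x)\<^sup>2 + of_real ((1 - q\<^sup>2) * (1 - exp (2 * Re (w t x))))"
    proof -
      have "wt t x = wxx t x + (wx t x + \<i> * of_real q)\<^sup>2 + 1 - of_real ((cmod (A t x))\<^sup>2)"
        by (simp add: wt_def wxx_def wx_def)
      also have "(cmod (A t x))\<^sup>2 = (1 - q\<^sup>2) * exp (2 * Re (w t x))" using Asq[OF t, of x] by (simp add: a_def)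
      finally show ?thesis by (simp add: power2_eq_square algebra_simps)
    qed
    show "Re (wt t x) = Re (wxx t x) - 2 * q * Im (wx t x) + (Re (wx t x))\<^sup>2 - (Im (wx t x))\<^sup>2 + (1 - q\<^sup>2) * (1 - exp (2 * Re (w t x)))"
      unfolding eq by (simp add: power2_eq_square)
    show "Im (wt t x) = Im (wxx t x) + 2 * q * Re (wx t x) + 2 * Re (wx t x) * Im (wx t x)"
      unfolding eq by (simp add: power2_eq_square)
  qed
  have z: "0 \<in> {0..T}" "T \<in> {0..T}" using T by auto
  have e: "0 \<le> e" using e0(1)[of 0] norm_ge_zero order_trans by blast
  have "cmod (w 0 x) \<le> 4 * e / sqrt a" for x
  proof -
    have "B 0 x - 1 = (A 0 x - W x) / W x" using W(2)[of x] by (simp add: B_def diff_divide_distrib)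
    then have "cmod (B 0 x - 1) \<le> e / sqrt a" using e0(1)[of x] W a by (simp add: norm_divide W_def divide_right_mono)
    moreover have "0 \<le> e / sqrt a" using e a by simp
    ultimately show ?thesis using w_le[OF z(1), of x] by simp
  qed
  then have i1: "(Re (w 0 x))\<^sup>2 + (Im (w 0 x))\<^sup>2 \<le> (4 * e / sqrt a)\<^sup>2" for x
    using power_mono[of "cmod (w 0 x)" "4 * e / sqrt a" 2] by (simp add: cmod_power2)
  have "cmod (wx 0 x) \<le> 4 * e / sqrt a" for x
  proof -
    have "wx 0 x = (Ax 0 x - \<i> * of_real q * A 0 x) / A 0 x" using Anz[OF z(1), of x] by (simp add: wx_def diff_divide_distrib)
    then have "cmod (wx 0 x) = cmod (Ax 0 x - \<i> * of_real q * A 0 x) * (1 / cmod (A 0 x))" by (simp add: norm_divide)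
    also have "\<dots> \<le> (2 * e) * (2 / sqrt a)" using e0(2)[of x] Alow[OF z(1), of x] e by (intro mult_mono) auto
    finally show ?thesis by simp
  qed
  then have i2: "(Re (wx 0 x))\<^sup>2 + (Im (wx 0 x))\<^sup>2 \<le> (4 * e / sqrt a)\<^sup>2" for x
    using power_mono[of "cmod (wx 0 x)" "4 * e / sqrt a" 2] by (simp add: cmod_power2)
  define Q where "Q = 3 * pi * exp (20 / c + 6) * (1 / c + 1)"
  have Q: "0 \<le> Q" using c by (simp add: Q_def)
  have "(cmod (w T y))\<^sup>2 \<le> Q * (4 * e / sqrt a)\<^sup>2"
    using pointwise_bound[OF i1 i2, of y] by (simp add: cmod_power2 Q_def)
  also have "\<dots> = (sqrt Q * (4 * e / sqrt a))\<^sup>2"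
    unfolding power_mult_distrib[of "sqrt Q"] using Q by simp
  finally have wT: "cmod (w T y) \<le> sqrt Q * (4 * e / sqrt a)"
    by (rule power2_le_imp_le) (use Q e a in simp)
  have "cmod (B T y - 1) \<le> 3 * cmod (w T y)"
    using norm_exp_minus_1_le[of "w T y"] w_small[OF z(2), of y] c expw[OF z(2), of y] by simp
  then have "cmod (B T y - 1) \<le> 3 * (sqrt Q * (4 * e / sqrt a))" using wT by linarith
  moreover have "A T y - W y = W y * (B T y - 1)" using W(2)[of y] by (simp add: B_def right_diff_distrib)
  then have "cmod (A T y - W y) = sqrt a * cmod (B T y - 1)" using W by (simp add: norm_mult)
  ultimately have "cmod (A T y - W y) \<le> sqrt a * (3 * (sqrt Q * (4 * e / sqrt a)))"
    using mult_left_mono[of "cmod (B T y - 1)" "3 * (sqrt Q * (4 * e / sqrt a))" "sqrt a"] a by (simp only: real_sqrt_ge_zero less_imp_le)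
  also have "\<dots> = 12 * sqrt Q * e" using a by simp
  finally show ?thesis by (simp add: W_def Q_def)
qed

section \<open>Global solutions that stay near the wave\<close>

lemma periodic_wave_uniformly_continuous:
  assumes "q\<^sup>2 < 1"
  shows "uniformly_continuous_on UNIV (periodic_wave q)"
proof (rule lipschitz_on_uniformly_continuous, rule lipschitz_onI)
  show "0 \<le> \<bar>q\<bar> * sqrt (1 - q\<^sup>2)" using assms by simp
  have "norm (\<i> * complex_of_real q * periodic_wave q x) \<le> \<bar>q\<bar> * sqrt (1 - q\<^sup>2)" for x
    using periodic_wave_nonzero(1)[OF assms, of x] by (simp add: norm_mult)
  from vector_derivative_lipschitz[OF convex_UNIV periodic_wave_deriv this]
  show "dist (periodic_wave q x) (periodic_wave q y) \<le> \<bar>q\<bar> * sqrt (1 - q\<^sup>2) * dist x y" for x y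
    by (simp add: dist_norm)
qed

theorem theorem1p1:
  fixes q :: real
  assumes "q\<^sup>2 < 1 / 3"
  shows "\<exists>M\<^sub>0 > 0. \<exists>\<epsilon>\<^sub>0 > 0. \<forall>\<epsilon>. 0 < \<epsilon> \<and> \<epsilon> < \<epsilon>\<^sub>0 \<longrightarrow>
    (\<forall>v\<^sub>0 :: real \<Rightarrow> complex. v\<^sub>0 \<in> C_ub 2 \<and> W_norm 2 v\<^sub>0 < \<epsilon> \<longrightarrow>
      (\<exists>A :: real \<Rightarrow> real \<Rightarrow> complex.
         GL_classical_solution A \<and>
         (\<forall>x. A 0 x = periodic_wave q x + v\<^sub>0 x) \<and>
         (\<forall>t\<ge>0. (SUP x. cmod (A t x - periodic_wave q x)) \<le> M\<^sub>0 * \<epsilon>)))"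
proof -
  define c where "c = 2 * (1 - 3 * q\<^sup>2) / 3"
  define a where "a = 1 - q\<^sup>2"
  have c: "0 < c" "c \<le> 2 / 3" using assms by (auto simp: c_def)
  have a: "0 < a" "a \<le> 1" using assms by (auto simp: a_def)
  have q1: "q\<^sup>2 < 1" "\<bar>q\<bar> \<le> 1" using assms by (auto simp: abs_square_le_1[symmetric])
  define R where "R = sqrt (3 * pi * exp (20 / c + 6) * (1 / c + 1))"
  have R: "0 \<le> R" using c by (simp add: R_def)
  \<comment> \<open>The added 1 makes \<open>M * \<epsilon>\<close> dominate the initial
    perturbation too, so that time 0, excluded from \<open>a_priori_estimate\<close>, is
    covered.\<close>
  define M where "M = 12 * R + 1"
  have M: "1 \<le> M" using R by (simp add: M_def)
  define \<delta> where "\<delta> = sqrt a * (c / 64)"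
  have \<delta>: "0 < \<delta>" using a c by (simp add: \<delta>_def)
  have sa: "sqrt a \<le> 1" using a by simp
  have \<delta>1: "\<delta> \<le> 1" unfolding \<delta>_def using sa c a by (intro mult_le_one) auto
  define W where "W = periodic_wave q"
  define k where "k = \<i> * complex_of_real q"
  have k: "norm k \<le> 1" using q1 by (simp add: k_def norm_mult)
  have W: "norm (W x) = sqrt a" for x using periodic_wave_nonzero(1)[OF q1(1)] by (simp add: W_def a_def)
  have dW: "(W has_vector_derivative k * W x) (at x)" for x unfolding W_def k_def by (rule periodic_wave_deriv)
  have uW: "uniformly_continuous_on UNIV (\<lambda>x. r * W x)" for r
    using bounded_linear.uniformly_continuous_on[OF bounded_linear_mult_right periodic_wave_uniformly_continuous[OF q1(1)]]
    by (simp add: W_def)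
  have bW: "bounded (range (\<lambda>x. r * W x))" for r
    unfolding bounded_iff using W by (auto intro!: exI[of _ "norm r * sqrt a"] simp: norm_mult)
  \<comment> \<open>The condition on \<epsilon> means \<open>M * \<epsilon> < \<delta> / 2\<close>:
    whenever the perturbation is at most \<delta> up to some time, the a priori estimate improves
    this to less than half of \<delta> at that time.\<close>
  have sol: "\<exists>A. GL_classical_solution A \<and> (\<forall>x. A 0 x = W x + v x) \<and> (\<forall>t\<ge>0. (SUP x. cmod (A t x - W x)) \<le> M * \<epsilon>)"
    if \<epsilon>: "0 < \<epsilon>" "\<epsilon> < \<delta> / (2 * M)" and v: "v \<in> C_ub 2" "W_norm 2 v < \<epsilon>" for \<epsilon> v
  proof -
    define v1 where "v1 = iter_vderiv 1 v"
    define v2 where "v2 = iter_vderiv 2 v"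
    have v0: "iter_vderiv 0 v = v" by (simp add: iter_vderiv_0)
    have dv: "(v has_vector_derivative v1 x) (at x)" "(v1 has_vector_derivative v2 x) (at x)" for x
      using C_ub_has_derivative[OF v(1), of 0] C_ub_has_derivative[OF v(1), of 1]
      by (auto simp: v0 v1_def v2_def numeral_2_eq_2)
    note d0 = C_ub_derivatives[OF v(1), of 0, unfolded v0, simplified]
    note d1 = C_ub_derivatives[OF v(1), of 1, folded v1_def, simplified]
    note d2 = C_ub_derivatives[OF v(1), of 2, folded v2_def, simplified]
    have vs: "norm (v x) \<le> \<epsilon>" "norm (v1 x) \<le> \<epsilon>" for x
      using d0(3)[of x] d1(3)[of x] v(2) by auto
    define f where "f x = 1 * W x + v x" for x
    define f' where "f' x = k * W x + v1 x" for x
    define f'' where "f'' x = (k * k) * W x + v2 x" for x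
    have uf: "uniformly_continuous_on UNIV f" "uniformly_continuous_on UNIV f'" "uniformly_continuous_on UNIV f''"
      unfolding f_def[abs_def] f'_def[abs_def] f''_def[abs_def] by (intro uniformly_continuous_on_add uW d0 d1 d2)+
    have bf: "bounded (range f)" "bounded (range f')" "bounded (range f'')"
      unfolding f_def[abs_def] f'_def[abs_def] f''_def[abs_def] by (intro bounded_plus_comp bW d0 d1 d2)+
    have df: "(f has_vector_derivative f' x) (at x)" "(f' has_vector_derivative f'' x) (at x)" for x
    proof -
      show "(f has_vector_derivative f' x) (at x)"
        unfolding f_def[abs_def] f'_def using has_vector_derivative_add[OF dW dv(1)] by simp
      show "(f' has_vector_derivative f'' x) (at x)"
        unfolding f'_def[abs_def] f''_def mult.assoc
        by (intro has_vector_derivative_add has_vector_derivative_mult_right dW dv(2))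
    qed
    obtain A Ax Axx where BUCs: "BUC A" "BUC Ax" "BUC Axx" and init: "\<And>x. A 0 x = f x" "\<And>x. Ax 0 x = f' x"
      and dx: "\<And>t x. 0 \<le> t \<Longrightarrow> (A t has_vector_derivative Ax t x) (at x)"
      and dxx: "\<And>T t x. (\<And>s y. s \<in> {0..T} \<Longrightarrow> cmod (A s y) \<le> 2) \<Longrightarrow> t \<in> {0..T} \<Longrightarrow> (Ax t has_vector_derivative Axx t x) (at x)"
      and dt: "\<And>T t x. (\<And>s y. s \<in> {0..T} \<Longrightarrow> cmod (A s y) \<le> 2) \<Longrightarrow> t \<in> {0..T} \<Longrightarrow>
        ((\<lambda>s. A s x) has_vector_derivative Axx t x + ginzburg (A t x)) (at t within {0..T})"
      by (rule truncated_solution[OF uf(1) bf(1) uf(2) bf(2) uf(3) bf(3) df]) blast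
    \<comment> \<open>The wave has modulus \<open>sqrt a \<le> 1\<close> and \<delta> is at most 1,
      so inside the \<delta>-neighbourhood of the wave the truncation is the identity.\<close>
    have le2: "cmod (A s y) \<le> 2" if "cmod (A s y - W y) \<le> \<delta>" for s y
      using norm_triangle_sub[of "A s y" "W y"] W[of y] sa \<delta>1 that by linarith
    have init0: "cmod (A 0 x - W x) \<le> \<epsilon>" for x using vs(1)[of x] by (simp add: init f_def)
    have est: "cmod (A T y - W y) \<le> M * \<epsilon>" if T: "0 \<le> T" and near: "\<And>t x. t \<in> {0..T} \<Longrightarrow> cmod (A t x - W x) \<le> \<delta>" for T y
    proof (cases "T = 0")
      case True
      have "\<epsilon> \<le> M * \<epsilon>" using M \<epsilon> by simp
      with init0[of y] have "cmod (A 0 y - W y) \<le> M * \<epsilon>" by linarith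
      then show ?thesis using True by simp
    next
      case False
      have i2: "cmod (Ax 0 x - \<i> * of_real q * A 0 x) \<le> 2 * \<epsilon>" for x
      proof -
        \<comment> \<open>The wave is annihilated by this first-order operator, so only the
          perturbation and its derivative remain.\<close>
        have "Ax 0 x - \<i> * of_real q * A 0 x = v1 x - k * v x" by (simp add: init f_def f'_def k_def algebra_simps)
        also have "cmod \<dots> \<le> cmod (v1 x) + cmod k * cmod (v x)" by (metis norm_mult norm_triangle_ineq4)
        also have "\<dots> \<le> \<epsilon> + 1 * \<epsilon>" using vs[of x] k by (intro add_mono mult_mono) auto
        finally show ?thesis by simp
      qed
      have "cmod (A T y - periodic_wave q y) \<le> 12 * sqrt (3 * pi * exp (20 / c + 6) * (1 / c + 1)) * \<epsilon>"
        unfolding c_def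
      proof (rule a_priori_estimate[OF assms BUCs])
        show "0 < T" using T False by simp
        show "cmod (A t x - periodic_wave q x) \<le> sqrt (1 - q\<^sup>2) * (2 * (1 - 3 * q\<^sup>2) / 3 / 64)" if "t \<in> {0..T}" for t x
          using near[OF that, of x] by (simp add: \<delta>_def c_def a_def W_def)
        show "cmod (A 0 x - periodic_wave q x) \<le> \<epsilon>" for x using init0 by (simp add: W_def)
        show "(Ax t has_vector_derivative Axx t x) (at x)" if "t \<in> {0..T}" for t x
          by (rule dxx[OF _ that]) (use near le2 in blast)
        show "((\<lambda>s. A s x) has_vector_derivative Axx t x + ginzburg (A t x)) (at t within {0..T})" if "t \<in> {0..T}" for t x
          by (rule dt[OF _ that]) (use near le2 in blast)
      qed (use dx i2 in auto)
      also have "\<dots> \<le> M * \<epsilon>" using \<epsilon> by (simp add: M_def R_def)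
      finally show ?thesis by (simp add: W_def)
    qed
    have M\<epsilon>: "M * \<epsilon> < \<delta> / 2" using \<epsilon>(2) M by (simp add: field_simps)
    have near: "cmod (A t x - W x) \<le> \<delta>" if "0 \<le> t" for t x
    proof (rule ccontr)
      assume not: "\<not> cmod (A t x - W x) \<le> \<delta>"
      \<comment> \<open>The times at which the bound fails somewhere. At the infimum
        \<open>T\<close> the bound still holds and is improved by \<open>est\<close>; uniform
        continuity in time, uniform in space, then extends it to all times just after
        \<open>T\<close>, contradicting the choice of \<open>T\<close>.\<close>
      define S where "S = {t. 0 \<le> t \<and> (\<exists>x. \<delta> < cmod (A t x - W x))}"
      have "\<delta> < cmod (A t x - W x)" using not by simp
      then have "t \<in> S" using that unfolding S_def by blast
      then have S: "S \<noteq> {}" "bdd_below S" by (auto simp: S_def intro!: bdd_belowI[of _ 0])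
      define T where "T = Inf S"
      have T0: "0 \<le> T" unfolding T_def using S(1) by (rule cInf_greatest) (simp add: S_def)
      have below: "cmod (A s y - W y) \<le> \<delta>" if "0 \<le> s" "s < T" for s y
      proof -
        have "s \<notin> S" using cInf_lower[OF _ S(2), of s] that(2) unfolding T_def by auto
        then have "\<not> \<delta> < cmod (A s y - W y)" using that(1) unfolding S_def by blast
        then show ?thesis by simp
      qed
      \<comment> \<open>Continuity from the left. It requires \<open>T\<close> to be positive, which
        holds under the contrary assumption because the initial perturbation is at most \<epsilon>,
        hence below \<delta>.\<close>
      have at_T: "cmod (A T y - W y) \<le> \<delta>" for y
      proof (rule ccontr)
        assume "\<not> ?thesis"
        then have gt: "0 < cmod (A T y - W y) - \<delta>" by simp
        have "\<epsilon> \<le> M * \<epsilon>" using M \<epsilon> by simp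
        then have "\<epsilon> < \<delta>" using M\<epsilon> \<delta> by linarith
        then have "T \<noteq> 0" using gt init0[of y] by auto
        with T0 have Tp: "0 < T" by simp
        obtain d where d: "0 < d" "\<And>s x. 0 \<le> s \<Longrightarrow> \<bar>s - T\<bar> < d \<Longrightarrow> norm (A s x - A T x) < cmod (A T y - W y) - \<delta>"
          using BUC_uniform_in_time[OF BUCs(1) T0 gt] by metis
        define s where "s = max 0 (T - d / 2)"
        have s: "0 \<le> s" "s < T" "\<bar>s - T\<bar> < d" using Tp d(1) by (auto simp: s_def)
        have "cmod (A T y - W y) \<le> cmod (A s y - W y) + cmod (A s y - A T y)"
          using norm_triangle_ineq4[of "A s y - W y" "A s y - A T y"] by simp
        then show False using below[OF s(1,2), of y] d(2)[OF s(1,3), of y] by linarith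
      qed
      have near_T: "cmod (A s y - W y) \<le> \<delta>" if "s \<in> {0..T}" for s y
        using that below at_T by (cases "s = T") auto
      obtain d where d: "0 < d" "\<And>s x. 0 \<le> s \<Longrightarrow> \<bar>s - T\<bar> < d \<Longrightarrow> norm (A s x - A T x) < \<delta> / 2"
        using BUC_uniform_in_time[OF BUCs(1) T0, of "\<delta> / 2"] \<delta> by (metis half_gt_zero)
      obtain s where s: "s \<in> S" "s < T + d"
        using cInf_less_iff[OF S, of "T + d"] d(1) unfolding T_def by auto
      have "T \<le> s" unfolding T_def by (rule cInf_lower[OF s(1) S(2)])
      then have sd: "0 \<le> s" "\<bar>s - T\<bar> < d" using s(2) T0 by auto
      have "cmod (A s y - W y) \<le> \<delta>" for y
        using norm_triangle_ineq[of "A s y - A T y" "A T y - W y"] d(2)[OF sd, of y] est[OF T0 near_T, of y] M\<epsilon> by simp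
      moreover obtain y where "\<delta> < cmod (A s y - W y)" using s(1) unfolding S_def by blast
      ultimately show False using not_less by blast
    qed
    have "GL_classical_solution A"
    proof (rule GL_classical_solutionI[OF BUCs dx])
      show "(Ax t has_vector_derivative Axx t x) (at x)" if "0 \<le> t" for t x
        by (rule dxx[of t]) (use near le2 that in auto)
      show "((\<lambda>s. A s x) has_vector_derivative Axx t x + ginzburg (A t x)) (at t within {0..T})" if "t \<in> {0..T}" for T t x
        by (rule dt[OF _ that]) (use near le2 in auto)
    qed
    moreover have "(SUP x. cmod (A t x - W x)) \<le> M * \<epsilon>" if "0 \<le> t" for t
      by (rule cSUP_least) (use est[OF that] near in auto)
    ultimately show ?thesis using init by (auto simp: f_def intro!: exI[of _ A])
  qed
  have "0 < M" "0 < \<delta> / (2 * M)" using M \<delta> by auto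
  then show ?thesis using sol unfolding W_def by blast
qed

end
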